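(* Let $\lambda:\mathbb Z/2\curvearrowright\mathcal G$ be an action by automorphisms on an ample groupoid $\mathcal G$ whose unit space is a Cantor set, free on $\mathcal G^{(0)}$, and put $\mathcal H:=\mathcal G\rtimes_\lambda\mathbb Z/2$. Assume that $\mathcal G$ and $\mathcal H$ are effective, minimal, and each either almost finite or purely infinite. Let $a\in\mathbb Z/2$ be the nontrivial element and suppose that $\lambda_a\notin\mathsf D(\mathcal H)$. Then there exists $\beta\in\mathsf F(\mathcal G)$ such that $\beta\lambda_a\in\mathsf D(\mathcal H)$. If the map on abelianizations \[H_1(\iota_* ):H_1(\mathsf F(\mathcal G))\longrightarrow H_1(\mathsf F(\mathcal H))\] induced by the inclusion $\iota_*:\mathsf F(\mathcal G)\to\mathsf F(\mathcal H)$ is injective, then, for any such $\beta$, the set \[M:=\mathsf D(\mathcal G)\sqcup\mathsf D(\mathcal G)\beta\lambda_a\] coincides with the normalizer $\mathrm N(\mathsf D(\mathcal H),\mathsf D(\mathcal G))$ of $\mathsf D(\mathcal G)$ in $\mathsf D(\mathcal H)$. In particular, $M$ is independent of the choice of $\beta$, is a maximal subgroup of $\mathsf D(\mathcal H)$, and contains $\mathsf D(\mathcal G)$ as a normal subgroup of index $2$.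
   Context: Groupoids. An étale groupoid is a second countable locally compact Hausdorff topological groupoid whose range map is a local homeomorphism; $\mathcal G^{(0)}$ is the unit space, $s(g)=g^{-1}g$, $r(g)=gg^{-1}$. It is ample if $\mathcal G^{(0)}$ is totally disconnected. A bisection is a subset on which $r$ and $s$ are injective. $\mathcal G$ is minimal if every orbit $r(s^{-1}(x))$ is dense in $\mathcal G^{(0)}$; effective if the interior of $\{g\mid r(g)=s(g)\}$ is $\mathcal G^{(0)}$; principal if $\{g\mid r(g)=s(g)\}=\mathcal G^{(0)}$. Full groups. For an effective ample groupoid with compact unit space, a full bisection is a compact open bisection $U$ with $r(U)=s(U)=\mathcal G^{(0)}$; $\theta_U:=r\circ(s|_U)^{-1}\in\mathrm{Homeo}(\mathcal G^{(0)})$. $\mathsf F(\mathcal G)$ is the group of all such $\theta_U$, $\mathsf D(\mathcal G)$ its commutator subgroup. $H_1(\Gamma)$ is the abelianization of a group $\Gamma$; $\mathrm N(\Gamma,S)=\{\alpha\in\Gamma\mid\alpha S\alpha^{-1}=S\}$. Almost finite / purely infinite. An elementary subgroupoid is a compact open principal subgroupoid $\mathcal K\subset\mathcal G$ with $\mathcal K^{(0)}=\mathcal G^{(0)}$; $\mathcal Kx=\{g\in\mathcal K\mid s(g)=x\}$. $\mathcal G$ is almost finite if for every compact $C\subset\mathcal G$ and $\varepsilon>0$ there is an elementary subgroupoid $\mathcal K$ with $\#(C\mathcal Kx\setminus\mathcal Kx)/\#(\mathcal Kx)<\varepsilon$ for all $x\in\mathcal G^{(0)}$. It is purely infinite if for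 every clopen $A\subset\mathcal G^{(0)}$ there are compact open bisections $U,V$ with $s(U)=s(V)=A$, $r(U)\cap r(V)=\emptyset$, $r(U)\cup r(V)\subset A$. Semidirect product. $\mathcal G\rtimes_\lambda\mathbb Z/2$ is $\mathcal G\times\mathbb Z/2$ with the product topology, unit space identified with $\mathcal G^{(0)}$, $r(g,a)=r(g)$, $s(g,a)=\lambda_a^{-1}(s(g))$, $(g,a)(h,b)=(g\lambda_a(h),a+b)$. $\mathcal G$ is identified with $\mathcal G\times\{0\}\subset\mathcal H$, so $\mathsf F(\mathcal G)\subset\mathsf F(\mathcal H)$ and $\mathsf D(\mathcal G)\subset\mathsf D(\mathcal H)$. The restriction of $\lambda_a$ to $\mathcal G^{(0)}$ is an element of $\mathsf F(\mathcal H)$, again written $\lambda_a$. *)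

theory Defs
  imports "HOL-Analysis.Analysis" "HOL-Algebra.Generated_Groups"
    "HOL-Algebra.Group_Action" "HOL-Algebra.Elementary_Groups"
begin

text \<open>A groupoid is given by its topological space of arrows, the product and the inverse.
  The unit space is a subset of the arrows, and source and range are derived from the product
  and the inverse. The product is only meaningful on composable pairs, that is, where the source
  of the first factor is the range of the second.\<close>

record 'g tgroupoid =
  arr_top :: "'g topology"
  gmult :: "'g \<Rightarrow> 'g \<Rightarrow> 'g"
  ginv :: "'g \<Rightarrow> 'g"

definition arrows :: "'g tgroupoid \<Rightarrow> 'g set" where
  "arrows G = topspace (arr_top G)"

definition src :: "'g tgroupoid \<Rightarrow> 'g \<Rightarrow> 'g" where
  "src G g = gmult G (ginv G g) g"

definition rng :: "'g tgroupoid \<Rightarrow> 'g \<Rightarrow> 'g" where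
  "rng G g = gmult G g (ginv G g)"

definition units :: "'g tgroupoid \<Rightarrow> 'g set" where
  "units G = src G ` arrows G"

definition unit_top :: "'g tgroupoid \<Rightarrow> 'g topology" where
  "unit_top G = subtopology (arr_top G) (units G)"

definition composable :: "'g tgroupoid \<Rightarrow> ('g \<times> 'g) set" where
  "composable G = {(g, h). g \<in> arrows G \<and> h \<in> arrows G \<and> src G g = rng G h}"

definition groupoid :: "'g tgroupoid \<Rightarrow> bool" where
  "groupoid G \<longleftrightarrow>
     (\<forall>g \<in> arrows G. ginv G g \<in> arrows G \<and> ginv G (ginv G g) = g) \<and>
     (\<forall>(g, h) \<in> composable G.
        gmult G g h \<in> arrows G \<and> src G (gmult G g h) = src G h \<and> rng G (gmult G g h) = rng G g \<and>
        gmult G (ginv G g) (gmult G g h) = h \<and> gmult G (gmult G g h) (ginv G h) = g) \<and>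
     (\<forall>g h k. (g, h) \<in> composable G \<and> (h, k) \<in> composable G \<longrightarrow>
        gmult G (gmult G g h) k = gmult G g (gmult G h k))"

definition topological_groupoid :: "'g tgroupoid \<Rightarrow> bool" where
  "topological_groupoid G \<longleftrightarrow>
     groupoid G \<and>
     continuous_map (subtopology (prod_topology (arr_top G) (arr_top G)) (composable G))
       (arr_top G) (\<lambda>(g, h). gmult G g h) \<and>
     continuous_map (arr_top G) (arr_top G) (ginv G)"

definition local_homeomorphism :: "'a topology \<Rightarrow> 'b topology \<Rightarrow> ('a \<Rightarrow> 'b) \<Rightarrow> bool" where
  "local_homeomorphism X Y f \<longleftrightarrow>
     (\<forall>x \<in> topspace X. \<exists>U. openin X U \<and> x \<in> U \<and> openin Y (f ` U) \<and>
        homeomorphic_map (subtopology X U) (subtopology Y (f ` U)) f)"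

definition etale_groupoid :: "'g tgroupoid \<Rightarrow> bool" where
  "etale_groupoid G \<longleftrightarrow>
     topological_groupoid G \<and> second_countable (arr_top G) \<and> locally_compact_space (arr_top G) \<and>
     Hausdorff_space (arr_top G) \<and> local_homeomorphism (arr_top G) (unit_top G) (rng G)"

definition totally_disconnected_space :: "'a topology \<Rightarrow> bool" where
  "totally_disconnected_space X \<longleftrightarrow> (\<forall>C. connectedin X C \<longrightarrow> (\<exists>x. C \<subseteq> {x}))"

definition ample_groupoid :: "'g tgroupoid \<Rightarrow> bool" where
  "ample_groupoid G \<longleftrightarrow> etale_groupoid G \<and> totally_disconnected_space (unit_top G)"

definition cantor_space :: "'a topology \<Rightarrow> bool" where
  "cantor_space X \<longleftrightarrow>
     X homeomorphic_space product_topology (\<lambda>_::nat. discrete_topology (UNIV :: bool set)) UNIV"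

definition bisection :: "'g tgroupoid \<Rightarrow> 'g set \<Rightarrow> bool" where
  "bisection G U \<longleftrightarrow> U \<subseteq> arrows G \<and> inj_on (rng G) U \<and> inj_on (src G) U"

definition compact_open_bisection :: "'g tgroupoid \<Rightarrow> 'g set \<Rightarrow> bool" where
  "compact_open_bisection G U \<longleftrightarrow>
     compactin (arr_top G) U \<and> openin (arr_top G) U \<and> bisection G U"

definition minimal_groupoid :: "'g tgroupoid \<Rightarrow> bool" where
  "minimal_groupoid G \<longleftrightarrow>
     (\<forall>x \<in> units G. unit_top G closure_of (rng G ` {g \<in> arrows G. src G g = x}) = units G)"

definition effective_groupoid :: "'g tgroupoid \<Rightarrow> bool" where
  "effective_groupoid G \<longleftrightarrow>
     arr_top G interior_of {g \<in> arrows G. rng G g = src G g} = units G"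

definition principal_groupoid :: "'g tgroupoid \<Rightarrow> bool" where
  "principal_groupoid G \<longleftrightarrow> {g \<in> arrows G. rng G g = src G g} = units G"

definition restrict_groupoid :: "'g tgroupoid \<Rightarrow> 'g set \<Rightarrow> 'g tgroupoid" where
  "restrict_groupoid G K = G\<lparr>arr_top := subtopology (arr_top G) K\<rparr>"

definition subgroupoid :: "'g set \<Rightarrow> 'g tgroupoid \<Rightarrow> bool" where
  "subgroupoid K G \<longleftrightarrow>
     K \<subseteq> arrows G \<and> (\<forall>g \<in> K. ginv G g \<in> K) \<and>
     (\<forall>g \<in> K. \<forall>h \<in> K. (g, h) \<in> composable G \<longrightarrow> gmult G g h \<in> K)"

definition elementary_subgroupoid :: "'g set \<Rightarrow> 'g tgroupoid \<Rightarrow> bool" where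
  "elementary_subgroupoid K G \<longleftrightarrow>
     subgroupoid K G \<and> compactin (arr_top G) K \<and> openin (arr_top G) K \<and>
     principal_groupoid (restrict_groupoid G K) \<and> units (restrict_groupoid G K) = units G"

definition gset_mult :: "'g tgroupoid \<Rightarrow> 'g set \<Rightarrow> 'g set \<Rightarrow> 'g set" where
  "gset_mult G A B = {gmult G g h | g h. g \<in> A \<and> h \<in> B \<and> (g, h) \<in> composable G}"

definition src_fibre :: "'g tgroupoid \<Rightarrow> 'g set \<Rightarrow> 'g \<Rightarrow> 'g set" where
  "src_fibre G K x = {g \<in> K. src G g = x}"

text \<open>The cardinalities below are those of finite sets: in an etale groupoid, a compact set
  meets every source fibre in a finite set, and \<open>x\<close> itself lies in the fibre of \<open>K\<close> over \<open>x\<close>.\<close>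

definition almost_finite :: "'g tgroupoid \<Rightarrow> bool" where
  "almost_finite G \<longleftrightarrow>
     (\<forall>C \<epsilon>. compactin (arr_top G) C \<and> \<epsilon> > (0 :: real) \<longrightarrow>
        (\<exists>K. elementary_subgroupoid K G \<and>
           (\<forall>x \<in> units G.
              real (card (gset_mult G C (src_fibre G K x) - src_fibre G K x))
                / real (card (src_fibre G K x)) < \<epsilon>)))"

definition purely_infinite :: "'g tgroupoid \<Rightarrow> bool" where
  "purely_infinite G \<longleftrightarrow>
     (\<forall>A. openin (unit_top G) A \<and> closedin (unit_top G) A \<longrightarrow>
        (\<exists>U V. compact_open_bisection G U \<and> compact_open_bisection G V \<and>
           src G ` U = A \<and> src G ` V = A \<and>
           rng G ` U \<inter> rng G ` V = {} \<and> rng G ` U \<union> rng G ` V \<subseteq> A))"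

definition full_bisection :: "'g tgroupoid \<Rightarrow> 'g set \<Rightarrow> bool" where
  "full_bisection G U \<longleftrightarrow>
     compact_open_bisection G U \<and> rng G ` U = units G \<and> src G ` U = units G"

definition bisection_map :: "'g tgroupoid \<Rightarrow> 'g set \<Rightarrow> 'g \<Rightarrow> 'g" where
  "bisection_map G U = (\<lambda>x \<in> units G. rng G (inv_into U (src G) x))"

text \<open>Full groups consist of permutations of the unit space, extended by \<^const>\<open>undefined\<close> as in
  \<^const>\<open>BijGroup\<close>; the product is composition.\<close>

definition full_group :: "'g tgroupoid \<Rightarrow> ('g \<Rightarrow> 'g) monoid" where
  "full_group G =
     (BijGroup (units G))\<lparr>carrier := {bisection_map G U | U. full_bisection G U}\<rparr>"

definition full_group_derived :: "'g tgroupoid \<Rightarrow> ('g \<Rightarrow> 'g) set" where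
  "full_group_derived G = derived (full_group G) (carrier (full_group G))"

definition abelianization :: "('a, 'm) monoid_scheme \<Rightarrow> 'a set monoid" where
  "abelianization \<Gamma> = \<Gamma> Mod derived \<Gamma> (carrier \<Gamma>)"

text \<open>The coset of \<open>x\<close> modulo commutators is sent to the coset of \<open>\<phi> x\<close>.\<close>

definition abelianization_map ::
    "('a, 'm) monoid_scheme \<Rightarrow> ('b, 'n) monoid_scheme \<Rightarrow> ('a \<Rightarrow> 'b) \<Rightarrow> 'a set \<Rightarrow> 'b set" where
  "abelianization_map \<Gamma> \<Delta> \<phi> =
     (\<lambda>C \<in> carrier (abelianization \<Gamma>). derived \<Delta> (carrier \<Delta>) <#>\<^bsub>\<Delta>\<^esub> \<phi> ` C)"

definition maximal_subgroup :: "'a set \<Rightarrow> ('a, 'm) monoid_scheme \<Rightarrow> bool" where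
  "maximal_subgroup M \<Gamma> \<longleftrightarrow>
     subgroup M \<Gamma> \<and> M \<noteq> carrier \<Gamma> \<and>
     (\<forall>K. subgroup K \<Gamma> \<and> M \<subseteq> K \<longrightarrow> K = M \<or> K = carrier \<Gamma>)"

abbreviation Z2 :: "int monoid" where
  "Z2 \<equiv> integer_mod_group 2"

definition groupoid_automorphism :: "'g tgroupoid \<Rightarrow> ('g \<Rightarrow> 'g) \<Rightarrow> bool" where
  "groupoid_automorphism G \<phi> \<longleftrightarrow>
     homeomorphic_map (arr_top G) (arr_top G) \<phi> \<and>
     (\<forall>(g, h) \<in> composable G.
        (\<phi> g, \<phi> h) \<in> composable G \<and> \<phi> (gmult G g h) = gmult G (\<phi> g) (\<phi> h))"

definition Z2_action :: "'g tgroupoid \<Rightarrow> (int \<Rightarrow> 'g \<Rightarrow> 'g) \<Rightarrow> bool" where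
  "Z2_action G lam \<longleftrightarrow>
     group_action Z2 (arrows G) lam \<and> (\<forall>a \<in> carrier Z2. groupoid_automorphism G (lam a))"

definition free_on_units :: "'g tgroupoid \<Rightarrow> (int \<Rightarrow> 'g \<Rightarrow> 'g) \<Rightarrow> bool" where
  "free_on_units G lam \<longleftrightarrow>
     (\<forall>a \<in> carrier Z2. a \<noteq> \<one>\<^bsub>Z2\<^esub> \<longrightarrow> (\<forall>x \<in> units G. lam a x \<noteq> x))"

definition semidirect :: "'g tgroupoid \<Rightarrow> (int \<Rightarrow> 'g \<Rightarrow> 'g) \<Rightarrow> ('g \<times> int) tgroupoid" where
  "semidirect G lam =
     \<lparr>arr_top = prod_topology (arr_top G) (discrete_topology (carrier Z2)),
      gmult = (\<lambda>(g, a) (h, b). (gmult G g (lam a h), a \<otimes>\<^bsub>Z2\<^esub> b)),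
      ginv = (\<lambda>(g, a). (lam (inv\<^bsub>Z2\<^esub> a) (ginv G g), inv\<^bsub>Z2\<^esub> a))\<rparr>"

text \<open>The unit space of \<^term>\<open>semidirect G lam\<close> is that of \<open>G\<close> times the trivial element. The
  following map transports a permutation of the units of \<open>G\<close> along this identification. On the full
  group of \<open>G\<close> it is the inclusion into the full group of the semidirect product; it also
  turns the restriction of \<^term>\<open>lam a\<close> to the units into an element of the latter.\<close>

definition transport_units ::
    "'g tgroupoid \<Rightarrow> (int \<Rightarrow> 'g \<Rightarrow> 'g) \<Rightarrow> ('g \<Rightarrow> 'g) \<Rightarrow> 'g \<times> int \<Rightarrow> 'g \<times> int" where
  "transport_units G lam \<alpha> = restrict (\<lambda>(x, c). (\<alpha> x, c)) (units (semidirect G lam))"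


text \<open>Consistency of the encoding with the usual description of the semidirect product.\<close>

lemma Z2_action_one:
  assumes "Z2_action G lam" "g \<in> arrows G"
  shows "lam \<one>\<^bsub>Z2\<^esub> g = g"
  using assms group_action.id_eq_one[of Z2 "arrows G" lam]
  by (metis Z2_action_def restrict_apply')

lemma Z2_action_mult:
  assumes "Z2_action G lam" "g \<in> arrows G" "c \<in> carrier Z2" "d \<in> carrier Z2"
  shows "lam (c \<otimes>\<^bsub>Z2\<^esub> d) g = lam c (lam d g)"
  using assms group_action.composition_rule[of Z2 "arrows G" lam]
  unfolding Z2_action_def by blast

lemma rng_semidirect:
  assumes "groupoid G" "Z2_action G lam" "g \<in> arrows G" "c \<in> carrier Z2"
  shows "rng (semidirect G lam) (g, c) = (rng G g, \<one>\<^bsub>Z2\<^esub>)"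
proof -
  have Z: "group Z2" by simp
  have i: "inv\<^bsub>Z2\<^esub> c \<in> carrier Z2" using Z assms(4) by (rule group.inv_closed)
  have g: "ginv G g \<in> arrows G" using assms(1,3) by (auto simp: groupoid_def)
  have "lam c (lam (inv\<^bsub>Z2\<^esub> c) (ginv G g)) = ginv G g"
    using Z2_action_mult[OF assms(2) g assms(4) i] Z2_action_one[OF assms(2) g]
      group.r_inv[OF Z assms(4)] by simp
  then show ?thesis
    using group.r_inv[OF Z assms(4)] by (simp add: rng_def semidirect_def)
qed

lemma src_semidirect:
  assumes "groupoid G" "Z2_action G lam" "g \<in> arrows G" "c \<in> carrier Z2"
  shows "src (semidirect G lam) (g, c) = (lam (inv\<^bsub>Z2\<^esub> c) (src G g), \<one>\<^bsub>Z2\<^esub>)"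
proof -
  have Z: "group Z2" by simp
  have i: "inv\<^bsub>Z2\<^esub> c \<in> carrier Z2" using Z assms(4) by (rule group.inv_closed)
  have g: "ginv G g \<in> arrows G" "ginv G (ginv G g) = g"
    using assms(1,3) by (auto simp: groupoid_def)
  then have "(ginv G g, g) \<in> composable G"
    using assms(3) by (simp add: composable_def src_def rng_def)
  then have "lam (inv\<^bsub>Z2\<^esub> c) (src G g)
      = gmult G (lam (inv\<^bsub>Z2\<^esub> c) (ginv G g)) (lam (inv\<^bsub>Z2\<^esub> c) g)"
    using assms(2) i by (auto simp: Z2_action_def groupoid_automorphism_def src_def)
  then show ?thesis
    using group.l_inv[OF Z assms(4)] by (simp add: src_def semidirect_def)
qed

lemma arrows_semidirect: "arrows (semidirect G lam) = arrows G \<times> carrier Z2"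
  by (simp add: arrows_def semidirect_def)

lemma groupoid_src_closed:
  assumes "groupoid G" "g \<in> arrows G"
  shows "src G g \<in> arrows G" "src G (src G g) = src G g" "rng G (src G g) = src G g"
proof -
  have i: "ginv G g \<in> arrows G" "ginv G (ginv G g) = g"
    using assms by (auto simp: groupoid_def)
  then have c: "(ginv G g, g) \<in> composable G"
    using assms(2) by (simp add: composable_def src_def rng_def)
  show "src G g \<in> arrows G" "src G (src G g) = src G g" "rng G (src G g) = src G g"
    using assms(1) c i unfolding groupoid_def by (auto simp: src_def rng_def)
qed

lemma groupoid_aut_units:
  assumes "Z2_action G lam" "groupoid G" "c \<in> carrier Z2" "x \<in> units G"
  shows "lam c x \<in> units G"
proof -
  have aut: "groupoid_automorphism G (lam c)" using assms by (auto simp: Z2_action_def)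
  have x: "x \<in> arrows G" "src G x = x" "rng G x = x"
    using assms(2,4) groupoid_src_closed by (auto simp: units_def)
  have lx: "lam c x \<in> arrows G"
    using aut x(1) homeomorphic_imp_surjective_map unfolding groupoid_automorphism_def arrows_def
    by blast
  have "(x, x) \<in> composable G" using x by (simp add: composable_def)
  moreover have xx: "gmult G x x = x"
  proof -
    have i: "ginv G x \<in> arrows G" "ginv G (ginv G x) = x"
      using assms(2) x(1) by (auto simp: groupoid_def)
    then have "(ginv G x, x) \<in> composable G"
      using x(1) by (simp add: composable_def src_def rng_def)
    then have "gmult G (ginv G (ginv G x)) (gmult G (ginv G x) x) = x"
      using assms(2) unfolding groupoid_def by auto
    then show ?thesis using i x(2) by (simp add: src_def)
  qed
  ultimately have c: "(lam c x, lam c x) \<in> composable G"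
    and m: "gmult G (lam c x) (lam c x) = lam c x"
    using aut unfolding groupoid_automorphism_def by (metis (mono_tags, lifting) case_prodD)+
  have "gmult G (ginv G (lam c x)) (gmult G (lam c x) (lam c x)) = lam c x"
    using c assms(2) unfolding groupoid_def by auto
  then have "src G (lam c x) = lam c x" using m by (simp add: src_def)
  then show ?thesis using lx by (metis image_eqI units_def)
qed

lemma units_semidirect:
  assumes "groupoid G" "Z2_action G lam"
  shows "units (semidirect G lam) = units G \<times> {\<one>\<^bsub>Z2\<^esub>}"
proof -
  have Z: "group Z2" by simp
  have one: "\<one>\<^bsub>Z2\<^esub> \<in> carrier Z2" using Z by (simp add: group.is_monoid monoid.one_closed)
  have "units (semidirect G lam) \<subseteq> units G \<times> {\<one>\<^bsub>Z2\<^esub>}"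
    using assms groupoid_aut_units[OF assms(2,1)] src_semidirect[OF assms] group.inv_closed[OF Z]
    by (fastforce simp: units_def arrows_semidirect)
  moreover have "(src G g, \<one>\<^bsub>Z2\<^esub>) \<in> units (semidirect G lam)" if "g \<in> arrows G" for g
  proof -
    have "src (semidirect G lam) (g, \<one>\<^bsub>Z2\<^esub>) = (src G g, \<one>\<^bsub>Z2\<^esub>)"
      using src_semidirect[OF assms that one] Z2_action_one[OF assms(2) groupoid_src_closed(1)[OF assms(1) that]]
        monoid.inv_one[OF group.is_monoid[OF Z]] by simp
    then show ?thesis using that one by (metis SigmaI arrows_semidirect image_eqI units_def)
  qed
  ultimately show ?thesis by (auto simp: units_def)
qed

end

theory Submission
  imports Defs
begin

text \<open>
  Existence of \<open>\<beta>\<close>: the free involution \<open>\<lambda>\<^sub>a\<close> is a finite product of transpositions supported on small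
  clopen sets. Minimality yields, next to each of them, a transposition in \<open>F(G)\<close> sharing one of the
  two sets, and the product of the two is a 3-cycle, hence a commutator in \<open>F(H)\<close>.

  Normalizer: effectiveness of \<open>H\<close> gives every germ of \<open>\<alpha> \<in> F(H)\<close> a well-defined degree in \<open>Z/2\<close>. If
  \<open>\<alpha>\<close> has germs of both degrees, then conjugating by \<open>\<alpha>\<close> a 3-cycle of \<open>D(G)\<close> joining two such points
  produces a germ of degree 1. So the normalizer of \<open>D(G)\<close> in \<open>F(H)\<close> lies in \<open>F(G) \<union> F(G)\<lambda>\<^sub>a\<close>, and
  injectivity of the map on abelianizations means \<open>F(G) \<inter> D(H) = D(G)\<close>.

  Maximality: a group \<open>K\<close> between \<open>D(G)\<close> and \<open>D(H)\<close> with an element of mixed degree contains a small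
  3-cycle with germs of both degrees. Conjugating by 3-cycles of constant degree and using minimality
  of \<open>G\<close>, \<open>K\<close> contains all 3-cycles of \<open>F(H)\<close>. It remains to see that they generate \<open>D(H)\<close>, that is,
  that \<open>F(H)\<close> is abelian modulo the group \<open>A(H)\<close> of 3-cycles. All transpositions are central modulo
  \<open>A(H)\<close>. After multiplication with transpositions, two given elements \<open>\<alpha>\<close>, \<open>\<beta>\<close> have supports so small
  that a product of transpositions moves one off the other, and then they commute modulo \<open>A(H)\<close>.
  In the purely infinite case the supports omit a common open set, into which everything embeds; in
  the almost finite case they cover less than a quarter of each orbit of an elementary subgroupoid.
\<close>

section \<open>Germs of homeomorphisms and transpositions\<close>

text \<open>The germs of G and of H are two predicates on one space, the unit space of G, so F(G) is
  literally contained in F(H); only at the end does \<open>\<iota>\<close> carry the result to the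
  units of H. Transpositions and 3-cycles are parametrised by maps on a common base set instead of
  by the sets they permute. Conjugation by \<alpha> is then postcomposition with \<alpha>, a change
  of base is precomposition, and a 3-cycle has a triple of degrees at each base point. Up to
  rotation and a common flip by \<lambda>, such a triple is constant or has one entry different from
  the other two, which is why a single mixed 3-cycle reaches all others. Transpositions are central
  modulo A(H) because (12)(34) is a product of two 3-cycles: near a point, any two transpositions
  have the class of one exchanging two fresh values. Fresh values exist since the unit space has no
  isolated point and orbits are dense. The quarter comes from a count: a greedy matching fails in an
  orbit only if three sets, each a share of the orbit below the bound, exhaust it, so any bound up
  to a third would serve.\<close>

definition clopenin :: "'a topology \<Rightarrow> 'a set \<Rightarrow> bool" where
  "clopenin T N \<longleftrightarrow> openin T N \<and> closedin T N"

text \<open>\<open>L f x\<close> means that near \<open>x\<close> the map \<open>f\<close> is given by an open set of arrows. Only these germs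
  of homeomorphisms of the unit space enter the combinatorial part of the proof.\<close>

locale germs =
  fixes T :: "'a topology" and L :: "('a \<Rightarrow> 'a) \<Rightarrow> 'a \<Rightarrow> bool"
  assumes cpt: "compact_space T" and haus: "Hausdorff_space T"
    and clopen_base: "\<And>U x. openin T U \<Longrightarrow> x \<in> U \<Longrightarrow> \<exists>N. clopenin T N \<and> x \<in> N \<and> N \<subseteq> U"
    and perfect: "\<And>x. \<not> openin T {x}"
    and L_cong: "\<And>f g x N. L f x \<Longrightarrow> openin T N \<Longrightarrow> x \<in> N \<Longrightarrow> (\<And>y. y \<in> N \<Longrightarrow> g y = f y) \<Longrightarrow> L g x"
    and L_id: "\<And>x. x \<in> topspace T \<Longrightarrow> L (\<lambda>y. y) x"
    and L_comp: "\<And>f g x. L f x \<Longrightarrow> L g (f x) \<Longrightarrow> L (\<lambda>y. g (f y)) x"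
    and L_cont: "\<And>f x B. L f x \<Longrightarrow> openin T B \<Longrightarrow> f x \<in> B \<Longrightarrow>
      \<exists>N. openin T N \<and> x \<in> N \<and> f ` N \<subseteq> B"
    and L_inv: "\<And>f x. L f x \<Longrightarrow> \<exists>N N' g. openin T N \<and> openin T N' \<and> x \<in> N \<and> f ` N = N' \<and>
      (\<forall>y\<in>N. L f y \<and> L g (f y) \<and> g (f y) = y)"
begin

abbreviation "X \<equiv> topspace T"
abbreviation "clopen \<equiv> clopenin T"

lemma clopen_subset: "clopen N \<Longrightarrow> N \<subseteq> X"
  by (simp add: clopenin_def openin_subset)

lemma clopen_simps [simp, intro]:
  "clopen {}" "clopen X"
  "clopen A \<Longrightarrow> clopen B \<Longrightarrow> clopen (A \<union> B)"
  "clopen A \<Longrightarrow> clopen B \<Longrightarrow> clopen (A \<inter> B)"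
  "clopen A \<Longrightarrow> clopen B \<Longrightarrow> clopen (A - B)"
  by (auto simp: clopenin_def)

lemma clopen_openin: "clopen N \<Longrightarrow> openin T N"
  by (simp add: clopenin_def)

lemma Hausdorff_sep:
  assumes "x \<in> X" "y \<in> X" "x \<noteq> y"
  shows "\<exists>A B. openin T A \<and> openin T B \<and> x \<in> A \<and> y \<in> B \<and> A \<inter> B = {}"
  using haus assms unfolding Hausdorff_space_def by (metis disjnt_def)

lemma L_dom: assumes "L f x" shows "x \<in> X" "f x \<in> X"
proof -
  from L_inv[OF assms] obtain N N' g where "openin T N" "openin T N'" "x \<in> N" "f ` N = N'" by blast
  then show "x \<in> X" "f x \<in> X" using openin_subset[of T N] openin_subset[of T N'] by auto
qed

text \<open>This is how compactness enters the gluing arguments. No disjoint partition is chosen in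
  advance; the step is required for every clopen B, and users split B \<union> N into B and the part
  of N outside B.\<close>

lemma cover_induct:
  assumes empty: "Q {}"
    and step: "\<And>x. x \<in> X \<Longrightarrow> \<exists>N. clopen N \<and> x \<in> N \<and> (\<forall>B. clopen B \<longrightarrow> Q B \<longrightarrow> Q (B \<union> N))"
  shows "Q X"
proof -
  define \<U> where "\<U> = {N. clopen N \<and> (\<forall>B. clopen B \<longrightarrow> Q B \<longrightarrow> Q (B \<union> N))}"
  have op: "\<And>U. U \<in> \<U> \<Longrightarrow> openin T U" by (simp add: \<U>_def clopen_openin)
  have cov: "X \<subseteq> \<Union>\<U>"
  proof
    fix x assume "x \<in> X"
    with step[OF this] show "x \<in> \<Union>\<U>" unfolding \<U>_def by blast
  qed
  have "\<exists>\<F>. finite \<F> \<and> \<F> \<subseteq> \<U> \<and> X \<subseteq> \<Union>\<F>"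
    using cpt op cov unfolding compact_space_alt by blast
  then obtain \<F> where f: "finite \<F>" "\<F> \<subseteq> \<U>" "X \<subseteq> \<Union>\<F>" by blast
  have "clopen (\<Union>\<F>) \<and> Q (\<Union>\<F>)" using f(1,2)
  proof (induction \<F>)
    case empty then show ?case using assms(1) by simp
  next
    case (insert N \<F>)
    then have "clopen N" "clopen (\<Union>\<F>)" "Q (\<Union>\<F>)" "Q (\<Union>\<F> \<union> N)" by (auto simp: \<U>_def)
    then show ?case by (simp add: Un_commute)
  qed
  moreover have "\<Union>\<F> = X" using calculation clopen_subset f(3) by blast
  ultimately show ?thesis by simp
qed

text \<open>\<open>eventually P (small x)\<close> also covers the small clopen sets that do not contain \<open>x\<close>; this
  makes such properties stable under the disjointification in \<open>cover_induct\<close>.\<close>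

definition small :: "'a \<Rightarrow> 'a set filter" where
  "small x = (INF N \<in> {N. clopen N \<and> x \<in> N}. principal {N'. clopen N' \<and> N' \<subseteq> N})"

lemma eventually_small:
  assumes "x \<in> X"
  shows "eventually P (small x) \<longleftrightarrow>
    (\<exists>N. clopen N \<and> x \<in> N \<and> (\<forall>N'. clopen N' \<and> N' \<subseteq> N \<longrightarrow> P N'))"
proof -
  have "eventually P (small x) \<longleftrightarrow>
      (\<exists>N \<in> {N. clopen N \<and> x \<in> N}. eventually P (principal {N'. clopen N' \<and> N' \<subseteq> N}))"
    unfolding small_def
  proof (rule eventually_INF_base)
    show "{N. clopen N \<and> x \<in> N} \<noteq> {}" using assms by blast
    fix a b assume "a \<in> {N. clopen N \<and> x \<in> N}" "b \<in> {N. clopen N \<and> x \<in> N}"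
    then show "\<exists>c\<in>{N. clopen N \<and> x \<in> N}. principal {N'. clopen N' \<and> N' \<subseteq> c}
        \<le> inf (principal {N'. clopen N' \<and> N' \<subseteq> a}) (principal {N'. clopen N' \<and> N' \<subseteq> b})"
      by (intro bexI[of _ "a \<inter> b"]) (auto simp: eventually_principal)
  qed
  then show ?thesis by (auto simp: eventually_principal)
qed

lemma small_clopen: "x \<in> X \<Longrightarrow> eventually clopen (small x)"
  unfolding eventually_small by blast

lemma small_subset: "clopen A \<Longrightarrow> x \<in> A \<Longrightarrow> \<forall>\<^sub>F N in small x. N \<subseteq> A"
  using clopen_subset by (subst eventually_small) blast+

text \<open>These are the partial homeomorphisms induced by compact open bisections. f is a total
  function whose values off N carry no information, as \<open>pm_cong\<close> records.\<close>

definition pm :: "'a set \<Rightarrow> ('a \<Rightarrow> 'a) \<Rightarrow> bool" where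
  "pm N f \<longleftrightarrow> clopen N \<and> inj_on f N \<and> (\<forall>x\<in>N. L f x)"

lemma pm_subset: "pm N f \<Longrightarrow> clopen N' \<Longrightarrow> N' \<subseteq> N \<Longrightarrow> pm N' f"
  unfolding pm_def by (meson inj_on_subset subsetD)

lemma pm_cong: 
  assumes "pm N f" "\<And>x. x \<in> N \<Longrightarrow> g x = f x" shows "pm N g"
  using assms L_cong[of f _ N g] unfolding pm_def by (metis clopen_openin inj_on_cong)

lemma small_pm: assumes "L f x" shows "\<forall>\<^sub>F N in small x. pm N f"
proof -
  obtain N N' g where N: "openin T N" "x \<in> N" "\<And>y. y \<in> N \<Longrightarrow> L f y \<and> g (f y) = y"
    using L_inv[OF assms] by blast
  obtain M where M: "clopen M" "x \<in> M" "M \<subseteq> N" using clopen_base[OF N(1,2)] by blast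
  have "inj_on f M" using N(3) M(3) by (metis inj_on_inverseI subsetD)
  then have "pm M f" using M N(3) unfolding pm_def by blast
  then show ?thesis using M pm_subset L_dom[OF assms] unfolding eventually_small[OF L_dom(1)[OF assms]] by blast
qed

lemma small_image:
  assumes "L f x" "openin T B" "f x \<in> B" shows "\<forall>\<^sub>F N in small x. f ` N \<subseteq> B"
proof -
  obtain N where N: "openin T N" "x \<in> N" "f ` N \<subseteq> B" using L_cont[OF assms] by blast
  obtain M where "clopen M" "x \<in> M" "M \<subseteq> N" using clopen_base[OF N(1,2)] by blast
  then show ?thesis using N(3) unfolding eventually_small[OF L_dom(1)[OF assms(1)]] by blast
qed

lemma small_disjoint:
  assumes "L f x" "L g x" "f x \<noteq> g x" shows "\<forall>\<^sub>F N in small x. f ` N \<inter> g ` N = {}"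
proof -
  obtain A B where "openin T A" "openin T B" "f x \<in> A" "g x \<in> B" "A \<inter> B = {}"
    using Hausdorff_sep L_dom assms by metis
  then have "\<forall>\<^sub>F N in small x. f ` N \<subseteq> A \<and> g ` N \<subseteq> B"
    using small_image[OF assms(1)] small_image[OF assms(2)] eventually_conj by blast
  then show ?thesis by eventually_elim (use \<open>A \<inter> B = {}\<close> in blast)
qed

text \<open>The local inverse from \<open>L_inv\<close> is itself a germ and therefore continuous,
  so a neighbourhood of f x can be pulled back into B.\<close>

lemma pm_image_open: assumes "pm N f" "openin T B" "B \<subseteq> N" shows "openin T (f ` B)"
proof (subst openin_subopen, intro ballI)
  fix y assume "y \<in> f ` B"
  then obtain x where x: "x \<in> B" "y = f x" by blast
  then have "L f x" using assms unfolding pm_def by blast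
  from L_inv[OF this] obtain M M' g where M: "openin T M" "openin T M'" "x \<in> M" "f ` M = M'"
    "\<forall>z\<in>M. L f z \<and> L g (f z) \<and> g (f z) = z"
    by (elim exE conjE)
  have "L g (f x)" "openin T (M \<inter> B)" "g (f x) \<in> M \<inter> B" using M x assms(2) by auto
  from L_cont[OF this] obtain W where W: "openin T W" "f x \<in> W" "g ` W \<subseteq> M \<inter> B" by blast
  have "W \<inter> M' \<subseteq> f ` B"
  proof
    fix w assume w: "w \<in> W \<inter> M'"
    then obtain z where "z \<in> M" "w = f z" using M(4) by blast
    then show "w \<in> f ` B" using W(3) M(5)[rule_format] w by (metis IntD1 IntD2 image_subset_iff imageI)
  qed
  moreover have "openin T (W \<inter> M')" "y \<in> W \<inter> M'" using W M x by auto
  ultimately show "\<exists>S. openin T S \<and> y \<in> S \<and> S \<subseteq> f ` B" by blast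
qed

lemma pm_inv_L: assumes "pm N f" "y \<in> f ` N" shows "L (inv_into N f) y"
proof -
  obtain x where x: "x \<in> N" "y = f x" using assms by blast
  have "L f x" using assms x by (simp add: pm_def)
  then obtain M M' g where M: "openin T M" "x \<in> M" "\<And>z. z \<in> M \<Longrightarrow> L f z \<and> L g (f z) \<and> g (f z) = z"
    using L_inv[of f x] by blast
  show ?thesis
  proof (rule L_cong[of g])
    show "L g y" using M x by blast
    show "openin T (f ` (M \<inter> N))" using pm_image_open[OF assms(1), of "M \<inter> N"] M(1) assms(1) by (auto simp: pm_def clopenin_def)
    show "y \<in> f ` (M \<inter> N)" using x M by blast
    fix z assume "z \<in> f ` (M \<inter> N)"
    then show "inv_into N f z = g z" using M(3) assms(1) unfolding pm_def by (metis IntE image_iff inv_into_f_f)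
  qed
qed

lemma pm_preimage_open:
  assumes "pm N f" "openin T B" shows "openin T {x \<in> N. f x \<in> B}"
proof (subst openin_subopen, intro ballI)
  fix x assume x: "x \<in> {x \<in> N. f x \<in> B}"
  then obtain M where "openin T M" "x \<in> M" "f ` M \<subseteq> B" using L_cont[of f x B] assms unfolding pm_def by blast
  then show "\<exists>S. openin T S \<and> x \<in> S \<and> S \<subseteq> {x \<in> N. f x \<in> B}"
    using x assms(1) by (intro exI[of _ "M \<inter> N"]) (auto simp: pm_def clopenin_def)
qed

lemma pm_image_subset: "pm N f \<Longrightarrow> f ` N \<subseteq> X"
  using L_dom unfolding pm_def by blast

lemma pm_preimage: assumes "pm N f" "clopen B" shows "clopen {x \<in> N. f x \<in> B}"
proof -
  have "openin T {x \<in> N. f x \<in> B}" using assms pm_preimage_open clopenin_def by metis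
  moreover have "openin T {x \<in> N. f x \<in> X - B}" using assms pm_preimage_open clopenin_def by (metis openin_diff openin_topspace)
  then have "openin T ((X - N) \<union> {x \<in> N. f x \<in> X - B})" using assms unfolding pm_def clopenin_def by blast
  moreover have "(X - N) \<union> {x \<in> N. f x \<in> X - B} = X - {x \<in> N. f x \<in> B}"
    using pm_image_subset[OF assms(1)] assms(1) clopen_subset unfolding pm_def by auto
  ultimately show ?thesis using assms(1) clopen_subset unfolding clopenin_def pm_def closedin_def
    by (metis (no_types, lifting) openin_subset)
qed

text \<open>Closedness of the image comes from compactness: N is compact, f is continuous on it, and
  T is Hausdorff.\<close>

lemma pm_image_clopen: assumes "pm N f" shows "clopen (f ` N)"
proof -
  have op: "openin T (f ` N)" using pm_image_open[OF assms] assms by (simp add: pm_def clopenin_def)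
  have "continuous_map (subtopology T N) T f"
  proof -
    have "openin (subtopology T N) {x \<in> topspace (subtopology T N). f x \<in> B}" if "openin T B" for B
    proof -
      have "{x \<in> topspace (subtopology T N). f x \<in> B} = {x \<in> N. f x \<in> B}"
        using assms clopen_subset by (auto simp: pm_def)
      then show ?thesis using pm_preimage_open[OF assms that] by (metis (no_types, lifting) inf.absorb_iff2 mem_Collect_eq openin_subtopology_Int2 subsetI)
    qed
    then show ?thesis using pm_image_subset[OF assms] assms clopen_subset by (auto simp: continuous_map_def pm_def)
  qed
  moreover have "compactin (subtopology T N) N"
    using assms cpt closedin_compact_space[OF cpt, of N] by (simp add: pm_def clopenin_def compactin_subtopology)
  ultimately have "compactin T (f ` N)" using image_compactin by blast
  then show ?thesis using op haus compactin_imp_closedin by (simp add: clopenin_def)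
qed

lemma pm_inv: "pm N f \<Longrightarrow> pm (f ` N) (inv_into N f)"
  using pm_image_clopen pm_inv_L by (simp add: pm_def inj_on_inv_into)

lemma pm_comp: assumes "pm N f" "pm N' g" "f ` N \<subseteq> N'" shows "pm N (\<lambda>x. g (f x))"
proof -
  have "inj_on (g \<circ> f) N" using assms unfolding pm_def by (metis comp_inj_on inj_on_subset)
  then show ?thesis using assms L_comp unfolding pm_def by (auto simp: comp_def)
qed

lemma pm_id: "clopen N \<Longrightarrow> pm N (\<lambda>x. x)"
  using clopen_subset L_id by (auto simp: pm_def)

lemma pm_union:
  assumes "pm A f" "pm B g" "A \<inter> B = {}" "f ` A \<inter> g ` B = {}"
  shows "pm (A \<union> B) (\<lambda>x. if x \<in> A then f x else g x)"
proof -
  have "pm A (\<lambda>x. if x \<in> A then f x else g x)" using pm_cong[OF assms(1)] by simp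
  moreover have "pm B (\<lambda>x. if x \<in> A then f x else g x)"
    by (rule pm_cong[OF assms(2)]) (use assms(3) in auto)
  moreover have "inj_on (\<lambda>x. if x \<in> A then f x else g x) (A \<union> B)"
    using calculation assms(3,4) unfolding pm_def by (auto simp: inj_on_def)
  ultimately show ?thesis unfolding pm_def by auto
qed

text \<open>The topological full group in the language of germs; \<open>full_group_carrier\<close>
  and \<open>full_group_H\<close> identify it with the full groups of the two groupoids.\<close>

definition F :: "('a \<Rightarrow> 'a) set" where "F = {\<alpha> \<in> Bij X. \<forall>x\<in>X. L \<alpha> x}"

abbreviation "B \<equiv> BijGroup X"

end

lemma BijGroup_mult_apply: "f \<in> Bij S \<Longrightarrow> g \<in> Bij S \<Longrightarrow> x \<in> S \<Longrightarrow> (f \<otimes>\<^bsub>BijGroup S\<^esub> g) x = f (g x)"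
  by (simp add: BijGroup_def compose_def)

lemma BijGroup_carrier: "carrier (BijGroup S) = Bij S"
  by (simp add: BijGroup_def)

lemma BijGroup_one_apply: "x \<in> S \<Longrightarrow> \<one>\<^bsub>BijGroup S\<^esub> x = x"
  by (simp add: BijGroup_def)

lemma Bij_eqI: "f \<in> Bij S \<Longrightarrow> g \<in> Bij S \<Longrightarrow> (\<And>x. x \<in> S \<Longrightarrow> f x = g x) \<Longrightarrow> f = g"
  by (metis Bij_imp_extensional extensionalityI)

lemma Bij_closed: "f \<in> Bij S \<Longrightarrow> x \<in> S \<Longrightarrow> f x \<in> S"
  by (auto simp: Bij_def bij_betw_def)

lemma Bij_inj: "f \<in> Bij S \<Longrightarrow> x \<in> S \<Longrightarrow> y \<in> S \<Longrightarrow> f x = f y \<longleftrightarrow> x = y"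
  by (auto simp: Bij_def bij_betw_def inj_on_def)

context germs begin

sublocale B: group "BijGroup X" by (rule group_BijGroup)

lemma F_pm: "\<alpha> \<in> F \<Longrightarrow> pm X \<alpha>"
  by (auto simp: F_def pm_def Bij_def bij_betw_def)

lemma F_Bij: "\<alpha> \<in> F \<Longrightarrow> \<alpha> \<in> Bij X" by (simp add: F_def)

lemma F_L: "\<alpha> \<in> F \<Longrightarrow> x \<in> X \<Longrightarrow> L \<alpha> x" by (simp add: F_def)

lemma F_image: "\<alpha> \<in> F \<Longrightarrow> \<alpha> ` X = X" by (simp add: F_def Bij_def bij_betw_def)

lemma subgroup_F: "subgroup F B"
proof
  show "F \<subseteq> carrier B" by (auto simp: F_def BijGroup_carrier)
  show "\<one>\<^bsub>B\<^esub> \<in> F"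
  proof -
    have "L (\<lambda>x\<in>X. x) x" if "x \<in> X" for x using L_cong[OF L_id[OF that], of X] that by simp
    then show ?thesis using B.one_closed by (auto simp: F_def BijGroup_def)
  qed
  fix f g assume fg: "f \<in> F" "g \<in> F"
  then have m: "f \<otimes>\<^bsub>B\<^esub> g \<in> Bij X" using B.m_closed by (simp add: BijGroup_carrier F_def)
  have "L (f \<otimes>\<^bsub>B\<^esub> g) x" if x: "x \<in> X" for x
  proof -
    have "L (\<lambda>y. f (g y)) x" by (rule L_comp[of g x f]) (use fg x in \<open>simp_all add: F_L F_Bij Bij_closed\<close>)
    from L_cong[OF this, of X] show ?thesis using fg x by (simp add: F_Bij BijGroup_mult_apply)
  qed
  then show "f \<otimes>\<^bsub>B\<^esub> g \<in> F" using m by (simp add: F_def)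
next
  fix f assume f: "f \<in> F"
  have i: "inv\<^bsub>B\<^esub> f = (\<lambda>x\<in>X. inv_into X f x)" using inv_BijGroup F_Bij[OF f] by blast
  have "L (inv\<^bsub>B\<^esub> f) x" if "x \<in> X" for x unfolding i
    by (rule L_cong[of "inv_into X f" _ X]) (use that pm_inv_L[OF F_pm[OF f]] F_image[OF f] in auto)
  then show "inv\<^bsub>B\<^esub> f \<in> F" using B.inv_closed f by (simp add: F_def BijGroup_carrier)
qed

lemma F_mult: "\<alpha> \<in> F \<Longrightarrow> \<beta> \<in> F \<Longrightarrow> \<alpha> \<otimes>\<^bsub>B\<^esub> \<beta> \<in> F"
  and F_inv: "\<alpha> \<in> F \<Longrightarrow> inv\<^bsub>B\<^esub> \<alpha> \<in> F"
  using subgroup_F by (auto simp: subgroup_def)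

lemma F_carrier: "\<alpha> \<in> F \<Longrightarrow> \<alpha> \<in> carrier B"
  by (simp add: BijGroup_carrier F_Bij)

lemma F_apply: "\<alpha> \<in> F \<Longrightarrow> \<beta> \<in> F \<Longrightarrow> x \<in> X \<Longrightarrow> (\<alpha> \<otimes>\<^bsub>B\<^esub> \<beta>) x = \<alpha> (\<beta> x)"
  by (simp add: BijGroup_mult_apply F_Bij)

lemma F_closed: "\<alpha> \<in> F \<Longrightarrow> x \<in> X \<Longrightarrow> \<alpha> x \<in> X" 
  by (simp add: F_Bij Bij_closed)

lemma F_eqI: "\<alpha> \<in> F \<Longrightarrow> \<beta> \<in> F \<Longrightarrow> (\<And>x. x \<in> X \<Longrightarrow> \<alpha> x = \<beta> x) \<Longrightarrow> \<alpha> = \<beta>"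
  by (rule Bij_eqI[of _ X]) (auto simp: F_Bij)

lemma F_inj: "\<alpha> \<in> F \<Longrightarrow> x \<in> X \<Longrightarrow> y \<in> X \<Longrightarrow> \<alpha> x = \<alpha> y \<longleftrightarrow> x = y"
  by (rule Bij_inj[of _ X]) (auto simp: F_Bij)

lemma F_inv_apply: "\<alpha> \<in> F \<Longrightarrow> x \<in> X \<Longrightarrow> (inv\<^bsub>B\<^esub> \<alpha>) (\<alpha> x) = x"
  using F_apply[of "inv\<^bsub>B\<^esub> \<alpha>" \<alpha> x] F_inv[of \<alpha>] B.l_inv[OF F_carrier, of \<alpha>]
  by (simp add: BijGroup_one_apply)

text \<open>The two exchanged sets are both images of the base N. This redundancy makes conjugation
  by \<alpha> a postcomposition of f and g with \<alpha> (\<open>swp_conj\<close>) and lets the base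
  be shrunk or changed without touching the maps.\<close>

definition swp :: "'a set \<Rightarrow> ('a \<Rightarrow> 'a) \<Rightarrow> ('a \<Rightarrow> 'a) \<Rightarrow> 'a \<Rightarrow> 'a" where
  "swp N f g = (\<lambda>y\<in>X. if y \<in> f ` N then g (inv_into N f y)
     else if y \<in> g ` N then f (inv_into N g y) else y)"

definition pm2 :: "'a set \<Rightarrow> ('a \<Rightarrow> 'a) \<Rightarrow> ('a \<Rightarrow> 'a) \<Rightarrow> bool" where
  "pm2 N f g \<longleftrightarrow> pm N f \<and> pm N g \<and> f ` N \<inter> g ` N = {}"

lemma pm2_subset: "pm2 N f g \<Longrightarrow> clopen N' \<Longrightarrow> N' \<subseteq> N \<Longrightarrow> pm2 N' f g"
  unfolding pm2_def by (meson disjoint_iff image_mono pm_subset subsetD)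

lemma small_pm2: "L f x \<Longrightarrow> L g x \<Longrightarrow> f x \<noteq> g x \<Longrightarrow> \<forall>\<^sub>F N in small x. pm2 N f g"
  unfolding pm2_def by (simp add: eventually_conj small_pm small_disjoint)

lemma pm2_commute: "pm2 N f g \<Longrightarrow> pm2 N g f"
  by (auto simp: pm2_def)

lemma pmD:
  assumes "pm N f" shows "inj_on f N" "x \<in> N \<Longrightarrow> f x \<in> X" "x \<in> N \<Longrightarrow> x \<in> X"
    "x \<in> N \<Longrightarrow> L f x" "clopen N"
  using assms pm_image_subset[OF assms] clopen_subset unfolding pm_def by auto

lemma swp_apply:
  assumes "pm2 N f g"
  shows "x \<in> N \<Longrightarrow> swp N f g (f x) = g x" "x \<in> N \<Longrightarrow> swp N f g (g x) = f x"
    "y \<in> X \<Longrightarrow> y \<notin> f ` N \<Longrightarrow> y \<notin> g ` N \<Longrightarrow> swp N f g y = y"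
  using assms pmD[of N f] pmD[of N g] unfolding pm2_def swp_def
  by (auto simp: inv_into_f_f)

lemma swp_cases:
  assumes "pm2 N f g" "y \<in> X"
  obtains x where "x \<in> N" "y = f x" "swp N f g y = g x" | x where "x \<in> N" "y = g x" "swp N f g y = f x"
    | "y \<notin> f ` N" "y \<notin> g ` N" "swp N f g y = y"
  using assms swp_apply[OF assms(1)] by blast

lemma swp_F: assumes "pm2 N f g" shows "swp N f g \<in> F"
proof -
  have cl: "swp N f g y \<in> X" if "y \<in> X" for y
    using swp_cases[OF assms that] assms pmD that unfolding pm2_def by metis
  have invol: "swp N f g (swp N f g y) = y" if "y \<in> X" for y
    using swp_cases[OF assms that] swp_apply[OF assms] by metis
  have "bij_betw (swp N f g) X X" by (rule bij_betwI[of _ _ _ "swp N f g"]) (use cl invol in auto)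
  moreover have "swp N f g \<in> extensional X" by (simp add: swp_def)
  moreover have "L (swp N f g) y" if y: "y \<in> X" for y
  proof -
    have o: "openin T (f ` N)" "openin T (g ` N)" "openin T (X - f ` N - g ` N)"
      using assms pm_image_clopen unfolding pm2_def clopenin_def by blast+
    have pmi: "pm (f ` N) (inv_into N f)" "pm (g ` N) (inv_into N g)" using assms pm_inv unfolding pm2_def by auto
    consider "y \<in> f ` N" | "y \<in> g ` N" | "y \<in> X - f ` N - g ` N" using y by blast
    then show ?thesis
    proof cases
      case 1
      have "L (\<lambda>z. g (inv_into N f z)) y" using 1 pmi assms
        by (intro L_comp[of "inv_into N f" y g]) (auto simp: pm_def pm2_def)
      then show ?thesis by (rule L_cong[OF _ o(1) 1]) (use assms pmD in \<open>auto simp: swp_def pm2_def\<close>)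
    next
      case 2
      have "L (\<lambda>z. f (inv_into N g z)) y" using 2 pmi assms
        by (intro L_comp[of "inv_into N g" y f]) (auto simp: pm_def pm2_def)
      then show ?thesis by (rule L_cong[OF _ o(2) 2]) (use assms pmD in \<open>auto simp: swp_def pm2_def\<close>)
    next
      case 3
      show ?thesis by (rule L_cong[OF L_id[OF y] o(3) 3]) (auto simp: swp_def)
    qed
  qed
  ultimately show ?thesis by (simp add: F_def Bij_def)
qed

lemma swp_empty: "swp {} f g = \<one>\<^bsub>B\<^esub>"
  by (simp add: swp_def BijGroup_def restrict_def)

lemma swp_invol: assumes "pm2 N f g" shows "swp N f g \<otimes>\<^bsub>B\<^esub> swp N f g = \<one>\<^bsub>B\<^esub>"
proof (rule F_eqI)
  show "swp N f g \<otimes>\<^bsub>B\<^esub> swp N f g \<in> F" "\<one>\<^bsub>B\<^esub> \<in> F"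
    using assms F_mult swp_F subgroup_F subgroup.one_closed by blast+
  fix x assume x: "x \<in> X"
  have "swp N f g (swp N f g x) = x"
    using swp_cases[OF assms x] swp_apply[OF assms] by metis
  then show "(swp N f g \<otimes>\<^bsub>B\<^esub> swp N f g) x = \<one>\<^bsub>B\<^esub> x"
    using swp_F[OF assms] x by (simp add: F_apply BijGroup_one_apply)
qed

lemma swp_inv: "pm2 N f g \<Longrightarrow> inv\<^bsub>B\<^esub> (swp N f g) = swp N f g"
  by (meson B.inv_equality F_carrier swp_F swp_invol)

lemma swp_cong:
  assumes "\<And>x. x \<in> N \<Longrightarrow> f' x = f x" "\<And>x. x \<in> N \<Longrightarrow> g' x = g x"
  shows "swp N f' g' = swp N f g"
proof -
  have im: "f' ` N = f ` N" "g' ` N = g ` N" using assms by (auto simp: image_def)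
  have "inv_into N f' y = inv_into N f y" "inv_into N g' y = inv_into N g y" for y
    unfolding inv_into_def using assms by (metis (mono_tags, lifting))+
  then show ?thesis using assms unfolding swp_def im
    by (auto intro!: restrict_ext simp: inv_into_into)
qed

lemma swp_commute: assumes "pm2 N f g" shows "swp N f g = swp N g f"
proof (rule F_eqI)
  show "swp N f g \<in> F" "swp N g f \<in> F" using swp_F assms pm2_commute by blast+
  fix y assume "y \<in> X"
  then show "swp N f g y = swp N g f y" using assms by (auto simp: swp_def pm2_def)
qed

lemma pm2_F: assumes "\<alpha> \<in> F" "pm2 N f g" shows "pm2 N (\<lambda>x. \<alpha> (f x)) (\<lambda>x. \<alpha> (g x))"
proof -
  have p: "pm N (\<lambda>x. \<alpha> (f x))" "pm N (\<lambda>x. \<alpha> (g x))"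
    using assms pm_comp[of N f X \<alpha>] pm_comp[of N g X \<alpha>] F_pm pm_image_subset
    unfolding pm2_def by simp_all
  have "\<alpha> (f x) \<noteq> \<alpha> (g y)" if "x \<in> N" "y \<in> N" for x y
  proof -
    have "f x \<in> X" "g y \<in> X" "f x \<noteq> g y" using assms that pmD[of N f] pmD[of N g] by (auto simp: pm2_def)
    then show ?thesis using F_inj[OF assms(1)] by blast
  qed
  then show ?thesis using p by (auto simp: pm2_def)
qed

lemma swp_conj:
  assumes "\<alpha> \<in> F" "pm2 N f g"
  shows "\<alpha> \<otimes>\<^bsub>B\<^esub> swp N f g \<otimes>\<^bsub>B\<^esub> inv\<^bsub>B\<^esub> \<alpha> = swp N (\<lambda>x. \<alpha> (f x)) (\<lambda>x. \<alpha> (g x))"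
proof -
  note p = pm2_F[OF assms]
  have "\<alpha> \<otimes>\<^bsub>B\<^esub> swp N f g = swp N (\<lambda>x. \<alpha> (f x)) (\<lambda>x. \<alpha> (g x)) \<otimes>\<^bsub>B\<^esub> \<alpha>"
  proof (rule F_eqI)
    fix y assume y: "y \<in> X"
    from assms(2) y have "\<alpha> (swp N f g y) = swp N (\<lambda>x. \<alpha> (f x)) (\<lambda>x. \<alpha> (g x)) (\<alpha> y)"
    proof (cases rule: swp_cases)
      case (1 x) then show ?thesis using swp_apply(1)[OF p] by metis
    next
      case (2 x) then show ?thesis using swp_apply(2)[OF p] by metis
    next
      case 3
      have fg: "f x \<in> X" "g x \<in> X" if "x \<in> N" for x
        using assms(2) pmD(2)[of N f] pmD(2)[of N g] that by (auto simp: pm2_def)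
      have "\<alpha> y \<notin> (\<lambda>x. \<alpha> (f x)) ` N" "\<alpha> y \<notin> (\<lambda>x. \<alpha> (g x)) ` N"
        using 3 F_inj[OF assms(1) y fg(1)] F_inj[OF assms(1) y fg(2)] by blast+
      then show ?thesis using 3 swp_apply(3)[OF p] F_closed[OF assms(1) y] by simp
    qed
    then show "(\<alpha> \<otimes>\<^bsub>B\<^esub> swp N f g) y = (swp N (\<lambda>x. \<alpha> (f x)) (\<lambda>x. \<alpha> (g x)) \<otimes>\<^bsub>B\<^esub> \<alpha>) y"
      using assms p swp_F y by (simp add: F_apply)
  qed (use assms p swp_F F_mult in auto)
  then show ?thesis using assms p swp_F F_carrier by (metis B.inv_solve_right' B.m_closed)
qed

text \<open>Additivity in the base set is what allows statements about small transpositions to be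
  glued by \<open>cover_induct\<close>.\<close>

lemma swp_split:
  assumes "pm2 (N1 \<union> N2) f g" "clopen N1" "clopen N2" "N1 \<inter> N2 = {}"
  shows "swp (N1 \<union> N2) f g = swp N1 f g \<otimes>\<^bsub>B\<^esub> swp N2 f g"
proof -
  have p: "pm2 N1 f g" "pm2 N2 f g" using pm2_subset[OF assms(1)] assms by auto
  note a = swp_apply[OF assms(1)] swp_apply[OF p(1)] swp_apply[OF p(2)]
  have inj: "inj_on f (N1 \<union> N2)" "inj_on g (N1 \<union> N2)" using assms(1) by (auto simp: pm2_def pm_def)
  have d: "f x \<in> f ` M \<longleftrightarrow> x \<in> M" "g x \<in> g ` M \<longleftrightarrow> x \<in> M" "f x \<notin> g ` M" "g x \<notin> f ` M"
    "f x \<in> X" "g x \<in> X"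
    if "x \<in> N1 \<union> N2" "M \<subseteq> N1 \<union> N2" for x M
  proof -
    have "f ` (N1 \<union> N2) \<inter> g ` (N1 \<union> N2) = {}" using assms(1) by (simp add: pm2_def)
    then show "f x \<notin> g ` M" "g x \<notin> f ` M" using that by blast+
    show "f x \<in> X" "g x \<in> X" using assms(1) pmD(2)[of _ _ x] that(1) unfolding pm2_def by blast+
  qed (use inj inj_on_image_mem_iff that in metis)+
  show ?thesis
  proof (rule F_eqI)
    fix y assume y: "y \<in> X"
    have "swp (N1 \<union> N2) f g y = swp N1 f g (swp N2 f g y)"
    proof (rule swp_cases[OF assms(1) y])
      fix x assume x: "x \<in> N1 \<union> N2" "y = f x" "swp (N1 \<union> N2) f g y = g x"
      have "x \<in> N1 \<longleftrightarrow> x \<notin> N2" using x assms(4) by blast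
      then show ?thesis using x d[OF x(1), of N1] d[OF x(1), of N2] a(4-9) by (cases "x \<in> N1") auto
    next
      fix x assume x: "x \<in> N1 \<union> N2" "y = g x" "swp (N1 \<union> N2) f g y = f x"
      have "x \<in> N1 \<longleftrightarrow> x \<notin> N2" using x assms(4) by blast
      then show ?thesis using x d[OF x(1), of N1] d[OF x(1), of N2] a(4-9) by (cases "x \<in> N1") auto
    next
      assume "y \<notin> f ` (N1 \<union> N2)" "y \<notin> g ` (N1 \<union> N2)" "swp (N1 \<union> N2) f g y = y"
      moreover from this have "swp N2 f g y = y" "swp N1 f g y = y"
        using y by (auto intro: a(6) a(9) simp del: image_Un)
      ultimately show ?thesis by simp
    qed
    then show "swp (N1 \<union> N2) f g y = (swp N1 f g \<otimes>\<^bsub>B\<^esub> swp N2 f g) y"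
      using p y swp_F by (simp add: F_apply)
  qed (use assms p swp_F F_mult in auto)
qed

end

section \<open>Three-cycles\<close>

text \<open>Applied in the quotient by \<open>alt\<close>: s and t are the classes of corrections
  built from transpositions, and commutation of the corrected elements s a and t b is passed back to
  a and b.\<close>

lemma (in group) commute_mod_central:
  assumes "s \<in> carrier G" "t \<in> carrier G" "a \<in> carrier G" "b \<in> carrier G"
    and "s \<otimes> b = b \<otimes> s" "t \<otimes> a = a \<otimes> t" "s \<otimes> t = t \<otimes> s"
    and c: "(s \<otimes> a) \<otimes> (t \<otimes> b) = (t \<otimes> b) \<otimes> (s \<otimes> a)"
  shows "a \<otimes> b = b \<otimes> a"
proof -
  have "(s \<otimes> a) \<otimes> (t \<otimes> b) = s \<otimes> ((t \<otimes> a) \<otimes> b)" using assms(1-4,6) by (simp add: m_assoc)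
  then have 1: "(s \<otimes> a) \<otimes> (t \<otimes> b) = (s \<otimes> t) \<otimes> (a \<otimes> b)" using assms(1-4) by (simp add: m_assoc)
  have "(t \<otimes> b) \<otimes> (s \<otimes> a) = t \<otimes> ((s \<otimes> b) \<otimes> a)" using assms(1-5) by (simp add: m_assoc)
  then have 2: "(t \<otimes> b) \<otimes> (s \<otimes> a) = (s \<otimes> t) \<otimes> (b \<otimes> a)" using assms(1-4,7) by (simp add: m_assoc)
  from 1 2 c show ?thesis using assms(1-4) by (metis Units_eq Units_l_cancel m_closed)
qed

lemma (in group) conj_mult:
  assumes "a \<in> carrier G" "s \<in> carrier G" "t \<in> carrier G"
  shows "a \<otimes> (s \<otimes> t) \<otimes> inv a = (a \<otimes> s \<otimes> inv a) \<otimes> (a \<otimes> t \<otimes> inv a)"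
proof -
  have "(a \<otimes> s \<otimes> inv a) \<otimes> (a \<otimes> t \<otimes> inv a) = a \<otimes> s \<otimes> (inv a \<otimes> a) \<otimes> t \<otimes> inv a"
    using assms by (simp only: m_assoc inv_closed m_closed)
  then show ?thesis using assms by (simp add: m_assoc)
qed

lemma (in group) conj_eq_iff:
  assumes "a \<in> carrier G" "s \<in> carrier G" "t \<in> carrier G"
  shows "a \<otimes> s \<otimes> inv a = t \<longleftrightarrow> a \<otimes> s = t \<otimes> a"
  using assms by (metis inv_solve_right' m_closed)

context germs begin

text \<open>\<open>tc N f g h\<close> is the 3-cycle \<open>f x \<mapsto> g x \<mapsto> h x \<mapsto> f x\<close> for \<open>x\<close> in \<open>N\<close>.\<close>

definition tri :: "'a set \<Rightarrow> ('a \<Rightarrow> 'a) \<Rightarrow> ('a \<Rightarrow> 'a) \<Rightarrow> ('a \<Rightarrow> 'a) \<Rightarrow> bool" where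
  "tri N f g h \<longleftrightarrow> pm2 N f g \<and> pm2 N g h \<and> pm2 N f h"

definition tc :: "'a set \<Rightarrow> ('a \<Rightarrow> 'a) \<Rightarrow> ('a \<Rightarrow> 'a) \<Rightarrow> ('a \<Rightarrow> 'a) \<Rightarrow> 'a \<Rightarrow> 'a" where
  "tc N f g h = swp N f g \<otimes>\<^bsub>B\<^esub> swp N g h"

definition alt :: "('a \<Rightarrow> 'a) set" where
  "alt = generate B {tc N f g h |N f g h. tri N f g h}"

lemma small_tri:
  "L f x \<Longrightarrow> L g x \<Longrightarrow> L h x \<Longrightarrow> f x \<noteq> g x \<Longrightarrow> g x \<noteq> h x \<Longrightarrow> f x \<noteq> h x \<Longrightarrow>
    \<forall>\<^sub>F N in small x. tri N f g h"
  unfolding tri_def by (intro eventually_conj small_pm2)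

lemma tri_subset: "tri N f g h \<Longrightarrow> clopen N' \<Longrightarrow> N' \<subseteq> N \<Longrightarrow> tri N' f g h"
  unfolding tri_def by (blast intro: pm2_subset)

lemma tri_rotate: "tri N f g h \<Longrightarrow> tri N g h f"
  unfolding tri_def by (blast intro: pm2_commute)

lemma tri_F: "\<alpha> \<in> F \<Longrightarrow> tri N f g h \<Longrightarrow> tri N (\<lambda>x. \<alpha> (f x)) (\<lambda>x. \<alpha> (g x)) (\<lambda>x. \<alpha> (h x))"
  unfolding tri_def by (blast intro: pm2_F)

lemma tc_F: "tri N f g h \<Longrightarrow> tc N f g h \<in> F"
  unfolding tc_def tri_def by (blast intro: F_mult swp_F)

lemma tc_cong:
  assumes "\<And>x. x \<in> N \<Longrightarrow> f' x = f x" "\<And>x. x \<in> N \<Longrightarrow> g' x = g x" "\<And>x. x \<in> N \<Longrightarrow> h' x = h x"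
  shows "tc N f' g' h' = tc N f g h"
  unfolding tc_def using assms swp_cong[of N f' f g' g] swp_cong[of N g' g h' h] by simp

lemma tc_conj:
  assumes "\<alpha> \<in> F" "tri N f g h"
  shows "\<alpha> \<otimes>\<^bsub>B\<^esub> tc N f g h \<otimes>\<^bsub>B\<^esub> inv\<^bsub>B\<^esub> \<alpha> = tc N (\<lambda>x. \<alpha> (f x)) (\<lambda>x. \<alpha> (g x)) (\<lambda>x. \<alpha> (h x))"
  using assms unfolding tc_def tri_def by (simp add: B.conj_mult F_carrier swp_F swp_conj)

lemma tri_apply:
  assumes "tri N f g h" "x \<in> N"
  shows "swp N f g (f x) = g x" "swp N f g (g x) = f x" "swp N f g (h x) = h x"
    "f x \<in> X" "g x \<in> X" "h x \<in> X"
proof -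
  have p: "pm2 N f g" using assms by (simp add: tri_def)
  show "f x \<in> X" "g x \<in> X" and h: "h x \<in> X"
    using assms pmD(2)[of N f] pmD(2)[of N g] pmD(2)[of N h] by (simp_all add: tri_def pm2_def)
  show "swp N f g (f x) = g x" "swp N f g (g x) = f x" using swp_apply[OF p] assms(2) by auto
  show "swp N f g (h x) = h x"
    by (rule swp_apply(3)[OF p h]) (use assms in \<open>auto simp: tri_def pm2_def\<close>)
qed

lemma tc_apply:
  assumes "tri N f g h" "x \<in> N"
  shows "tc N f g h (f x) = g x" "tc N f g h (g x) = h x" "tc N f g h (h x) = f x"
proof -
  note t = tri_apply[OF assms] tri_apply[OF tri_rotate[OF assms(1)] assms(2)]
  have "swp N f g \<in> F" "swp N g h \<in> F" using assms(1) swp_F by (auto simp: tri_def)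
  then show "tc N f g h (f x) = g x" "tc N f g h (g x) = h x" "tc N f g h (h x) = f x"
    using t unfolding tc_def by (simp_all add: F_apply)
qed

lemma tc_apply_other:
  assumes "tri N f g h" "y \<in> X" "y \<notin> f ` N" "y \<notin> g ` N" "y \<notin> h ` N"
  shows "tc N f g h y = y"
proof -
  have "swp N f g \<in> F" "swp N g h \<in> F" using assms(1) swp_F by (auto simp: tri_def)
  then show ?thesis using assms swp_apply(3) unfolding tc_def tri_def by (simp add: F_apply)
qed

text \<open>Conjugating the transposition of h and f by that of g and h gives the transposition of g
  and f; rearranged, this is the equality of the two products.\<close>

lemma tc_rotate: assumes "tri N f g h" shows "tc N g h f = tc N f g h"
proof -
  have p: "pm2 N g h" "pm2 N h f" "pm2 N f g" using assms pm2_commute by (auto simp: tri_def)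
  have "swp N g h \<otimes>\<^bsub>B\<^esub> swp N h f \<otimes>\<^bsub>B\<^esub> inv\<^bsub>B\<^esub> (swp N g h) =
      swp N (\<lambda>x. swp N g h (h x)) (\<lambda>x. swp N g h (f x))"
    using p swp_F swp_conj by blast
  also have "\<dots> = swp N g f"
    using tri_apply[OF tri_rotate[OF assms]] by (intro swp_cong) auto
  also have "\<dots> = swp N f g" using p(3) swp_commute by metis
  finally show ?thesis unfolding tc_def using p swp_F F_carrier B.conj_eq_iff by metis
qed

text \<open>The factors \<open>swp N1 g h\<close> and \<open>swp N2 f g\<close> have disjoint
  supports, so conjugating one by the other changes nothing. They may be exchanged, and the four
  transpositions regroup.\<close>

lemma tc_split:
  assumes "tri (N1 \<union> N2) f g h" "clopen N1" "clopen N2" "N1 \<inter> N2 = {}"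
  shows "tc (N1 \<union> N2) f g h = tc N1 f g h \<otimes>\<^bsub>B\<^esub> tc N2 f g h"
proof -
  have t: "tri N1 f g h" "tri N2 f g h" using tri_subset[OF assms(1)] assms by auto
  then have F: "swp N1 f g \<in> F" "swp N2 f g \<in> F" "swp N1 g h \<in> F" "swp N2 g h \<in> F"
    using swp_F by (auto simp: tri_def)
  have sp: "swp (N1 \<union> N2) f g = swp N1 f g \<otimes>\<^bsub>B\<^esub> swp N2 f g" "swp (N1 \<union> N2) g h = swp N1 g h \<otimes>\<^bsub>B\<^esub> swp N2 g h"
    using assms(1) swp_split[OF _ assms(2-4)] unfolding tri_def by simp_all
  have disj: "f x \<notin> g ` N1" "f x \<notin> h ` N1" "g x \<notin> g ` N1" "g x \<notin> h ` N1" if x: "x \<in> N2" for x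
  proof -
    have d: "f ` (N1 \<union> N2) \<inter> g ` (N1 \<union> N2) = {}" "f ` (N1 \<union> N2) \<inter> h ` (N1 \<union> N2) = {}"
      "g ` (N1 \<union> N2) \<inter> h ` (N1 \<union> N2) = {}" and i: "inj_on g (N1 \<union> N2)"
      using assms(1) by (simp_all add: tri_def pm2_def pm_def)
    show "f x \<notin> g ` N1" "f x \<notin> h ` N1" "g x \<notin> h ` N1" using d x by blast+
    show "g x \<notin> g ` N1" using i x assms(4) by (metis Int_iff UnCI emptyE inj_on_image_mem_iff sup_ge1)
  qed
  have "swp N1 g h \<otimes>\<^bsub>B\<^esub> swp N2 f g \<otimes>\<^bsub>B\<^esub> inv\<^bsub>B\<^esub> (swp N1 g h) =
      swp N2 (\<lambda>x. swp N1 g h (f x)) (\<lambda>x. swp N1 g h (g x))"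
    using t F swp_conj by (auto simp: tri_def)
  also have "\<dots> = swp N2 f g"
    using t tri_apply[OF t(2)] disj swp_apply(3)[of N1 g h] by (intro swp_cong) (auto simp: tri_def)
  finally have c: "swp N1 g h \<otimes>\<^bsub>B\<^esub> swp N2 f g = swp N2 f g \<otimes>\<^bsub>B\<^esub> swp N1 g h"
    using F F_carrier B.conj_eq_iff by metis
  note C = F[THEN F_carrier]
  have "tc (N1 \<union> N2) f g h = swp N1 f g \<otimes>\<^bsub>B\<^esub> (swp N2 f g \<otimes>\<^bsub>B\<^esub> swp N1 g h) \<otimes>\<^bsub>B\<^esub> swp N2 g h"
    unfolding tc_def sp using C by (simp only: B.m_assoc B.m_closed)
  then show ?thesis unfolding tc_def c[symmetric] using C by (simp only: B.m_assoc B.m_closed)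
qed

text \<open>The two transpositions whose product is the 3-cycle are conjugate under that 3-cycle.\<close>

lemma tc_derived: assumes "tri N f g h" shows "tc N f g h \<in> derived B F"
proof -
  define s c where "s = swp N f g" and "c = tc N f g h"
  have F: "s \<in> F" "c \<in> F" using assms swp_F tc_F by (auto simp: tri_def s_def c_def)
  have inv: "inv\<^bsub>B\<^esub> s = s" using assms swp_inv by (auto simp: tri_def s_def)
  have "c \<otimes>\<^bsub>B\<^esub> s \<otimes>\<^bsub>B\<^esub> inv\<^bsub>B\<^esub> c = swp N (\<lambda>x. c (f x)) (\<lambda>x. c (g x))"
    using F(2) assms swp_conj by (auto simp: tri_def s_def)
  also have "\<dots> = swp N g h"
    using tc_apply[OF assms] by (intro swp_cong) (auto simp: c_def)
  \<comment> \<open>Here c = s (c s c^{-1}), and s is its own inverse, so c is the commutator of s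
    and c.\<close>
  finally have "c = s \<otimes>\<^bsub>B\<^esub> c \<otimes>\<^bsub>B\<^esub> inv\<^bsub>B\<^esub> s \<otimes>\<^bsub>B\<^esub> inv\<^bsub>B\<^esub> c"
    using F[THEN F_carrier] unfolding inv by (simp add: B.m_assoc c_def s_def[symmetric] tc_def)
  then show ?thesis using F unfolding derived_def c_def[symmetric] by (blast intro: generate.incl)
qed

lemma alt_F: "alt \<subseteq> F"
  unfolding alt_def by (rule B.generate_subgroup_incl[OF _ subgroup_F]) (auto simp: tc_F)

lemma subgroup_alt: "subgroup alt B"
  unfolding alt_def using tc_F F_carrier by (intro B.generate_is_subgroup) blast

lemma tc_alt: "tri N f g h \<Longrightarrow> tc N f g h \<in> alt"
  unfolding alt_def by (blast intro: generate.incl)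

lemma alt_conj:
  assumes "\<alpha> \<in> F" "s \<in> alt" shows "\<alpha> \<otimes>\<^bsub>B\<^esub> s \<otimes>\<^bsub>B\<^esub> inv\<^bsub>B\<^esub> \<alpha> \<in> alt"
proof -
  interpret alt: subgroup alt B by (rule subgroup_alt)
  note a = F_carrier[OF assms(1)]
  have g: "s \<in> F" if "s \<in> alt" for s using that alt_F by blast
  show ?thesis using assms(2) unfolding alt_def
  proof (induction rule: generate.induct)
    case one then show ?case using a generate.one by simp
  next
    case (incl h)
    then obtain N f g k where h: "h = tc N f g k" "tri N f g k" by blast
    show ?case using tc_conj[OF assms(1) h(2)] tri_F[OF assms(1) h(2)] h(1)
      by (auto intro!: generate.incl)
  next
    case (inv h)
    then obtain N f g k where h: "h = tc N f g k" "tri N f g k" by blast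
    have "\<alpha> \<otimes>\<^bsub>B\<^esub> inv\<^bsub>B\<^esub> h \<otimes>\<^bsub>B\<^esub> inv\<^bsub>B\<^esub> \<alpha> = inv\<^bsub>B\<^esub> (\<alpha> \<otimes>\<^bsub>B\<^esub> h \<otimes>\<^bsub>B\<^esub> inv\<^bsub>B\<^esub> \<alpha>)"
      using a tc_F[OF h(2)] F_carrier h(1) by (simp add: B.inv_mult_group B.m_assoc)
    then show ?case using tc_conj[OF assms(1) h(2)] tri_F[OF assms(1) h(2)] h(1)
      by (auto intro!: generate.inv)
  next
    case (eng h1 h2)
    then have "h1 \<in> carrier B" "h2 \<in> carrier B" unfolding alt_def[symmetric] by auto
    then show ?case using B.conj_mult[OF a] generate.eng[OF eng.IH] by simp
  qed
qed

section \<open>The full group modulo its 3-cycles\<close>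

definition "\<Gamma> = B\<lparr>carrier := F\<rparr>"

lemma group_\<Gamma>: "group \<Gamma>"
  unfolding \<Gamma>_def using B.subgroup_imp_group subgroup_F by blast

lemma \<Gamma>_inv: "x \<in> F \<Longrightarrow> inv\<^bsub>\<Gamma>\<^esub> x = inv\<^bsub>B\<^esub> x"
  unfolding \<Gamma>_def using B.m_inv_consistent subgroup_F by blast

lemma normal_alt: "alt \<lhd> \<Gamma>"
proof -
  interpret \<Gamma>: group \<Gamma> by (rule group_\<Gamma>)
  have "subgroup alt \<Gamma>"
    unfolding \<Gamma>_def using B.subgroup_incl[OF subgroup_alt subgroup_F alt_F] .
  then show ?thesis
    unfolding \<Gamma>.normal_inv_iff using alt_conj by (auto simp: \<Gamma>_inv \<Gamma>_def[THEN arg_cong[of _ _ carrier]] \<Gamma>_def[THEN arg_cong[of _ _ mult]])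
qed

definition "Q = \<Gamma> Mod alt"
definition "\<pi> x = alt #>\<^bsub>\<Gamma>\<^esub> x"

sublocale Q: group Q
  unfolding Q_def by (rule normal.factorgroup_is_group[OF normal_alt])

lemma \<pi>_closed: "x \<in> F \<Longrightarrow> \<pi> x \<in> carrier Q"
  and \<pi>_mult: "x \<in> F \<Longrightarrow> y \<in> F \<Longrightarrow> \<pi> (x \<otimes>\<^bsub>B\<^esub> y) = \<pi> x \<otimes>\<^bsub>Q\<^esub> \<pi> y"
  using normal.r_coset_hom_Mod[OF normal_alt] unfolding hom_def Q_def \<pi>_def by (auto simp: \<Gamma>_def)

lemma \<pi>_one_iff: assumes "x \<in> F" shows "\<pi> x = \<one>\<^bsub>Q\<^esub> \<longleftrightarrow> x \<in> alt"
proof -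
  have s: "subgroup alt \<Gamma>" using normal_alt normal_imp_subgroup by blast
  then show ?thesis using assms group.coset_join1[OF group_\<Gamma> _ _ s] group.coset_join2[OF group_\<Gamma> _ s]
      subgroup.subset[OF s] unfolding Q_def \<pi>_def FactGroup_def by (auto simp: \<Gamma>_def)
qed

lemma \<pi>_inv: assumes "x \<in> F" shows "\<pi> (inv\<^bsub>B\<^esub> x) = inv\<^bsub>Q\<^esub> \<pi> x"
proof -
  have "\<pi> (inv\<^bsub>B\<^esub> x) \<otimes>\<^bsub>Q\<^esub> \<pi> x = \<pi> (inv\<^bsub>B\<^esub> x \<otimes>\<^bsub>B\<^esub> x)" using assms F_inv \<pi>_mult by simp
  also have "\<dots> = \<one>\<^bsub>Q\<^esub>"
    using assms F_carrier \<pi>_one_iff subgroup.one_closed[OF subgroup_F] subgroup.one_closed[OF subgroup_alt] by simp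
  finally show ?thesis using assms F_inv \<pi>_closed by (metis Q.inv_equality)
qed

text \<open>Centrality refers to the class in Q; t itself need not commute with the elements of
  F.\<close>

definition central :: "('a \<Rightarrow> 'a) \<Rightarrow> bool" where
  "central t \<longleftrightarrow> t \<in> F \<and> (\<forall>\<alpha>\<in>F. \<pi> \<alpha> \<otimes>\<^bsub>Q\<^esub> \<pi> t = \<pi> t \<otimes>\<^bsub>Q\<^esub> \<pi> \<alpha>)"

lemma commute_mult:
  assumes "\<alpha> \<in> F" "s \<in> F" "t \<in> F" 
    "\<pi> \<alpha> \<otimes>\<^bsub>Q\<^esub> \<pi> s = \<pi> s \<otimes>\<^bsub>Q\<^esub> \<pi> \<alpha>" "\<pi> \<alpha> \<otimes>\<^bsub>Q\<^esub> \<pi> t = \<pi> t \<otimes>\<^bsub>Q\<^esub> \<pi> \<alpha>"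
  shows "\<pi> \<alpha> \<otimes>\<^bsub>Q\<^esub> \<pi> (s \<otimes>\<^bsub>B\<^esub> t) = \<pi> (s \<otimes>\<^bsub>B\<^esub> t) \<otimes>\<^bsub>Q\<^esub> \<pi> \<alpha>"
proof -
  note c = assms(1-3)[THEN \<pi>_closed]
  have "\<pi> \<alpha> \<otimes>\<^bsub>Q\<^esub> (\<pi> s \<otimes>\<^bsub>Q\<^esub> \<pi> t) = \<pi> s \<otimes>\<^bsub>Q\<^esub> (\<pi> \<alpha> \<otimes>\<^bsub>Q\<^esub> \<pi> t)"
    using c assms(4) by (metis Q.m_assoc)
  then show ?thesis using assms(2,3,5) c by (simp add: \<pi>_mult Q.m_assoc)
qed

lemma central_mult: "central s \<Longrightarrow> central t \<Longrightarrow> central (s \<otimes>\<^bsub>B\<^esub> t)"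
  unfolding central_def by (simp add: commute_mult F_mult)

lemma one_F: "\<one>\<^bsub>B\<^esub> \<in> F" using subgroup.one_closed[OF subgroup_F] .

lemma \<pi>_one: "\<pi> \<one>\<^bsub>B\<^esub> = \<one>\<^bsub>Q\<^esub>" 
  using \<pi>_one_iff one_F subgroup.one_closed[OF subgroup_alt] by blast

lemma central_one: "central \<one>\<^bsub>B\<^esub>"
  unfolding central_def using one_F \<pi>_one \<pi>_closed by simp

text \<open>In cycle notation (12)(23) times (23)(34) is (12)(34), so the product of the two
  transpositions lies in \<open>alt\<close>. Since each is an involution, their classes
  agree.\<close>

lemma \<pi>_swp_eq_disjoint:
  assumes "pm2 N f1 f2" "pm2 N f3 f4" "pm2 N f1 f3" "pm2 N f1 f4" "pm2 N f2 f3" "pm2 N f2 f4"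
  shows "\<pi> (swp N f1 f2) = \<pi> (swp N f3 f4)"
proof -
  have t: "tri N f1 f2 f3" "tri N f2 f3 f4" using assms by (auto simp: tri_def)
  have F: "swp N f1 f2 \<in> F" "swp N f2 f3 \<in> F" "swp N f3 f4 \<in> F" using assms swp_F by auto
  note C = F[THEN F_carrier]
  have inv: "swp N f2 f3 \<otimes>\<^bsub>B\<^esub> swp N f2 f3 = \<one>\<^bsub>B\<^esub>" using assms swp_invol by auto
  have "tc N f1 f2 f3 \<otimes>\<^bsub>B\<^esub> tc N f2 f3 f4 =
     swp N f1 f2 \<otimes>\<^bsub>B\<^esub> (swp N f2 f3 \<otimes>\<^bsub>B\<^esub> swp N f2 f3) \<otimes>\<^bsub>B\<^esub> swp N f3 f4"
    unfolding tc_def using C by (simp only: B.m_assoc B.m_closed)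
  then have "swp N f1 f2 \<otimes>\<^bsub>B\<^esub> swp N f3 f4 \<in> alt"
    using inv C subgroup.m_closed[OF subgroup_alt tc_alt[OF t(1)] tc_alt[OF t(2)]] by simp
  then have "\<pi> (swp N f1 f2) \<otimes>\<^bsub>Q\<^esub> \<pi> (swp N f3 f4) = \<one>\<^bsub>Q\<^esub>"
    using F F_mult \<pi>_one_iff \<pi>_mult by metis
  moreover have "\<pi> (swp N f3 f4) \<otimes>\<^bsub>Q\<^esub> \<pi> (swp N f3 f4) = \<one>\<^bsub>Q\<^esub>"
    using F(3) \<pi>_mult[of "swp N f3 f4" "swp N f3 f4"] swp_invol assms(2) \<pi>_one by simp
  ultimately show ?thesis using F \<pi>_closed by (metis Q.right_cancel)
qed

text \<open>Conjugating \<open>t \<alpha>\<close> by the involution exchanging \<open>Y \<inter> Z\<close> with its image under \<open>\<phi>\<close> moves its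
  support off that of \<open>t' \<beta>\<close>, and the involution is central modulo \<open>alt\<close>.\<close>

lemma commute_of_separation:
  assumes "\<alpha> \<in> F" "\<beta> \<in> F" and ct: "central t" "central t'" and YZ: "clopen Y" "clopen Z"
    and fY: "\<And>x. x \<in> X - Y \<Longrightarrow> (t \<otimes>\<^bsub>B\<^esub> \<alpha>) x = x" and fZ: "\<And>x. x \<in> X - Z \<Longrightarrow> (t' \<otimes>\<^bsub>B\<^esub> \<beta>) x = x"
    and p: "pm (Y \<inter> Z) \<phi>" and im: "\<phi> ` (Y \<inter> Z) \<subseteq> X - (Y \<union> Z)"
    and swp_central: "\<And>N f g. pm2 N f g \<Longrightarrow> central (swp N f g)"
  shows "\<pi> \<alpha> \<otimes>\<^bsub>Q\<^esub> \<pi> \<beta> = \<pi> \<beta> \<otimes>\<^bsub>Q\<^esub> \<pi> \<alpha>"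
proof -
  define a b where "a = t \<otimes>\<^bsub>B\<^esub> \<alpha>" and "b = t' \<otimes>\<^bsub>B\<^esub> \<beta>"
  have tF: "t \<in> F" "t' \<in> F" using ct by (auto simp: central_def)
  have F: "a \<in> F" "b \<in> F" using assms(1,2) tF F_mult by (auto simp: a_def b_def)
  have p2: "pm2 (Y \<inter> Z) (\<lambda>x. x) \<phi>" unfolding pm2_def using p pm_id YZ im by auto
  define \<gamma> where "\<gamma> = swp (Y \<inter> Z) (\<lambda>x. x) \<phi>"
  have \<gamma>: "\<gamma> \<in> F" "central \<gamma>" using p2 swp_F swp_central by (auto simp: \<gamma>_def)
  \<comment> \<open>Points of Y \<inter> Z are sent by \<phi> outside Y \<union> Z; points of Y - Z
    are already outside Z and stay in place.\<close>
  have \<gamma>Y: "\<gamma> y \<in> X - Z" if "y \<in> Y" for y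
  proof (cases "y \<in> Z")
    case True
    then have "\<gamma> y = \<phi> y" using swp_apply(1)[OF p2, of y] that by (simp add: \<gamma>_def)
    then show ?thesis using im that True by blast
  next
    case False
    have "y \<in> X" using that YZ clopen_subset by blast
    moreover have "y \<notin> \<phi> ` (Y \<inter> Z)" using im that by blast
    ultimately have "\<gamma> y = y" using False swp_apply(3)[OF p2, of y] by (simp add: \<gamma>_def)
    then show ?thesis using False \<open>y \<in> X\<close> by simp
  qed
  \<comment> \<open>A bijection that is the identity off Y preserves Y: a value outside Y would be a
    fixed point, hence equal to y by injectivity.\<close>
  have inv: "a y \<in> Y" if "y \<in> Y" for y
  proof (rule ccontr)
    assume n: "a y \<notin> Y"
    have y: "y \<in> X" using that YZ clopen_subset by blast
    then have "a y \<in> X" using F F_closed by blast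
    then have "a (a y) = a y" using fY n by (simp add: a_def)
    then have "a y = y" using F_inj[OF F(1)] y \<open>a y \<in> X\<close> by blast
    then show False using n that by simp
  qed
  have invb: "b y \<in> Z" if "y \<in> Z" for y
  proof (rule ccontr)
    assume n: "b y \<notin> Z"
    have y: "y \<in> X" using that YZ clopen_subset by blast
    then have "b y \<in> X" using F F_closed by blast
    then have "b (b y) = b y" using fZ n by (simp add: b_def)
    then have "b y = y" using F_inj[OF F(2)] y \<open>b y \<in> X\<close> by blast
    then show False using n that by simp
  qed
  define c where "c = \<gamma> \<otimes>\<^bsub>B\<^esub> a \<otimes>\<^bsub>B\<^esub> inv\<^bsub>B\<^esub> \<gamma>"
  have cF: "c \<in> F" using F \<gamma> F_mult F_inv by (simp add: c_def)
  have c_apply: "c (\<gamma> y) = \<gamma> (a y)" if "y \<in> X" for y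
    using that F \<gamma> by (simp add: c_def F_apply F_mult F_inv F_closed F_inv_apply)
  have "b \<otimes>\<^bsub>B\<^esub> c = c \<otimes>\<^bsub>B\<^esub> b"
  proof (rule F_eqI)
    fix x assume x: "x \<in> X"
    then obtain y where y: "y \<in> X" "x = \<gamma> y" using F_image[OF \<gamma>(1)] by (metis imageE)
    have "b (c x) = c (b x)"
    proof (cases "y \<in> Y")
      case True
      then have "b x = x" "b (\<gamma> (a y)) = \<gamma> (a y)" using fZ \<gamma>Y inv y by (auto simp: b_def)
      then show ?thesis using y c_apply by simp
    next
      case False
      have cx: "c z = z" if z: "z \<in> X" "z \<notin> \<gamma> ` Y" for z
      proof -
        obtain w where w: "w \<in> X" "z = \<gamma> w" using F_image[OF \<gamma>(1)] z by (metis imageE)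
        then have "a w = w" using fY z by (auto simp: a_def)
        then show ?thesis using c_apply w by simp
      qed
      have xn: "x \<notin> \<gamma> ` Y" using False y F_inj[OF \<gamma>(1)] YZ(1) clopen_subset by blast
      then have 1: "c x = x" using cx x by blast
      show ?thesis
      proof (cases "x \<in> Z")
        case True
        then have "b x \<notin> \<gamma> ` Y" using invb[OF True] \<gamma>Y by (metis DiffD2 imageE)
        then show ?thesis using 1 cx F_closed[OF F(2) x] by simp
      next
        case False
        then have "b x = x" using fZ x by (auto simp: b_def)
        then show ?thesis using 1 by simp
      qed
    qed
    then show "(b \<otimes>\<^bsub>B\<^esub> c) x = (c \<otimes>\<^bsub>B\<^esub> b) x" using F cF x by (simp add: F_apply)
  qed (use F cF F_mult in auto)
  then have bc: "\<pi> b \<otimes>\<^bsub>Q\<^esub> \<pi> c = \<pi> c \<otimes>\<^bsub>Q\<^esub> \<pi> b" using F cF \<pi>_mult by metis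
  have "\<pi> c = \<pi> a"
  proof -
    have "\<pi> c = \<pi> \<gamma> \<otimes>\<^bsub>Q\<^esub> \<pi> a \<otimes>\<^bsub>Q\<^esub> inv\<^bsub>Q\<^esub> \<pi> \<gamma>"
      using F \<gamma> by (simp add: c_def \<pi>_mult \<pi>_inv F_mult F_inv)
    also have "\<pi> \<gamma> \<otimes>\<^bsub>Q\<^esub> \<pi> a = \<pi> a \<otimes>\<^bsub>Q\<^esub> \<pi> \<gamma>" using \<gamma>(2) F by (simp add: central_def)
    finally show ?thesis using F \<gamma> \<pi>_closed by (simp add: Q.m_assoc)
  qed
  with bc have ab: "\<pi> a \<otimes>\<^bsub>Q\<^esub> \<pi> b = \<pi> b \<otimes>\<^bsub>Q\<^esub> \<pi> a" by simp
  show ?thesis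
  proof (rule Q.commute_mod_central[of "\<pi> t" "\<pi> t'"])
    show "\<pi> t \<otimes>\<^bsub>Q\<^esub> \<pi> \<alpha> \<otimes>\<^bsub>Q\<^esub> (\<pi> t' \<otimes>\<^bsub>Q\<^esub> \<pi> \<beta>) = \<pi> t' \<otimes>\<^bsub>Q\<^esub> \<pi> \<beta> \<otimes>\<^bsub>Q\<^esub> (\<pi> t \<otimes>\<^bsub>Q\<^esub> \<pi> \<alpha>)"
      using ab assms(1,2) tF \<pi>_mult by (simp add: a_def b_def)
    have c: "\<pi> t \<otimes>\<^bsub>Q\<^esub> \<pi> y = \<pi> y \<otimes>\<^bsub>Q\<^esub> \<pi> t" "\<pi> t' \<otimes>\<^bsub>Q\<^esub> \<pi> y = \<pi> y \<otimes>\<^bsub>Q\<^esub> \<pi> t'" if "y \<in> F" for y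
      using ct that unfolding central_def by metis+
    show "\<pi> t \<otimes>\<^bsub>Q\<^esub> \<pi> \<beta> = \<pi> \<beta> \<otimes>\<^bsub>Q\<^esub> \<pi> t" "\<pi> t' \<otimes>\<^bsub>Q\<^esub> \<pi> \<alpha> = \<pi> \<alpha> \<otimes>\<^bsub>Q\<^esub> \<pi> t'"
      "\<pi> t \<otimes>\<^bsub>Q\<^esub> \<pi> t' = \<pi> t' \<otimes>\<^bsub>Q\<^esub> \<pi> t" using c assms(1,2) tF by blast+
  qed (use assms(1,2) tF \<pi>_closed in simp_all)
qed

end

section \<open>Commutators are products of three-cycles\<close>

locale minimal_germs = germs +
  assumes min: "\<And>x U. x \<in> topspace T \<Longrightarrow> openin T U \<Longrightarrow> U \<noteq> {} \<Longrightarrow> \<exists>f. L f x \<and> f x \<in> U"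
begin

lemma small_ex:
  "eventually P (small x) \<Longrightarrow> x \<in> X \<Longrightarrow>
    \<exists>N. clopen N \<and> x \<in> N \<and> P N \<and> (\<forall>N'. clopen N' \<longrightarrow> N' \<subseteq> N \<longrightarrow> P N')"
  by (simp add: eventually_small) blast

text \<open>As no point is isolated, a nonempty open set remains open and nonempty after finitely
  many points are removed, and minimality reaches what is left. All auxiliary maps whose values must
  avoid those already in use come from here.\<close>

lemma fresh:
  assumes x: "x \<in> X" and U: "openin T U" "U \<noteq> {}" and S: "finite S"
  shows "\<exists>f. L f x \<and> f x \<in> U \<and> f x \<notin> S"
proof -
  have cl: "closedin T (S' \<inter> X)" if "S' \<subseteq> S" for S'
    using closedin_Hausdorff_finite[OF haus] that S by (meson finite_Int finite_subset inf_le2)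
  have op: "openin T (U - S')" if "S' \<subseteq> S" for S'
  proof -
    have "U - S' = U - S' \<inter> X" using openin_subset[OF U(1)] by blast
    then show ?thesis using openin_diff[OF U(1) cl[OF that]] by simp
  qed
  have "U - S \<noteq> {}"
  proof
    assume e: "U - S = {}"
    obtain y where y: "y \<in> U" using U by blast
    have "U - (S - {y}) = {y}" using e y by blast
    then show False using op[of "S - {y}"] perfect by auto
  qed
  then obtain f where "L f x" "f x \<in> U - S" using min[OF x op] by blast
  then show ?thesis by blast
qed

lemma fresh': "x \<in> X \<Longrightarrow> finite S \<Longrightarrow> \<exists>f. L f x \<and> f x \<notin> S"
  using fresh[of x X S] openin_topspace by blast

text \<open>Compare both transpositions with one that exchanges two fresh points.\<close>

lemma small_\<pi>_swp_eq:
  assumes "L f x" "L g x" "L f' x" "L g' x" "f x \<noteq> g x" "f' x \<noteq> g' x"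
  shows "\<forall>\<^sub>F N in small x. \<pi> (swp N f g) = \<pi> (swp N f' g')"
proof -
  have x: "x \<in> X" using assms(1) L_dom by blast
  obtain u where u: "L u x" "u x \<notin> {f x, g x, f' x, g' x}" using fresh'[OF x, of "{f x, g x, f' x, g' x}"] by auto
  obtain v where v: "L v x" "v x \<notin> {f x, g x, f' x, g' x, u x}" using fresh'[OF x, of "{f x, g x, f' x, g' x, u x}"] by auto
  have "\<forall>\<^sub>F N in small x. (pm2 N f g \<and> pm2 N u v \<and> pm2 N f u \<and> pm2 N f v \<and> pm2 N g u \<and> pm2 N g v) \<and>
     (pm2 N f' g' \<and> pm2 N u v \<and> pm2 N f' u \<and> pm2 N f' v \<and> pm2 N g' u \<and> pm2 N g' v)"
    by (intro eventually_conj small_pm2) (use assms u v in auto)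
  then show ?thesis
    by (rule eventually_mono) (use \<pi>_swp_eq_disjoint[of _ f g u v] \<pi>_swp_eq_disjoint[of _ f' g' u v] in simp)
qed

text \<open>Conjugation by \<alpha> turns f, g into \<alpha> f, \<alpha> g, and on a small base this
  does not change the class, by \<open>small_\<pi>_swp_eq\<close>. The local statements multiply up
  over a finite cover of N because commuting with \<alpha> is closed under products.\<close>

lemma swp_central: assumes p: "pm2 N f g" shows "central (swp N f g)"
proof -
  have "\<pi> \<alpha> \<otimes>\<^bsub>Q\<^esub> \<pi> (swp N f g) = \<pi> (swp N f g) \<otimes>\<^bsub>Q\<^esub> \<pi> \<alpha>" if a: "\<alpha> \<in> F" for \<alpha>
  proof -
    define C where "C M \<longleftrightarrow> \<pi> \<alpha> \<otimes>\<^bsub>Q\<^esub> \<pi> (swp M f g) = \<pi> (swp M f g) \<otimes>\<^bsub>Q\<^esub> \<pi> \<alpha>" for M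
    have Nc: "clopen N" using p by (simp add: pm2_def pm_def)
    have "C (N \<inter> X)"
    proof (rule cover_induct)
      show "C (N \<inter> {})" using a \<pi>_closed \<pi>_one by (simp add: C_def swp_empty)
      fix x assume x: "x \<in> X"
      show "\<exists>M. clopen M \<and> x \<in> M \<and> (\<forall>D. clopen D \<longrightarrow> C (N \<inter> D) \<longrightarrow> C (N \<inter> (D \<union> M)))"
      proof (cases "x \<in> N")
        case False
        have "N \<inter> (D \<union> (X - N)) = N \<inter> D" for D by blast
        \<comment> \<open>Away from N the neighbourhood X - N adds nothing to the part of N already
          treated.\<close>
        then show ?thesis using x False Nc by (intro exI[of _ "X - N"]) auto
      next
        case True
        have L: "L f x" "L g x" "f x \<noteq> g x" using p True by (auto simp: pm2_def pm_def)
        have L': "L (\<lambda>y. \<alpha> (f y)) x" "L (\<lambda>y. \<alpha> (g y)) x"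
          using L_comp[OF L(1), of \<alpha>] L_comp[OF L(2), of \<alpha>] F_L[OF a] L_dom L by auto
        have ne: "\<alpha> (f x) \<noteq> \<alpha> (g x)" using F_inj[OF a] L L_dom by metis
        have "\<forall>\<^sub>F M in small x. \<pi> (swp M f g) = \<pi> (swp M (\<lambda>y. \<alpha> (f y)) (\<lambda>y. \<alpha> (g y))) \<and> M \<subseteq> N"
          by (intro eventually_conj small_\<pi>_swp_eq small_subset L L' ne Nc True)
        from small_ex[OF this x] obtain M where M0: "clopen M" "x \<in> M" "M \<subseteq> N" and "\<forall>M'. clopen M' \<longrightarrow> M' \<subseteq> M \<longrightarrow>
            \<pi> (swp M' f g) = \<pi> (swp M' (\<lambda>y. \<alpha> (f y)) (\<lambda>y. \<alpha> (g y))) \<and> M' \<subseteq> N"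
          by (elim exE conjE) (rule that)
        then have M: "clopen M" "x \<in> M" "\<And>M'. clopen M' \<Longrightarrow> M' \<subseteq> M \<Longrightarrow>
            \<pi> (swp M' f g) = \<pi> (swp M' (\<lambda>y. \<alpha> (f y)) (\<lambda>y. \<alpha> (g y)))" "M \<subseteq> N" by auto
        have CM: "C M'" if M': "clopen M'" "M' \<subseteq> M" for M'
        proof -
          have p': "pm2 M' f g" using pm2_subset p M' M(4) by blast
          have s: "swp M' f g \<in> F" using p' swp_F by blast
          have "\<alpha> \<otimes>\<^bsub>B\<^esub> swp M' f g = swp M' (\<lambda>y. \<alpha> (f y)) (\<lambda>y. \<alpha> (g y)) \<otimes>\<^bsub>B\<^esub> \<alpha>"
            using swp_conj[OF a p'] B.conj_eq_iff a s F_carrier swp_F pm2_F[OF a p'] by metis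
          then have "\<pi> \<alpha> \<otimes>\<^bsub>Q\<^esub> \<pi> (swp M' f g) = \<pi> (swp M' (\<lambda>y. \<alpha> (f y)) (\<lambda>y. \<alpha> (g y))) \<otimes>\<^bsub>Q\<^esub> \<pi> \<alpha>"
            using a s swp_F pm2_F[OF a p'] \<pi>_mult by metis
          then show ?thesis using M(3)[OF M'] by (simp add: C_def)
        qed
        have "C (N \<inter> (D \<union> M))" if D: "clopen D" "C (N \<inter> D)" for D
        proof -
          have e: "N \<inter> (D \<union> M) = (N \<inter> D) \<union> (M - D)" using M(4) by blast
          have p': "pm2 ((N \<inter> D) \<union> (M - D)) f g"
            by (rule pm2_subset[OF p]) (use D M Nc in auto)
          have "swp ((N \<inter> D) \<union> (M - D)) f g = swp (N \<inter> D) f g \<otimes>\<^bsub>B\<^esub> swp (M - D) f g"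
            by (rule swp_split[OF p']) (use D M Nc in auto)
          moreover have "swp (N \<inter> D) f g \<in> F" "swp (M - D) f g \<in> F"
            by (rule swp_F, rule pm2_subset[OF p'], use D M Nc in auto)+
          moreover have "C (M - D)" using CM M(1) D(1) by auto
          ultimately show ?thesis unfolding e using D(2) a commute_mult unfolding C_def by metis
        qed
        then show ?thesis using M by blast
      qed
    qed
    moreover have "N \<inter> X = N" using Nc clopen_subset by blast
    ultimately show ?thesis by (simp add: C_def)
  qed
  then show ?thesis using p swp_F by (simp add: central_def)
qed

lemma derived_subset_alt_of_commute:
  assumes "\<And>\<alpha> \<beta>. \<alpha> \<in> F \<Longrightarrow> \<beta> \<in> F \<Longrightarrow> \<pi> \<alpha> \<otimes>\<^bsub>Q\<^esub> \<pi> \<beta> = \<pi> \<beta> \<otimes>\<^bsub>Q\<^esub> \<pi> \<alpha>"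
  shows "derived B F \<subseteq> alt"
  unfolding derived_def
proof (rule B.generate_subgroup_incl[OF _ subgroup_alt], clarsimp)
  fix a b assume ab: "a \<in> F" "b \<in> F"
  note c = ab[THEN \<pi>_closed]
  have "\<pi> (a \<otimes>\<^bsub>B\<^esub> b \<otimes>\<^bsub>B\<^esub> inv\<^bsub>B\<^esub> a \<otimes>\<^bsub>B\<^esub> inv\<^bsub>B\<^esub> b) = (\<pi> a \<otimes>\<^bsub>Q\<^esub> \<pi> b) \<otimes>\<^bsub>Q\<^esub> inv\<^bsub>Q\<^esub> \<pi> a \<otimes>\<^bsub>Q\<^esub> inv\<^bsub>Q\<^esub> \<pi> b"
    using ab F_mult F_inv by (simp add: \<pi>_mult \<pi>_inv)
  also have "\<dots> = (\<pi> b \<otimes>\<^bsub>Q\<^esub> \<pi> a) \<otimes>\<^bsub>Q\<^esub> inv\<^bsub>Q\<^esub> \<pi> a \<otimes>\<^bsub>Q\<^esub> inv\<^bsub>Q\<^esub> \<pi> b" using assms ab by simp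
  also have "\<dots> = \<one>\<^bsub>Q\<^esub>" using c by (simp add: Q.m_assoc)
  finally show "a \<otimes>\<^bsub>B\<^esub> b \<otimes>\<^bsub>B\<^esub> inv\<^bsub>B\<^esub> a \<otimes>\<^bsub>B\<^esub> inv\<^bsub>B\<^esub> b \<in> alt"
    using ab F_mult F_inv \<pi>_one_iff by metis
qed

text \<open>If \<alpha> moves x, the transposition exchanging a small N with its image undoes
  \<alpha> on N. If \<alpha> fixes x, a preliminary transposition moves x away and reduces to that
  case.\<close>

lemma fix_near:
  assumes a: "\<alpha> \<in> F" and x: "x \<in> X"
  shows "\<exists>t N. central t \<and> clopen N \<and> x \<in> N \<and> (\<forall>y\<in>N. (t \<otimes>\<^bsub>B\<^esub> \<alpha>) y = y)"
proof -
  have moved: "\<exists>t N. central t \<and> clopen N \<and> x \<in> N \<and> (\<forall>y\<in>N. (t \<otimes>\<^bsub>B\<^esub> \<alpha>) y = y)"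
    if a: "\<alpha> \<in> F" and ne: "\<alpha> x \<noteq> x" for \<alpha>
  proof -
    have "\<forall>\<^sub>F N in small x. pm2 N \<alpha> (\<lambda>y. y)" by (intro small_pm2 F_L a x L_id) (simp add: ne)
    from small_ex[OF this x] obtain N where N: "clopen N" "x \<in> N" "pm2 N \<alpha> (\<lambda>y. y)" by blast
    have "(swp N \<alpha> (\<lambda>y. y) \<otimes>\<^bsub>B\<^esub> \<alpha>) y = y" if "y \<in> N" for y
      using that swp_apply(1)[OF N(3)] F_apply[OF swp_F[OF N(3)] a] clopen_subset[OF N(1)] by auto
    then show ?thesis using N swp_central by blast
  qed
  show ?thesis
  proof (cases "\<alpha> x = x")
    case False then show ?thesis using moved a by blast
  next
    case True
    obtain g where g: "L g x" "g x \<noteq> x" using fresh'[OF x, of "{x}"] by auto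
    have "\<forall>\<^sub>F N in small x. pm2 N (\<lambda>y. y) g" by (intro small_pm2 g x L_id) (use g in simp)
    from small_ex[OF this x] obtain N where N: "clopen N" "x \<in> N" "pm2 N (\<lambda>y. y) g" by blast
    define s where "s = swp N (\<lambda>y. y) g"
    have s: "s \<in> F" "central s" using N swp_F swp_central by (auto simp: s_def)
    have "(s \<otimes>\<^bsub>B\<^esub> \<alpha>) x = g x" using F_apply[OF s(1) a x] True swp_apply(1)[OF N(3,2)] by (simp add: s_def)
    then obtain t M where t: "central t" "clopen M" "x \<in> M" "\<And>y. y\<in>M \<Longrightarrow> (t \<otimes>\<^bsub>B\<^esub> (s \<otimes>\<^bsub>B\<^esub> \<alpha>)) y = y"
      using moved[of "s \<otimes>\<^bsub>B\<^esub> \<alpha>"] s a F_mult g(2) by auto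
    have "t \<otimes>\<^bsub>B\<^esub> (s \<otimes>\<^bsub>B\<^esub> \<alpha>) = (t \<otimes>\<^bsub>B\<^esub> s) \<otimes>\<^bsub>B\<^esub> \<alpha>"
      using t(1) s(1) a F_carrier by (simp add: central_def B.m_assoc)
    then show ?thesis using t central_mult[OF t(1) s(2)] by metis
  qed
qed

section \<open>The purely infinite case\<close>

definition pinf :: bool where
  "pinf \<longleftrightarrow> (\<forall>A. clopen A \<longrightarrow> (\<exists>f g. pm2 A f g \<and> f ` A \<subseteq> A \<and> g ` A \<subseteq> A))"

text \<open>V contains two disjoint copies of itself. An embedding of the part of Z treated so far
  is pushed into the copy under f, which frees the copy under g for the next small piece.\<close>

lemma pinf_embed:
  assumes pinf and Z: "clopen Z" and V: "clopen V" "V \<noteq> {}"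
  shows "\<exists>\<phi>. pm Z \<phi> \<and> \<phi> ` Z \<subseteq> V"
proof -
  obtain f g where fg: "pm2 V f g" "f ` V \<subseteq> V" "g ` V \<subseteq> V" using assms(1) V unfolding pinf_def by blast
  have "\<exists>\<phi>. pm (Z \<inter> X) \<phi> \<and> \<phi> ` (Z \<inter> X) \<subseteq> V"
  proof (rule cover_induct)
    show "\<exists>\<phi>. pm (Z \<inter> {}) \<phi> \<and> \<phi> ` (Z \<inter> {}) \<subseteq> V" by (simp add: pm_def)
    fix x assume x: "x \<in> X"
    obtain k where k: "L k x" "k x \<in> V" using min[OF x] V clopen_openin by blast
    have "\<forall>\<^sub>F N in small x. pm N k \<and> k ` N \<subseteq> V"
      by (intro eventually_conj small_pm small_image k clopen_openin V)
    from small_ex[OF this x] obtain N where N: "clopen N" "x \<in> N" "pm N k" "k ` N \<subseteq> V" by blast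
    have "\<exists>\<phi>. pm (Z \<inter> (D \<union> N)) \<phi> \<and> \<phi> ` (Z \<inter> (D \<union> N)) \<subseteq> V"
      if D: "clopen D" and ex: "\<exists>\<phi>. pm (Z \<inter> D) \<phi> \<and> \<phi> ` (Z \<inter> D) \<subseteq> V" for D
    proof -
      obtain \<phi> where \<phi>: "pm (Z \<inter> D) \<phi>" "\<phi> ` (Z \<inter> D) \<subseteq> V" using ex by blast
      have kZ: "pm (Z \<inter> N - D) k" "k ` (Z \<inter> N - D) \<subseteq> V" using pm_subset[OF N(3), of "Z \<inter> N - D"] Z D N(1,4) by (simp_all, blast+)
      have fgp: "pm V f" "pm V g" "f ` V \<inter> g ` V = {}" using fg(1) by (auto simp: pm2_def)
      have "pm ((Z \<inter> D) \<union> (Z \<inter> N - D)) (\<lambda>x. if x \<in> Z \<inter> D then f (\<phi> x) else g (k x))"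
      proof (rule pm_union)
        show "pm (Z \<inter> D) (\<lambda>x. f (\<phi> x))" using pm_comp[OF \<phi>(1) fgp(1) \<phi>(2)] .
        show "pm (Z \<inter> N - D) (\<lambda>x. g (k x))" using pm_comp[OF kZ(1) fgp(2) kZ(2)] .
        show "(\<lambda>x. f (\<phi> x)) ` (Z \<inter> D) \<inter> (\<lambda>x. g (k x)) ` (Z \<inter> N - D) = {}"
          using fgp(3) \<phi>(2) kZ(2) by blast
      qed auto
      moreover have "(Z \<inter> D) \<union> (Z \<inter> N - D) = Z \<inter> (D \<union> N)" by blast
      moreover have "(\<lambda>x. if x \<in> Z \<inter> D then f (\<phi> x) else g (k x)) ` (Z \<inter> (D \<union> N)) \<subseteq> V"
        using fg(2,3) \<phi>(2) kZ(2) by (auto simp: image_subset_iff)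
      ultimately show ?thesis by (intro exI[of _ "\<lambda>x. if x \<in> Z \<inter> D then f (\<phi> x) else g (k x)"]) simp
    qed
    then show "\<exists>N. clopen N \<and> x \<in> N \<and> (\<forall>D. clopen D \<longrightarrow> (\<exists>\<phi>. pm (Z \<inter> D) \<phi> \<and> \<phi> ` (Z \<inter> D) \<subseteq> V) \<longrightarrow>
        (\<exists>\<phi>. pm (Z \<inter> (D \<union> N)) \<phi> \<and> \<phi> ` (Z \<inter> (D \<union> N)) \<subseteq> V))" using N by blast
  qed
  moreover have "Z \<inter> X = Z" using Z clopen_subset by blast
  ultimately show ?thesis by simp
qed

lemma pinf_commute:
  assumes pinf "\<alpha> \<in> F" "\<beta> \<in> F" "X \<noteq> {}"
  shows "\<pi> \<alpha> \<otimes>\<^bsub>Q\<^esub> \<pi> \<beta> = \<pi> \<beta> \<otimes>\<^bsub>Q\<^esub> \<pi> \<alpha>"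
proof -
  obtain x where x: "x \<in> X" using assms by blast
  obtain t N where t: "central t" "clopen N" "x \<in> N" "\<And>y. y\<in>N \<Longrightarrow> (t \<otimes>\<^bsub>B\<^esub> \<alpha>) y = y"
    using fix_near[OF assms(2) x] by blast
  obtain t' N' where t': "central t'" "clopen N'" "x \<in> N'" "\<And>y. y\<in>N' \<Longrightarrow> (t' \<otimes>\<^bsub>B\<^esub> \<beta>) y = y"
    using fix_near[OF assms(3) x] by blast
  \<comment> \<open>Both corrected elements are the identity on V, so the complement of V can serve
    as Y and as Z at once; it embeds into V itself.\<close>
  define V where "V = N \<inter> N'"
  have V: "clopen V" "V \<noteq> {}" "clopen (X - V)" using t t' by (auto simp: V_def)
  obtain \<phi> where \<phi>: "pm (X - V) \<phi>" "\<phi> ` (X - V) \<subseteq> V" using pinf_embed[OF assms(1) V(3,1,2)] by blast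
  show ?thesis
  proof (rule commute_of_separation[OF assms(2,3) t(1) t'(1) V(3) V(3)])
    show "pm ((X - V) \<inter> (X - V)) \<phi>" "\<phi> ` ((X - V) \<inter> (X - V)) \<subseteq> X - ((X - V) \<union> (X - V))"
      using \<phi> clopen_subset[OF V(1)] by auto
    show "central (swp N f g)" if "pm2 N f g" for N f g using that swp_central by blast
  qed (use t t' in \<open>auto simp: V_def\<close>)
qed

section \<open>The almost finite case\<close>

text \<open>The combinatorial content of an elementary subgroupoid: finitely many partial maps whose graphs
  form its orbit relation.\<close>

definition graph :: "('a set \<times> ('a \<Rightarrow> 'a)) set \<Rightarrow> ('a \<times> 'a) set" where
  "graph \<Phi> = {(x, f x) |x A f. (A, f) \<in> \<Phi> \<and> x \<in> A}"

text \<open>The alternative, identity or disjoint from the domain, is what yields the transversal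
  neighbourhoods of \<open>towers_transversal\<close>.\<close>

definition towers :: "('a set \<times> ('a \<Rightarrow> 'a)) set \<Rightarrow> bool" where
  "towers \<Phi> \<longleftrightarrow> finite \<Phi> \<and> equiv X (graph \<Phi>) \<and>
     (\<forall>(A, f) \<in> \<Phi>. pm A f \<and> ((\<forall>x\<in>A. f x = x) \<or> f ` A \<inter> A = {}))"

text \<open>A Folner-type estimate for the bisections of \<alpha> and \<beta> with \<epsilon> = 1/4,
  cleared of denominators.\<close>

definition afin :: bool where
  "afin \<longleftrightarrow> (\<forall>\<alpha>\<in>F. \<forall>\<beta>\<in>F. \<exists>\<Phi> Y Z. towers \<Phi> \<and> clopen Y \<and> clopen Z \<and>
     (\<forall>y\<in>Y. (y, \<alpha> y) \<in> graph \<Phi>) \<and> (\<forall>z\<in>Z. (z, \<beta> z) \<in> graph \<Phi>) \<and>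
     (\<forall>x\<in>X. 4 * card (graph \<Phi> `` {x} - Y) < card (graph \<Phi> `` {x}) \<and>
            4 * card (graph \<Phi> `` {x} - Z) < card (graph \<Phi> `` {x})))"

text \<open>For each of the finitely many partial maps, the neighbourhood is cut down to its domain
  or to the complement, whichever contains x. Inside the domain a map that is not the identity
  leaves it, so it cannot join two points of E.\<close>

lemma towers_transversal:
  assumes "towers \<Phi>" "x \<in> X"
  shows "\<exists>E. clopen E \<and> x \<in> E \<and> (\<forall>y\<in>E. \<forall>z\<in>E. (y, z) \<in> graph \<Phi> \<longrightarrow> z = y)"
proof -
  have fin: "finite \<Phi>" and pmP: "\<And>A f. (A, f) \<in> \<Phi> \<Longrightarrow> pm A f \<and> ((\<forall>x\<in>A. f x = x) \<or> f ` A \<inter> A = {})"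
    using assms(1) unfolding towers_def by blast+
  have "\<exists>E. clopen E \<and> x \<in> E \<and> (\<forall>y\<in>E. \<forall>z\<in>E. (y, z) \<in> graph \<Phi>' \<longrightarrow> z = y)" if "finite \<Phi>'" "\<Phi>' \<subseteq> \<Phi>" for \<Phi>'
    using that
  proof (induction \<Phi>')
    case empty then show ?case using assms(2) by (intro exI[of _ X]) (auto simp: graph_def)
  next
    case (insert p \<Phi>')
    obtain A f where p: "p = (A, f)" by fastforce
    obtain E where E: "clopen E" "x \<in> E" "\<And>y z. y \<in> E \<Longrightarrow> z \<in> E \<Longrightarrow> (y, z) \<in> graph \<Phi>' \<Longrightarrow> z = y"
      using insert by blast
    have A: "clopen A" "(\<forall>x\<in>A. f x = x) \<or> f ` A \<inter> A = {}" using pmP[of A f] insert.prems p by (auto simp: pm_def)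
    define E' where "E' = E \<inter> (if x \<in> A then A else X - A)"
    have "z = y" if "y \<in> E'" "z \<in> E'" "(y, z) \<in> graph (insert p \<Phi>')" for y z
    proof (cases "(y, z) \<in> graph \<Phi>'")
      case True then show ?thesis using that E by (auto simp: E'_def)
    next
      case False
      then have "y \<in> A" "z = f y" using that(3) p by (auto simp: graph_def)
      moreover from this have "x \<in> A" "z \<in> A" using that by (auto simp: E'_def split: if_splits)
      ultimately show ?thesis using A(2) by auto
    qed
    moreover have "clopen E'" "x \<in> E'" using E A assms(2) by (auto simp: E'_def)
    ultimately show ?case by blast
  qed
  then show ?thesis using fin by blast
qed

text \<open>Treat one transversal piece \<open>E\<close> after the other: a point of \<open>E\<close> whose image stays in its orbit is
  either fixed or leaves \<open>E\<close>, so a transposition corrects all of \<open>E\<close> without disturbing the points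
  fixed before.\<close>

lemma towers_fix:
  assumes tw: "towers \<Phi>" and a: "\<alpha> \<in> F" and Y: "clopen Y" and R: "\<And>y. y \<in> Y \<Longrightarrow> (y, \<alpha> y) \<in> graph \<Phi>"
  shows "\<exists>t. central t \<and> (\<forall>y\<in>Y. (t \<otimes>\<^bsub>B\<^esub> \<alpha>) y = y)"
proof -
  have eq: "equiv X (graph \<Phi>)" using tw by (simp add: towers_def)
  have refl: "\<And>x. x \<in> X \<Longrightarrow> (x, x) \<in> graph \<Phi>" and sym: "\<And>x y. (x, y) \<in> graph \<Phi> \<Longrightarrow> (y, x) \<in> graph \<Phi>"
    and trans: "\<And>x y z. (x, y) \<in> graph \<Phi> \<Longrightarrow> (y, z) \<in> graph \<Phi> \<Longrightarrow> (x, z) \<in> graph \<Phi>"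
    using eq by (auto simp: equiv_def refl_on_def dest: symD transD)
  \<comment> \<open>The last clause is an invariant: the next correction again needs all points of
    Y, not only those already fixed, to move within their orbits.\<close>
  define C where "C D \<longleftrightarrow> (\<exists>t. central t \<and> (\<forall>y\<in>Y \<inter> D. (t \<otimes>\<^bsub>B\<^esub> \<alpha>) y = y) \<and>
      (\<forall>y\<in>Y. (y, (t \<otimes>\<^bsub>B\<^esub> \<alpha>) y) \<in> graph \<Phi>))" for D
  have "C X"
  proof (rule cover_induct)
    have "(\<one>\<^bsub>B\<^esub> \<otimes>\<^bsub>B\<^esub> \<alpha>) = \<alpha>" using a F_carrier by simp
    then show "C {}" unfolding C_def using central_one R by (intro exI[of _ "\<one>\<^bsub>B\<^esub>"]) auto
    fix x assume x: "x \<in> X"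
    obtain E where E: "clopen E" "x \<in> E" "\<And>y z. y \<in> E \<Longrightarrow> z \<in> E \<Longrightarrow> (y, z) \<in> graph \<Phi> \<Longrightarrow> z = y"
      using towers_transversal[OF tw x] by blast
    have "C (D \<union> E)" if D: "clopen D" and CD: "C D" for D
    proof -
      obtain t where t: "central t" "\<And>y. y\<in>Y \<inter> D \<Longrightarrow> (t \<otimes>\<^bsub>B\<^esub> \<alpha>) y = y"
        "\<And>y. y \<in> Y \<Longrightarrow> (y, (t \<otimes>\<^bsub>B\<^esub> \<alpha>) y) \<in> graph \<Phi>" using CD unfolding C_def by blast
      define b where "b = t \<otimes>\<^bsub>B\<^esub> \<alpha>"
      have tF: "t \<in> F" using t(1) by (simp add: central_def)
      then have bF: "b \<in> F" using a F_mult by (simp add: b_def)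
      \<comment> \<open>On the rest of Y \<inter> E the image under b stays in E and in the orbit,
        so by transversality b is the identity there.\<close>
      define M where "M = {y \<in> Y \<inter> E. b y \<in> X - E}"
      have bYE: "pm (Y \<inter> E) b" using pm_subset[OF F_pm[OF bF]] Y E clopen_subset by auto
      have M: "clopen M" unfolding M_def using pm_preimage[OF bYE, of "X - E"] E by simp
      have "pm M b" using pm_subset[OF bYE M] by (auto simp: M_def)
      then have p: "pm2 M (\<lambda>y. y) b" unfolding pm2_def using pm_id M by (auto simp: M_def)
      define s where "s = swp M (\<lambda>y. y) b"
      have s: "s \<in> F" "central s" using p swp_F swp_central by (auto simp: s_def)
      have YX: "Y \<subseteq> X" using Y clopen_subset by blast
      have fixb: "b y = y" if "y \<in> Y \<inter> E" "y \<notin> M" for y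
      proof -
        have "b y \<in> X" using that YX F_closed[OF bF] by blast
        then have "b y \<in> E" using that by (auto simp: M_def)
        then show ?thesis using E(3)[of y "b y"] t(3)[of y] that by (simp add: b_def)
      qed
      \<comment> \<open>A point of Y fixed by b is not in M, since b carries M off E, and not in the
        image of M, since b is injective. Thus earlier work survives.\<close>
      have s_off: "s z = z" if "z \<in> Y" "b z = z" for z
      proof -
        have "z \<notin> M" 
        proof
          assume zM: "z \<in> M"
          then have "b z \<notin> E" "z \<in> E" by (simp_all add: M_def)
          then show False using that(2) by simp
        qed
        moreover have "z \<notin> b ` M"
        proof
          assume "z \<in> b ` M"
          then obtain y where y: "y \<in> M" "z = b y" by blast
          then have "y \<in> X" using M clopen_subset by blast
          then have "z = y" using F_inj[OF bF, of z y] that y YX by auto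
          then show False using y \<open>z \<notin> M\<close> by simp
        qed
        moreover have "z \<in> X" using that YX by blast
        ultimately show ?thesis using swp_apply(3)[OF p, of z] by (simp add: s_def)
      qed
      have s_on: "s (b y) = y" if "y \<in> M" for y using swp_apply(2)[OF p that] by (simp add: s_def)
      have sb: "(s \<otimes>\<^bsub>B\<^esub> b) y = s (b y)" if "y \<in> X" for y using F_apply[OF s(1) bF that] .
      have "(s \<otimes>\<^bsub>B\<^esub> b) y = y" if y: "y \<in> Y \<inter> (D \<union> E)" for y
      proof (cases "y \<in> M")
        case True then show ?thesis using sb s_on y YX by auto
      next
        case False
        then have "b y = y" using y fixb t(2) by (auto simp: b_def)
        then show ?thesis using sb s_off y YX by auto
      qed
      moreover have "(y, (s \<otimes>\<^bsub>B\<^esub> b) y) \<in> graph \<Phi>" if y: "y \<in> Y" for y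
      proof -
        have yb: "(y, b y) \<in> graph \<Phi>" using t(3)[OF y] by (simp add: b_def)
        have byX: "b y \<in> X" using y YX F_closed[OF bF] by blast
        have "(b y, s (b y)) \<in> graph \<Phi>"
        proof (rule swp_cases[OF p byX])
          fix w assume w: "w \<in> M" "b y = w" "swp M (\<lambda>y. y) b (b y) = b w"
          have "(w, b w) \<in> graph \<Phi>" using t(3)[of w] w(1) by (simp add: b_def M_def)
          then show ?thesis using w by (simp add: s_def)
        next
          fix w assume w: "w \<in> M" "b y = b w" "swp M (\<lambda>y. y) b (b y) = w"
          have "(w, b w) \<in> graph \<Phi>" using t(3)[of w] w(1) by (simp add: b_def M_def)
          then show ?thesis using w sym by (simp add: s_def)
        next
          assume "swp M (\<lambda>y. y) b (b y) = b y"
          then show ?thesis using refl[OF byX] by (simp add: s_def)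
        qed
        then show ?thesis using trans[OF yb] sb y YX by auto
      qed
      moreover have "s \<otimes>\<^bsub>B\<^esub> b = (s \<otimes>\<^bsub>B\<^esub> t) \<otimes>\<^bsub>B\<^esub> \<alpha>"
        using s tF a F_carrier by (simp add: b_def B.m_assoc)
      ultimately show ?thesis unfolding C_def using central_mult[OF s(2) t(1)]
        by (intro exI[of _ "s \<otimes>\<^bsub>B\<^esub> t"]) simp
    qed
    then show "\<exists>N. clopen N \<and> x \<in> N \<and> (\<forall>D. clopen D \<longrightarrow> C D \<longrightarrow> C (D \<union> N))" using E by blast
  qed
  then obtain t where "central t" "\<forall>y\<in>Y \<inter> X. (t \<otimes>\<^bsub>B\<^esub> \<alpha>) y = y" unfolding C_def by blast
  then show ?thesis using clopen_subset[OF Y] by blast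
qed

text \<open>A point of \<open>W\<close> left over by a greedy matching sees only matched points of \<open>V\<close> in its orbit.\<close>

lemma towers_greedy:
  assumes tw: "towers \<Phi>" and W: "clopen W" and V: "clopen V" and WV: "W \<inter> V = {}"
  shows "\<exists>D \<phi>. pm D \<phi> \<and> D \<subseteq> W \<and> \<phi> ` D \<subseteq> V \<and> (\<forall>x\<in>D. (x, \<phi> x) \<in> graph \<Phi>) \<and>
    (\<forall>x\<in>W - D. \<forall>y\<in>V. (x, y) \<in> graph \<Phi> \<longrightarrow> y \<in> \<phi> ` D)"
proof -
  have fin: "finite \<Phi>" and pmP: "\<And>A f. (A, f) \<in> \<Phi> \<Longrightarrow> pm A f"
    using tw unfolding towers_def by auto
  have "\<exists>D \<phi>. pm D \<phi> \<and> D \<subseteq> W \<and> \<phi> ` D \<subseteq> V \<and> (\<forall>x\<in>D. (x, \<phi> x) \<in> graph \<Phi>) \<and>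
    (\<forall>x\<in>W - D. \<forall>y\<in>V. (x, y) \<in> graph \<Phi>' \<longrightarrow> y \<in> \<phi> ` D)" if "finite \<Phi>'" "\<Phi>' \<subseteq> \<Phi>" for \<Phi>'
    using that
  proof (induction \<Phi>')
    case empty
    show ?case by (intro exI[of _ "{}"] exI[of _ "\<lambda>x. x"]) (auto simp: graph_def pm_def)
  next
    case (insert p \<Phi>')
    obtain A f where p: "p = (A, f)" by fastforce
    obtain D \<phi> where D: "pm D \<phi>" "D \<subseteq> W" "\<phi> ` D \<subseteq> V" "\<And>x. x \<in> D \<Longrightarrow> (x, \<phi> x) \<in> graph \<Phi>"
      "\<And>x y. x \<in> W - D \<Longrightarrow> y \<in> V \<Longrightarrow> (x, y) \<in> graph \<Phi>' \<Longrightarrow> y \<in> \<phi> ` D"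
      using insert by (elim meta_impE) auto
    have Af: "(A, f) \<in> \<Phi>" "pm A f" using pmP insert.prems p by auto
    have Dc: "clopen D" "clopen A" using D(1) Af(2) by (auto simp: pm_def)
    \<comment> \<open>The new map f is used on every unmatched point of W whose value under f is an
      unmatched point of V.\<close>
    define D' where "D' = {x \<in> A \<inter> (W - D). f x \<in> V - \<phi> ` D}"
    have pA: "pm (A \<inter> (W - D)) f" by (rule pm_subset[OF Af(2)]) (use Dc W in auto)
    have cD': "clopen D'" unfolding D'_def using pm_preimage[OF pA, of "V - \<phi> ` D"] V pm_image_clopen[OF D(1)] by simp
    define \<psi> where "\<psi> = (\<lambda>x. if x \<in> D then \<phi> x else f x)"
    have "pm D' f" by (rule pm_subset[OF pA cD']) (auto simp: D'_def)
    then have "pm (D \<union> D') \<psi>" unfolding \<psi>_def by (rule pm_union[OF D(1)]) (auto simp: D'_def image_iff)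
    moreover have "D \<union> D' \<subseteq> W" "\<psi> ` (D \<union> D') \<subseteq> V" using D(2,3) by (auto simp: D'_def \<psi>_def)
    moreover have "(x, \<psi> x) \<in> graph \<Phi>" if "x \<in> D \<union> D'" for x
      using that D(4) Af(1) by (auto simp: D'_def \<psi>_def graph_def)
    moreover have "y \<in> \<psi> ` (D \<union> D')" if x: "x \<in> W - (D \<union> D')" "y \<in> V" "(x, y) \<in> graph (insert p \<Phi>')" for x y
    proof -
      have "y \<in> \<phi> ` D"
      proof (cases "(x, y) \<in> graph \<Phi>'")
        case True then show ?thesis using x D(5) by blast
      next
        case False
        then have "x \<in> A" "y = f x" using x(3) p by (auto simp: graph_def)
        then show ?thesis using x(1,2) by (auto simp: D'_def)
      qed
      then obtain d where "d \<in> D" "y = \<psi> d" by (auto simp: \<psi>_def)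
      then show ?thesis by blast
    qed
    ultimately show ?case by blast
  qed
  then show ?thesis using fin by blast
qed

text \<open>If a point of W remained unmatched, every point of V in its orbit O would be matched to
  a point of D, hence of O - Y, so #(O \<inter> V) \<le> #(O - Y). As V is Y \<inter> Z, this gives
  #O \<le> 2 #(O - Y) + #(O - Z), contradicting the two bounds.\<close>

lemma towers_matching:
  assumes tw: "towers \<Phi>" and Y: "clopen Y" and Z: "clopen Z"
    and cY: "\<And>x. x \<in> X \<Longrightarrow> 4 * card (graph \<Phi> `` {x} - Y) < card (graph \<Phi> `` {x})"
    and cZ: "\<And>x. x \<in> X \<Longrightarrow> 4 * card (graph \<Phi> `` {x} - Z) < card (graph \<Phi> `` {x})"
  shows "\<exists>\<phi>. pm ((X - Y) \<inter> (X - Z)) \<phi> \<and> \<phi> ` ((X - Y) \<inter> (X - Z)) \<subseteq> Y \<inter> Z"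
proof -
  define W where "W = (X - Y) \<inter> (X - Z)"
  define V where "V = Y \<inter> Z"
  have WV: "clopen W" "clopen V" "W \<inter> V = {}" using Y Z by (auto simp: W_def V_def)
  obtain D \<phi> where D: "pm D \<phi>" "D \<subseteq> W" "\<phi> ` D \<subseteq> V" "\<And>x. x\<in>D \<Longrightarrow> (x, \<phi> x) \<in> graph \<Phi>"
    "\<And>x y. x \<in> W - D \<Longrightarrow> y \<in> V \<Longrightarrow> (x, y) \<in> graph \<Phi> \<Longrightarrow> y \<in> \<phi> ` D"
    using towers_greedy[OF tw WV] by (elim exE conjE) blast
  have eq: "equiv X (graph \<Phi>)" using tw by (simp add: towers_def)
  have "W \<subseteq> D"
  proof
    fix x assume x: "x \<in> W"
    show "x \<in> D"
    proof (rule ccontr)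
      assume nD: "x \<notin> D"
      have xX: "x \<in> X" using x by (simp add: W_def)
      define O' where "O' = graph \<Phi> `` {x}"
      have "O' \<subseteq> (\<lambda>(A, f). f x) ` \<Phi>" by (auto simp: O'_def graph_def image_def case_prod_beta) force
      then have fin: "finite O'" using tw finite_surj by (auto simp: towers_def)
      have OX: "O' \<subseteq> X" unfolding O'_def using eq equiv_class_subset[OF eq] by (auto simp: equiv_def refl_on_def)
      have "O' \<inter> V \<subseteq> \<phi> ` (D \<inter> O')"
      proof
        fix y assume y: "y \<in> O' \<inter> V"
        then obtain d where d: "d \<in> D" "y = \<phi> d" using D(5)[of x y] x nD by (auto simp: O'_def)
        then have "(d, y) \<in> graph \<Phi>" "(x, y) \<in> graph \<Phi>" using D(4) y by (auto simp: O'_def)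
        then have "(x, d) \<in> graph \<Phi>" using eq by (meson equivE symD transD)
        then show "y \<in> \<phi> ` (D \<inter> O')" using d by (auto simp: O'_def)
      qed
      then have "card (O' \<inter> V) \<le> card (D \<inter> O')"
        by (meson card_image_le card_mono fin finite_Int finite_imageI le_trans)
      also have "\<dots> \<le> card (O' - Y)" using D(2) fin by (intro card_mono) (auto simp: W_def)
      finally have 1: "card (O' \<inter> V) \<le> card (O' - Y)" .
      have "O' = (O' \<inter> V) \<union> ((O' - Y) \<union> (O' - Z))" by (auto simp: V_def)
      then have "card O' \<le> card (O' \<inter> V) + (card (O' - Y) + card (O' - Z))"
        by (metis card_Un_le add_left_mono le_trans)
      then show False using 1 cY[OF xX] cZ[OF xX] by (simp add: O'_def)
    qed
  qed
  then have "D = W" using D(2) by blast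
  then show ?thesis using D(1,3) unfolding W_def V_def by blast
qed

lemma afin_commute:
  assumes afin "\<alpha> \<in> F" "\<beta> \<in> F"
  shows "\<pi> \<alpha> \<otimes>\<^bsub>Q\<^esub> \<pi> \<beta> = \<pi> \<beta> \<otimes>\<^bsub>Q\<^esub> \<pi> \<alpha>"
proof -
  from assms(1)[unfolded afin_def, rule_format, OF assms(2,3)] obtain \<Phi> Y Z where tw: "towers \<Phi>" and Y: "clopen Y" and Z: "clopen Z"
    and R: "\<And>y. y\<in>Y \<Longrightarrow> (y, \<alpha> y) \<in> graph \<Phi>" "\<And>z. z\<in>Z \<Longrightarrow> (z, \<beta> z) \<in> graph \<Phi>" and
    cY: "\<And>x. x \<in> X \<Longrightarrow> 4 * card (graph \<Phi> `` {x} - Y) < card (graph \<Phi> `` {x})" and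
    cZ: "\<And>x. x \<in> X \<Longrightarrow> 4 * card (graph \<Phi> `` {x} - Z) < card (graph \<Phi> `` {x})"
    by blast
  obtain t where t: "central t" "\<And>y. y\<in>Y \<Longrightarrow> (t \<otimes>\<^bsub>B\<^esub> \<alpha>) y = y" using towers_fix[OF tw assms(2) Y R(1)] by blast
  obtain t' where t': "central t'" "\<And>y. y\<in>Z \<Longrightarrow> (t' \<otimes>\<^bsub>B\<^esub> \<beta>) y = y" using towers_fix[OF tw assms(3) Z R(2)] by blast
  obtain \<phi> where \<phi>: "pm ((X - Y) \<inter> (X - Z)) \<phi>" "\<phi> ` ((X - Y) \<inter> (X - Z)) \<subseteq> Y \<inter> Z"
    using towers_matching[OF tw Y Z cY cZ] by blast
  have c: "clopen (X - Y)" "clopen (X - Z)" using Y Z by auto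
  show ?thesis
  proof (rule commute_of_separation[OF assms(2,3) t(1) t'(1) c _ _ \<phi>(1)])
    show "\<phi> ` ((X - Y) \<inter> (X - Z)) \<subseteq> X - ((X - Y) \<union> (X - Z))"
      using \<phi>(2) clopen_subset[OF Y] by blast
    show "central (swp N f g)" if "pm2 N f g" for N f g using that swp_central by blast
  qed (use t t' in auto)
qed

theorem derived_subset_alt:
  assumes "pinf \<or> afin" shows "derived B F \<subseteq> alt"
proof (cases "X = {}")
  case True
  have "x = \<one>\<^bsub>B\<^esub>" if "x \<in> F" for x using that one_F by (rule F_eqI) (simp add: True)
  then show ?thesis using subgroup.one_closed[OF subgroup_alt] subgroup.subset[OF subgroup_F]
    B.derived_incl[OF order_refl subgroup_F] by auto
next
  case False
  then show ?thesis using assms pinf_commute afin_commute by (intro derived_subset_alt_of_commute) blast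
qed

end

section \<open>Germs of degree zero and one\<close>

context germs begin

lemma swp_reparam:
  assumes k: "pm N k" and p: "pm2 (k ` N) f g"
  shows "swp (k ` N) f g = swp N (\<lambda>x. f (k x)) (\<lambda>x. g (k x))"
proof -
  have p': "pm2 N (\<lambda>x. f (k x)) (\<lambda>x. g (k x))"
    using pm_comp[OF k, of "k ` N" f] pm_comp[OF k, of "k ` N" g] p by (auto simp: pm2_def)
  show ?thesis
  proof (rule F_eqI)
    fix y assume y: "y \<in> X"
    show "swp (k ` N) f g y = swp N (\<lambda>x. f (k x)) (\<lambda>x. g (k x)) y"
    proof (rule swp_cases[OF p' y])
      fix x assume "x \<in> N" "y = f (k x)" "swp N (\<lambda>x. f (k x)) (\<lambda>x. g (k x)) y = g (k x)"
      then show ?thesis using swp_apply(1)[OF p, of "k x"] by simp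
    next
      fix x assume "x \<in> N" "y = g (k x)" "swp N (\<lambda>x. f (k x)) (\<lambda>x. g (k x)) y = f (k x)"
      then show ?thesis using swp_apply(2)[OF p, of "k x"] by simp
    next
      assume a: "y \<notin> (\<lambda>x. f (k x)) ` N" "y \<notin> (\<lambda>x. g (k x)) ` N" "swp N (\<lambda>x. f (k x)) (\<lambda>x. g (k x)) y = y"
      then have "y \<notin> f ` k ` N" "y \<notin> g ` k ` N" by auto
      then show ?thesis using swp_apply(3)[OF p y] a(3) by simp
    qed
  qed (use swp_F p p' in auto)
qed

text \<open>A change of base point: precomposition with k changes the degrees of all three maps by
  that of k, while the permutation stays the same.\<close>

lemma tc_reparam:
  "pm N k \<Longrightarrow> tri (k ` N) f g h \<Longrightarrow> tc (k ` N) f g h = tc N (\<lambda>x. f (k x)) (\<lambda>x. g (k x)) (\<lambda>x. h (k x))"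
  by (simp add: tc_def tri_def swp_reparam)

lemma tri_neq: "tri N f g h \<Longrightarrow> x \<in> N \<Longrightarrow> f x \<noteq> g x \<and> g x \<noteq> h x \<and> f x \<noteq> h x"
  unfolding tri_def pm2_def by blast

lemma tri_L: "tri N f g h \<Longrightarrow> x \<in> N \<Longrightarrow> L f x \<and> L g x \<and> L h x"
  unfolding tri_def pm2_def pm_def by blast

text \<open>A 3-cycle is the product of its restrictions to disjoint parts of its base, and
  compactness makes finitely many small parts enough. Membership of all generators of
  \<open>alt\<close> thus becomes a question about a single point and three germs.\<close>

lemma alt_subset_local:
  assumes K: "subgroup K B"
    and loc: "\<And>f g h x. L f x \<Longrightarrow> L g x \<Longrightarrow> L h x \<Longrightarrow> f x \<noteq> g x \<Longrightarrow> g x \<noteq> h x \<Longrightarrow> f x \<noteq> h x \<Longrightarrow>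
      \<forall>\<^sub>F N in small x. tc N f g h \<in> K"
  shows "alt \<subseteq> K"
  unfolding alt_def
proof (rule B.generate_subgroup_incl[OF _ K], clarify)
  fix N f g h assume t: "tri N f g h"
  have Nc: "clopen N" using t by (simp add: tri_def pm2_def pm_def)
  have "tc (N \<inter> X) f g h \<in> K"
  proof (rule cover_induct)
    show "tc (N \<inter> {}) f g h \<in> K" using subgroup.one_closed[OF K] by (simp add: tc_def swp_empty)
    fix x assume x: "x \<in> X"
    show "\<exists>M. clopen M \<and> x \<in> M \<and> (\<forall>D. clopen D \<longrightarrow> tc (N \<inter> D) f g h \<in> K \<longrightarrow> tc (N \<inter> (D \<union> M)) f g h \<in> K)"
    proof (cases "x \<in> N")
      case False
      have "N \<inter> (D \<union> (X - N)) = N \<inter> D" for D by blast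
      then show ?thesis using x False Nc by (intro exI[of _ "X - N"]) auto
    next
      case True
      have "\<forall>\<^sub>F M in small x. tc M f g h \<in> K"
        using tri_L[OF t True] tri_neq[OF t True] by (intro loc) auto
      then have "\<forall>\<^sub>F M in small x. tc M f g h \<in> K \<and> M \<subseteq> N"
        by (intro eventually_conj small_subset Nc True)
      then obtain M where M: "clopen M" "x \<in> M" "M \<subseteq> N" "\<And>M'. clopen M' \<Longrightarrow> M' \<subseteq> M \<Longrightarrow> tc M' f g h \<in> K"
        unfolding eventually_small[OF x] by blast
      have "tc (N \<inter> (D \<union> M)) f g h \<in> K" if D: "clopen D" "tc (N \<inter> D) f g h \<in> K" for D
      proof -
        have e: "N \<inter> (D \<union> M) = (N \<inter> D) \<union> (M - D)" using M(3) by blast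
        have t': "tri ((N \<inter> D) \<union> (M - D)) f g h"
          by (rule tri_subset[OF t]) (use D M Nc in auto)
        have "tc ((N \<inter> D) \<union> (M - D)) f g h = tc (N \<inter> D) f g h \<otimes>\<^bsub>B\<^esub> tc (M - D) f g h"
          by (rule tc_split[OF t']) (use D M Nc in auto)
        moreover have "tc (M - D) f g h \<in> K" by (rule M(4)) (use M(1) D(1) in auto)
        ultimately show ?thesis unfolding e using D(2) subgroup.m_closed[OF K] by simp
      qed
      then show ?thesis using M by blast
    qed
  qed
  moreover have "N \<inter> X = N" using Nc clopen_subset by blast
  ultimately show "tc N f g h \<in> K" by simp
qed

end

text \<open>An abstraction of the semidirect product on the unit space of G: \<open>lam\<close> is
  the free involution given by the nontrivial group element and acts on the germs of G by
  \<open>lam_equivariant\<close>. That no germ of \<open>lam\<close> belongs to G,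
  \<open>lam_outer\<close>, is what effectiveness of H provides.\<close>

locale graded_germs = G: minimal_germs T LG for T :: "'a topology" and LG +
  fixes lam :: "'a \<Rightarrow> 'a"
  assumes lam_closed: "\<And>x. x \<in> topspace T \<Longrightarrow> lam x \<in> topspace T"
    and lam_invol: "\<And>x. x \<in> topspace T \<Longrightarrow> lam (lam x) = x"
    and lam_free: "\<And>x. x \<in> topspace T \<Longrightarrow> lam x \<noteq> x"
    and lam_open: "\<And>U. openin T U \<Longrightarrow> openin T (lam ` U)"
    and lam_equivariant: "\<And>f x. LG f x \<Longrightarrow> LG (\<lambda>y. lam (f (lam y))) (lam x)"
    and lam_outer: "\<And>x. x \<in> topspace T \<Longrightarrow> \<not> LG lam x"
begin

abbreviation "X \<equiv> topspace T"

text \<open>\<open>ty b f x\<close>: near \<open>x\<close> the map \<open>f\<close> is given by arrows of the semidirect product of degree \<open>b\<close>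
  in \<open>Z/2\<close>.\<close>

definition ty :: "bool \<Rightarrow> ('a \<Rightarrow> 'a) \<Rightarrow> 'a \<Rightarrow> bool" where
  "ty b f x \<longleftrightarrow> x \<in> X \<and> (if b then LG (\<lambda>y. f (lam y)) (lam x) else LG f x)"

definition LH :: "('a \<Rightarrow> 'a) \<Rightarrow> 'a \<Rightarrow> bool" where
  "LH f x \<longleftrightarrow> (\<exists>b. ty b f x)"

lemma ty_False: "ty False f x \<longleftrightarrow> LG f x"
  using G.L_dom by (auto simp: ty_def)

lemma ty_True: "ty True f x \<longleftrightarrow> x \<in> X \<and> LG (\<lambda>y. f (lam y)) (lam x)"
  by (simp add: ty_def)

lemma LG_near:
  assumes "LG f x" shows "\<exists>N. openin T N \<and> x \<in> N \<and> (\<forall>y\<in>N. y \<in> X \<and> f y \<in> X \<and> LG f y)"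
proof -
  from G.L_inv[OF assms] obtain N where "openin T N" "x \<in> N" "\<forall>y\<in>N. LG f y" by blast
  then show ?thesis using G.L_dom[of f] by metis
qed

lemma ty_cong:
  assumes "ty b f x" "openin T N" "x \<in> N" "\<And>y. y \<in> N \<Longrightarrow> g y = f y" shows "ty b g x"
proof (cases b)
  case False
  then show ?thesis using assms G.L_cong[of f x N g] by (simp add: ty_False)
next
  case True
  have NX: "N \<subseteq> X" using assms openin_subset by blast
  have "LG (\<lambda>y. g (lam y)) (lam x)"
  proof (rule G.L_cong)
    show "LG (\<lambda>y. f (lam y)) (lam x)" using assms(1) True by (simp add: ty_True)
    show "openin T (lam ` N)" using assms lam_open by blast
    show "lam x \<in> lam ` N" using assms by blast
    fix y assume "y \<in> lam ` N"
    then have "lam y \<in> N" using NX lam_invol by auto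
    then show "g (lam y) = f (lam y)" using assms by blast
  qed
  then show ?thesis using assms True by (simp add: ty_True)
qed

lemma ty_lam: "ty b f x \<Longrightarrow> ty (\<not> b) (\<lambda>y. f (lam y)) (lam x)"
proof (cases b)
  case True
  assume "ty b f x"
  then show ?thesis using True by (simp add: ty_True ty_False)
next
  case False
  assume "ty b f x"
  then have f: "LG f x" using False by (simp add: ty_False)
  then have x: "x \<in> X" using G.L_dom by blast
  have "LG (\<lambda>y. f (lam (lam y))) x"
    by (rule G.L_cong[OF f openin_topspace x]) (simp add: lam_invol)
  then show ?thesis using x False lam_closed lam_invol by (simp add: ty_True)
qed

text \<open>If g has degree one, then g lam is a germ of G, and \<open>lam_equivariant\<close>
  supplies the germ of G to compose it with. The two copies of lam in between cancel only on X,
  hence the passage to a neighbourhood on which f has values in X.\<close>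

lemma ty_comp: assumes f: "ty a f x" and g: "ty b g (f x)" shows "ty (a \<noteq> b) (\<lambda>y. g (f y)) x"
proof -
  have x: "x \<in> X" using f by (simp add: ty_def)
  have l: "lam x \<in> X" "lam (lam x) = x" using x lam_closed lam_invol by auto
  show ?thesis
  proof (cases a)
    case False
    note a = this
    have Lf: "LG f x" using f a by (simp add: ty_False)
    show ?thesis
    proof (cases b)
      case False
      then show ?thesis using g a G.L_comp[OF Lf, of g] by (simp add: ty_False)
    next
      case True
      have e: "LG (\<lambda>y. lam (f (lam y))) (lam x)" using lam_equivariant[OF Lf] .
      have "LG (\<lambda>y. g (lam (lam (f (lam y))))) (lam x)"
        by (rule G.L_comp[OF e, of "\<lambda>y. g (lam y)"]) (use g True l in \<open>simp add: ty_True\<close>)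
      moreover obtain N where N: "openin T N" "x \<in> N" "\<And>y. y \<in> N \<Longrightarrow> y \<in> X \<and> f y \<in> X" using LG_near[OF Lf] by blast
      ultimately have "LG (\<lambda>y. g (f (lam y))) (lam x)"
      proof (rule_tac G.L_cong[where N="lam ` N"])
        show "openin T (lam ` N)" "lam x \<in> lam ` N" using N lam_open by auto
        fix y assume "y \<in> lam ` N"
        then obtain n where n: "n \<in> N" "y = lam n" by blast
        then show "g (f (lam y)) = g (lam (lam (f (lam y))))" using N(3)[OF n(1)] by (simp add: lam_invol)
      qed
      then show ?thesis using True a x by (simp add: ty_True)
    qed
  next
    case True
    note a = this
    have Lf: "LG (\<lambda>y. f (lam y)) (lam x)" using f a by (simp add: ty_True)
    show ?thesis
    proof (cases b)
      case False
      then show ?thesis using g a x l G.L_comp[OF Lf, of g] by (simp add: ty_False ty_True)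
    next
      case True
      have e: "LG (\<lambda>y. lam (f (lam (lam y)))) x" using lam_equivariant[OF Lf] l by simp
      have "LG (\<lambda>y. g (lam (lam (f (lam (lam y)))))) x"
        by (rule G.L_comp[OF e, of "\<lambda>y. g (lam y)"]) (use g True l in \<open>simp add: ty_True\<close>)
      moreover obtain N where N: "openin T N" "lam x \<in> N" "\<And>y. y \<in> N \<Longrightarrow> y \<in> X \<and> f (lam y) \<in> X"
        using LG_near[OF Lf] by blast
      ultimately have "LG (\<lambda>y. g (f y)) x"
      proof (rule_tac G.L_cong[where N="lam ` N"])
        show "openin T (lam ` N)" using N lam_open by blast
        show "x \<in> lam ` N" using N(2) l by force
        fix y assume "y \<in> lam ` N"
        then obtain n where n: "n \<in> N" "y = lam n" by blast
        then show "g (f y) = g (lam (lam (f (lam (lam y)))))" using N(3)[OF n(1)] by (simp add: lam_invol)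
      qed
      then show ?thesis using True a by (simp add: ty_False)
    qed
  qed
qed

text \<open>In degree one, a local inverse g of f lam gives the local inverse lam g of f, and
  equivariance shows that it has degree one as well.\<close>

lemma ty_inv:
  assumes "ty b f x"
  shows "\<exists>N N' g. openin T N \<and> openin T N' \<and> x \<in> N \<and> f ` N = N' \<and>
      (\<forall>y\<in>N. ty b f y \<and> ty b g (f y) \<and> g (f y) = y)"
proof (cases b)
  case False
  then show ?thesis using G.L_inv[of f x] assms by (simp add: ty_False)
next
  case True
  have x: "x \<in> X" and Lf: "LG (\<lambda>y. f (lam y)) (lam x)" using assms True by (auto simp: ty_True)
  from G.L_inv[OF Lf] obtain N N' g where N: "openin T N" "openin T N'" "lam x \<in> N" "(\<lambda>y. f (lam y)) ` N = N'"
     "\<forall>y\<in>N. LG (\<lambda>y. f (lam y)) y \<and> LG g (f (lam y)) \<and> g (f (lam y)) = y" by (elim exE conjE)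
  have NX: "N \<subseteq> X" using N openin_subset by blast
  show ?thesis
  proof (intro exI conjI ballI)
    show "openin T (lam ` N)" "openin T N'" using N lam_open by auto
    show "x \<in> lam ` N" using N(3) x lam_invol by force
    show "f ` lam ` N = N'" using N(4) by (simp add: image_image)
    fix y assume "y \<in> lam ` N"
    then obtain n where n: "n \<in> N" "y = lam n" by blast
    then have nX: "n \<in> X" "lam y = n" "y \<in> X" using NX lam_invol lam_closed by auto
    show "ty b f y" using N(5) n nX True by (simp add: ty_True)
    have "LG g (f y)" using N(5) n by simp
    then have "LG (\<lambda>z. lam (g (lam z))) (lam (f y))" using lam_equivariant by blast
    then show "ty b (\<lambda>z. lam (g z)) (f y)" using \<open>LG g (f y)\<close> G.L_dom True by (auto simp: ty_True)
    show "lam (g (f y)) = y" using N(5) n by simp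
  qed
qed

lemma ty_dom: "ty b f x \<Longrightarrow> x \<in> X \<and> f x \<in> X"
  using ty_inv[of b f x] openin_subset by blast

lemma ty_open: "ty b f x \<Longrightarrow> \<exists>U. openin T U \<and> x \<in> U \<and> (\<forall>y\<in>U. ty b f y)"
  using ty_inv[of b f x] by blast

lemma ty_lam_self: "x \<in> X \<Longrightarrow> ty True lam x"
  using G.L_cong[OF G.L_id[of "lam x"] openin_topspace, of "\<lambda>y. lam (lam y)"]
  by (simp add: ty_True lam_closed lam_invol)

text \<open>Composing f, taken with degree one, with a local inverse of degree zero gives the
  identity with degree one. This means that lam is a germ of G, which \<open>lam_outer\<close>
  excludes.\<close>

lemma ty_unique: assumes "ty a f x" "ty b f x" shows "a = b"
proof -
  have False if f0: "ty False f x" and f1: "ty True f x"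
  proof -
    obtain N g where N: "openin T N" "x \<in> N" "\<forall>y\<in>N. ty False f y \<and> ty False g (f y) \<and> g (f y) = y"
      using ty_inv[OF f0] by blast
    have "ty (True \<noteq> False) (\<lambda>y. g (f y)) x" by (rule ty_comp[OF f1]) (use N in blast)
    then have "ty True (\<lambda>y. y) x" using ty_cong[of True "\<lambda>y. g (f y)" x N "\<lambda>y. y"] N by simp
    then show False using lam_outer[of "lam x"] lam_closed by (simp add: ty_True)
  qed
  then show ?thesis using assms by (metis (full_types))
qed

sublocale H: minimal_germs T LH
proof
  show "LH g x" if L: "LH f x" "openin T N" "x \<in> N" "\<And>y. y \<in> N \<Longrightarrow> g y = f y" for f g x N
  proof -
    obtain b where "ty b f x" using L(1) by (auto simp: LH_def)
    from ty_cong[OF this L(2,3,4)] show ?thesis by (auto simp: LH_def)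
  qed
  show "LH (\<lambda>y. y) x" if "x \<in> X" for x using G.L_id[OF that] ty_False unfolding LH_def by blast
  show "LH (\<lambda>y. g (f y)) x" if "LH f x" "LH g (f x)" for f g x
  proof -
    from that obtain a b where "ty a f x" "ty b g (f x)" by (auto simp: LH_def)
    from ty_comp[OF this] show ?thesis by (auto simp: LH_def)
  qed
  show "\<exists>N N' g. openin T N \<and> openin T N' \<and> x \<in> N \<and> f ` N = N' \<and>
      (\<forall>y\<in>N. LH f y \<and> LH g (f y) \<and> g (f y) = y)" if L: "LH f x" for f x
  proof -
    obtain b where "ty b f x" using L by (auto simp: LH_def)
    from ty_inv[OF this] obtain N N' g where "openin T N" "openin T N'" "x \<in> N" "f ` N = N'"
      "\<forall>y\<in>N. ty b f y \<and> ty b g (f y) \<and> g (f y) = y" by (elim exE conjE)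
    then show ?thesis unfolding LH_def by blast
  qed
  show "\<exists>f. LH f x \<and> f x \<in> U" if "x \<in> X" "openin T U" "U \<noteq> {}" for x U
    using G.min[OF that] ty_False unfolding LH_def by blast
  show "\<exists>N. openin T N \<and> x \<in> N \<and> f ` N \<subseteq> D" if L: "LH f x" and D: "openin T D" "f x \<in> D" for f x D
  proof -
    obtain b where b: "ty b f x" using L by (auto simp: LH_def)
    show ?thesis
    proof (cases b)
      case False then show ?thesis using b G.L_cont[of f x D] D by (simp add: ty_False)
    next
      case True
      have x: "x \<in> X" "LG (\<lambda>y. f (lam y)) (lam x)" using b True by (auto simp: ty_True)
      have "f (lam (lam x)) \<in> D" using D x lam_invol by simp
      from G.L_cont[OF x(2) D(1) this] obtain N where N: "openin T N" "lam x \<in> N" "(\<lambda>y. f (lam y)) ` N \<subseteq> D"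
        by blast
      have "x \<in> lam ` N" using N(2) lam_invol[OF x(1)] by force
      moreover have "f ` lam ` N \<subseteq> D" using N(3) by blast
      ultimately show ?thesis using lam_open[OF N(1)] by blast
    qed
  qed
qed (use G.cpt G.haus G.clopen_base G.perfect in auto)

lemma LH_ty: "ty b f x \<Longrightarrow> LH f x"
  by (auto simp: LH_def)

lemma LH_LG: "LG f x \<Longrightarrow> LH f x"
  using ty_False LH_ty by blast

lemma F_subset: "G.F \<subseteq> H.F"
  unfolding G.F_def H.F_def using LH_LG by blast

abbreviation "\<Lambda> \<equiv> restrict lam X"

lemma \<Lambda>_F: "\<Lambda> \<in> H.F"
proof -
  have "bij_betw lam X X" by (rule bij_betwI[of _ _ _ lam]) (auto simp: lam_closed lam_invol)
  then have "\<Lambda> \<in> Bij X" by (simp add: Bij_def)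
  moreover have "LH \<Lambda> x" if "x \<in> X" for x
    by (rule LH_ty, rule ty_cong[OF ty_lam_self[OF that] openin_topspace that]) simp
  ultimately show ?thesis by (simp add: H.F_def)
qed

lemma \<Lambda>_invol: "\<Lambda> \<otimes>\<^bsub>H.B\<^esub> \<Lambda> = \<one>\<^bsub>H.B\<^esub>"
  by (rule H.F_eqI) (use \<Lambda>_F H.F_mult H.one_F H.F_apply[OF \<Lambda>_F \<Lambda>_F] in \<open>auto simp: lam_closed lam_invol BijGroup_one_apply\<close>)

lemma mult_\<Lambda>_in_G:
  assumes "\<alpha> \<in> H.F" shows "\<alpha> \<otimes>\<^bsub>H.B\<^esub> \<Lambda> \<in> G.F \<longleftrightarrow> (\<forall>x\<in>X. ty True \<alpha> x)"
proof -
  have m: "\<alpha> \<otimes>\<^bsub>H.B\<^esub> \<Lambda> \<in> H.F" using assms \<Lambda>_F H.F_mult by blast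
  have eq: "(\<alpha> \<otimes>\<^bsub>H.B\<^esub> \<Lambda>) y = \<alpha> (lam y)" if "y \<in> X" for y using H.F_apply[OF assms \<Lambda>_F that] that by simp
  have "LG (\<alpha> \<otimes>\<^bsub>H.B\<^esub> \<Lambda>) x \<longleftrightarrow> LG (\<lambda>y. \<alpha> (lam y)) x" if "x \<in> X" for x
    using G.L_cong[of _ x X] eq that by (metis openin_topspace)
  then have "\<alpha> \<otimes>\<^bsub>H.B\<^esub> \<Lambda> \<in> G.F \<longleftrightarrow> (\<forall>x\<in>X. LG (\<lambda>y. \<alpha> (lam y)) x)"
    using m by (auto simp: G.F_def H.F_def)
  also have "\<dots> \<longleftrightarrow> (\<forall>x\<in>X. LG (\<lambda>y. \<alpha> (lam y)) (lam x))" using lam_closed lam_invol by metis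
  finally show ?thesis by (simp add: ty_True)
qed

lemma mem_G_iff: "\<alpha> \<in> H.F \<Longrightarrow> \<alpha> \<in> G.F \<longleftrightarrow> (\<forall>x\<in>X. ty False \<alpha> x)"
  by (auto simp: ty_False G.F_def H.F_def)

lemma \<Lambda>_conj_G: assumes "\<alpha> \<in> G.F" shows "\<Lambda> \<otimes>\<^bsub>H.B\<^esub> \<alpha> \<otimes>\<^bsub>H.B\<^esub> \<Lambda> \<in> G.F"
proof -
  have a: "\<alpha> \<in> H.F" using assms F_subset by blast
  have m: "\<Lambda> \<otimes>\<^bsub>H.B\<^esub> \<alpha> \<in> H.F" using a \<Lambda>_F H.F_mult by blast
  have "ty True (\<Lambda> \<otimes>\<^bsub>H.B\<^esub> \<alpha>) x" if x: "x \<in> X" for x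
  proof -
    have 1: "ty False \<alpha> x" using assms x mem_G_iff a by blast
    have ax: "\<alpha> x \<in> X" using H.F_closed[OF a x] .
    have "ty (False \<noteq> True) (\<lambda>y. lam (\<alpha> y)) x" by (rule ty_comp[OF 1 ty_lam_self[OF ax]])
    then have "ty True (\<lambda>y. lam (\<alpha> y)) x" by simp
    then show ?thesis by (rule ty_cong[OF _ openin_topspace x])
        (use H.F_apply[OF \<Lambda>_F a] H.F_closed[OF a] in auto)
  qed
  then show ?thesis using mult_\<Lambda>_in_G[OF m] by blast
qed

lemma \<Lambda>_notin_G: assumes "X \<noteq> {}" shows "\<Lambda> \<notin> G.F"
proof
  assume "\<Lambda> \<in> G.F"
  obtain x where x: "x \<in> X" using assms by blast
  then have "LG \<Lambda> x" using \<open>\<Lambda> \<in> G.F\<close> G.F_L by blast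
  then have "LG lam x" by (rule G.L_cong[OF _ openin_topspace x]) simp
  then show False using lam_outer x by blast
qed

lemma mixed:
  assumes "\<alpha> \<in> H.F" "\<alpha> \<notin> G.F" "\<alpha> \<otimes>\<^bsub>H.B\<^esub> \<Lambda> \<notin> G.F"
  shows "\<exists>x0 x1. ty False \<alpha> x0 \<and> ty True \<alpha> x1"
proof -
  obtain x1 where 1: "x1 \<in> X" "\<not> ty False \<alpha> x1" using assms mem_G_iff by blast
  obtain x0 where 0: "x0 \<in> X" "\<not> ty True \<alpha> x0" using assms mult_\<Lambda>_in_G by blast
  have "LH \<alpha> x1" "LH \<alpha> x0" using assms(1) H.F_L 0 1 by auto
  then obtain b c where "ty b \<alpha> x1" "ty c \<alpha> x0" by (auto simp: LH_def)
  then show ?thesis using 0 1 by (metis (full_types))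
qed

lemma fresh_ty: assumes "x \<in> X" "finite S" shows "\<exists>f. ty b f x \<and> f x \<notin> S"
proof (cases b)
  case False then show ?thesis using G.fresh'[OF assms] by (simp add: ty_False)
next
  case True
  obtain g where g: "LG g x" "g x \<notin> lam ` S" using G.fresh'[OF assms(1), of "lam ` S"] assms by blast
  have gx: "g x \<in> X" using g G.L_dom by blast
  have "ty (False \<noteq> True) (\<lambda>y. lam (g y)) x" 
    by (rule ty_comp[of False g x True lam]) (use g ty_lam_self[OF gx] in \<open>simp_all add: ty_False\<close>)
  moreover have "lam (g x) \<notin> S" using g(2) lam_invol[OF gx] by force
  ultimately show ?thesis using True by (intro exI[of _ "\<lambda>y. lam (g y)"]) simp
qed

lemma G_derived_subset: "derived H.B G.F \<subseteq> derived H.B H.F"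
  using G.B.mono_derived[OF F_subset] .

end

section \<open>Subgroups of F(H) containing D(G)\<close>

locale over_derived = graded_germs +
  fixes K :: "('a \<Rightarrow> 'a) set"
  assumes K: "subgroup K H.B" "K \<subseteq> H.F" and KG: "derived H.B G.F \<subseteq> K"
begin

definition good :: "'a \<Rightarrow> ('a \<Rightarrow> 'a) \<Rightarrow> ('a \<Rightarrow> 'a) \<Rightarrow> ('a \<Rightarrow> 'a) \<Rightarrow> bool" where
  "good x f g h \<longleftrightarrow> (\<forall>\<^sub>F N in H.small x. H.tc N f g h \<in> K)"

definition dist3 :: "'a \<Rightarrow> ('a \<Rightarrow> 'a) \<Rightarrow> ('a \<Rightarrow> 'a) \<Rightarrow> ('a \<Rightarrow> 'a) \<Rightarrow> bool" where
  "dist3 x f g h \<longleftrightarrow> f x \<noteq> g x \<and> g x \<noteq> h x \<and> f x \<noteq> h x"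

lemma ev_tri: "LH f x \<Longrightarrow> LH g x \<Longrightarrow> LH h x \<Longrightarrow> dist3 x f g h \<Longrightarrow> \<forall>\<^sub>F N in H.small x. H.tri N f g h"
  by (intro H.small_tri) (auto simp: dist3_def)

lemma good_rotate:
  assumes "LH f x" "LH g x" "LH h x" "dist3 x f g h" "good x f g h" shows "good x g h f"
  using ev_tri[OF assms(1-4)] assms(5) unfolding good_def
  by eventually_elim (simp add: H.tc_rotate)

lemma good_reparam:
  assumes k: "LH k x" and y: "y = k x" and L: "LH f y" "LH g y" "LH h y" and d: "dist3 y f g h" and gd: "good y f g h"
  shows "good x (\<lambda>z. f (k z)) (\<lambda>z. g (k z)) (\<lambda>z. h (k z))"
proof -
  have x: "x \<in> X" and yX: "y \<in> X" using H.L_dom[OF k] y by auto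
  have "\<forall>\<^sub>F N in H.small y. H.tc N f g h \<in> K \<and> H.tri N f g h"
    using gd ev_tri[OF L d] by (auto simp: good_def intro: eventually_conj)
  then obtain M where M: "clopenin T M" "y \<in> M" "\<And>N. clopenin T N \<Longrightarrow> N \<subseteq> M \<Longrightarrow> H.tc N f g h \<in> K \<and> H.tri N f g h"
    unfolding H.eventually_small[OF yX] by blast
  have "\<forall>\<^sub>F N in H.small x. H.pm N k \<and> k ` N \<subseteq> M"
    by (intro eventually_conj H.small_pm H.small_image k) (use M y in \<open>auto simp: clopenin_def\<close>)
  then show ?thesis unfolding good_def
  proof (rule eventually_mono)
    fix N assume N: "H.pm N k \<and> k ` N \<subseteq> M"
    then have "H.tc (k ` N) f g h \<in> K \<and> H.tri (k ` N) f g h" using M(3) H.pm_image_clopen by blast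
    then show "H.tc N (\<lambda>z. f (k z)) (\<lambda>z. g (k z)) (\<lambda>z. h (k z)) \<in> K" using H.tc_reparam N by metis
  qed
qed

lemma good_same:
  assumes t: "ty b f x" "ty b g x" "ty b h x" and d: "dist3 x f g h" shows "good x f g h"
proof (cases b)
  case False
  \<comment> \<open>\<open>small\<close> and \<open>tc\<close> depend on T only and coincide for G
    and H; the germs enter only through \<open>tri\<close>.\<close>
  have "\<forall>\<^sub>F N in H.small x. G.tri N f g h"
    by (rule G.small_tri) (use t d False in \<open>auto simp: ty_False dist3_def\<close>)
  then show ?thesis unfolding good_def
    by (rule eventually_mono) (use G.tc_derived KG in blast)
next
  case True
  have x: "x \<in> X" using ty_dom t by blast
  have l: "lam (lam x) = x" using lam_invol x by blast
  have "\<forall>\<^sub>F N in H.small (lam x). G.tri N (\<lambda>y. f (lam y)) (\<lambda>y. g (lam y)) (\<lambda>y. h (lam y))"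
    by (rule G.small_tri) (use t d l True in \<open>auto simp: ty_True dist3_def\<close>)
  then have 1: "good (lam x) (\<lambda>y. f (lam y)) (\<lambda>y. g (lam y)) (\<lambda>y. h (lam y))" unfolding good_def
    by (rule eventually_mono) (use G.tc_derived KG in blast)
  have "good x (\<lambda>z. f (lam (lam z))) (\<lambda>z. g (lam (lam z))) (\<lambda>z. h (lam (lam z)))"
    by (rule good_reparam[OF LH_ty[OF ty_lam_self[OF x]] refl, of "\<lambda>y. f (lam y)" "\<lambda>y. g (lam y)" "\<lambda>y. h (lam y)"])
      (use 1 t d l True in \<open>auto simp: ty_True dist3_def intro!: LH_LG\<close>)
  moreover have "H.tc N (\<lambda>z. f (lam (lam z))) (\<lambda>z. g (lam (lam z))) (\<lambda>z. h (lam (lam z))) = H.tc N f g h"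
    if "clopenin T N" for N
    by (rule H.tc_cong) (use H.clopen_subset[OF that] lam_invol in auto)
  ultimately show ?thesis unfolding good_def
    using H.small_clopen[OF x] by (auto elim: eventually_elim2)
qed

text \<open>Conjugate by a 3-cycle through \<open>f\<close>, \<open>f'\<close> and a fresh third map of the same degree.\<close>

lemma good_replace:
  assumes f: "ty a f x" "ty a f' x" and gh: "LH g x" "LH h x" and d: "dist3 x f g h" 
    and n: "f' x \<noteq> f x" "f' x \<noteq> g x" "f' x \<noteq> h x" and gd: "good x f g h"
  shows "good x f' g h"
proof -
  have x: "x \<in> X" using ty_dom f by blast
  obtain e where e: "ty a e x" "e x \<notin> {f x, f' x, g x, h x}" using fresh_ty[OF x, of "{f x, f' x, g x, h x}"] by auto
  have "good x f f' e" using good_same[OF f e(1)] e n by (auto simp: dist3_def)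
  then have 1: "\<forall>\<^sub>F N in H.small x. H.tc N f f' e \<in> K" by (simp add: good_def)
  have L: "LH f x" "LH f' x" "LH e x" using f e LH_ty by auto
  have "\<forall>\<^sub>F N in H.small x. H.tri N f f' e \<and> H.tri N f g h \<and> H.tri N g f' e \<and> H.tri N h f' e"
    by (intro eventually_conj ev_tri L gh) (use d e n in \<open>auto simp: dist3_def\<close>)
  with 1 gd[unfolded good_def] show ?thesis unfolding good_def
  proof eventually_elim
    case (elim N)
    define c where "c = H.tc N f f' e"
    have t: "H.tri N f f' e" "H.tri N f g h" "H.tri N g f' e" "H.tri N h f' e" using elim by auto
    have cK: "c \<in> K" using elim by (simp add: c_def)
    have cF: "c \<in> H.F" using cK K by blast
    have gX: "g z \<in> X" "h z \<in> X" if "z \<in> N" for z using H.tri_apply(5,6)[OF t(2) that] .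
    have "c (g z) = g z" "c (h z) = h z" if "z \<in> N" for z
    proof -
      have "f ` N \<inter> g ` N = {}" "f ` N \<inter> h ` N = {}" "g ` N \<inter> f' ` N = {}" "g ` N \<inter> e ` N = {}"
        "h ` N \<inter> f' ` N = {}" "h ` N \<inter> e ` N = {}"
        using t by (auto simp: H.tri_def H.pm2_def)
      then show "c (g z) = g z" "c (h z) = h z" unfolding c_def
        using H.tc_apply_other[OF t(1)] gX[OF that] that by (metis IntI empty_iff image_eqI)+
    qed
    moreover have "c (f z) = f' z" if "z \<in> N" for z using H.tc_apply(1)[OF t(1) that] by (simp add: c_def)
    ultimately have "H.tc N (\<lambda>z. c (f z)) (\<lambda>z. c (g z)) (\<lambda>z. c (h z)) = H.tc N f' g h"
      by (intro H.tc_cong) auto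
    then have "c \<otimes>\<^bsub>H.B\<^esub> H.tc N f g h \<otimes>\<^bsub>H.B\<^esub> inv\<^bsub>H.B\<^esub> c = H.tc N f' g h"
      using H.tc_conj[OF cF t(2)] by simp
    then show ?case using cK elim(2) K(1) by (metis subgroup.m_closed subgroup.m_inv_closed)
  qed
qed

text \<open>\<open>good_replace\<close> needs each new value to differ from those present, which f',
  g', h' need not satisfy relative to f, g, h. The detour through fresh maps u, v, w of the same
  degrees removes collisions; rotations bring the map to be replaced to the front.\<close>

lemma good_move:
  assumes t: "ty a f x" "ty b g x" "ty c h x" "ty a f' x" "ty b g' x" "ty c h' x"
    and d: "dist3 x f g h" "dist3 x f' g' h'" and gd: "good x f g h"
  shows "good x f' g' h'"
proof -
  have x: "x \<in> X" using ty_dom t by blast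
  define S where "S = {f x, g x, h x, f' x, g' x, h' x}"
  have fin: "finite S" by (simp add: S_def)
  obtain u where u: "ty a u x" "u x \<notin> S" using fresh_ty[OF x fin] by blast
  obtain v where v: "ty b v x" "v x \<notin> insert (u x) S" using fresh_ty[OF x, of "insert (u x) S"] fin by auto
  obtain w where w: "ty c w x" "w x \<notin> insert (v x) (insert (u x) S)"
    using fresh_ty[OF x, of "insert (v x) (insert (u x) S)"] fin by auto
  note L = t[THEN LH_ty] u(1)[THEN LH_ty] v(1)[THEN LH_ty] w(1)[THEN LH_ty]
  note D = d[unfolded dist3_def] u(2)[unfolded S_def] v(2)[unfolded S_def] w(2)[unfolded S_def]
  have "good x u g h" by (rule good_replace[OF t(1) u(1) L(2,3) d(1) _ _ _ gd]) (use D in auto)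
  then have "good x g h u" by (rule good_rotate[rotated -1]) (use L D in \<open>auto simp: dist3_def\<close>)
  then have "good x v h u" by (rule good_replace[OF t(2) v(1), rotated -1]) (use L D in \<open>auto simp: dist3_def\<close>)
  then have "good x h u v" by (rule good_rotate[rotated -1]) (use L D in \<open>auto simp: dist3_def\<close>)
  then have "good x w u v" by (rule good_replace[OF t(3) w(1), rotated -1]) (use L D in \<open>auto simp: dist3_def\<close>)
  then have "good x u v w" by (rule good_rotate[rotated -1]) (use L D in \<open>auto simp: dist3_def\<close>)
  then have "good x f' v w" by (rule good_replace[OF u(1) t(4), rotated -1]) (use L D in \<open>auto simp: dist3_def\<close>)
  then have "good x v w f'" by (rule good_rotate[rotated -1]) (use L D in \<open>auto simp: dist3_def\<close>)
  then have "good x g' w f'" by (rule good_replace[OF v(1) t(5), rotated -1]) (use L D in \<open>auto simp: dist3_def\<close>)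
  then have "good x w f' g'" by (rule good_rotate[rotated -1]) (use L D in \<open>auto simp: dist3_def\<close>)
  then have "good x h' f' g'" by (rule good_replace[OF w(1) t(6), rotated -1]) (use L D in \<open>auto simp: dist3_def\<close>)
  then show ?thesis by (rule good_rotate[rotated -1]) (use L D in \<open>auto simp: dist3_def\<close>)
qed

end

context over_derived begin

text \<open>Constant triples of degrees are settled by \<open>good_same\<close>. The mixed element
  produces one good triple of degrees 0, 1, 1; every other nonconstant triple is carried to it by a
  change of base point, a flip of all degrees, or a rotation.\<close>

lemma alt_subset_of_mixed:
  assumes \<alpha>: "\<alpha> \<in> K" and mix: "\<alpha> \<notin> G.F" "\<alpha> \<otimes>\<^bsub>H.B\<^esub> \<Lambda> \<notin> G.F"
  shows "H.alt \<subseteq> K"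
proof -
  have aF: "\<alpha> \<in> H.F" using \<alpha> K by blast
  obtain x0 x1 where x0: "ty False \<alpha> x0" and x1: "ty True \<alpha> x1" using mixed[OF aF mix] by blast
  have x0X: "x0 \<in> X" using x0 ty_dom by blast
  obtain U where U: "openin T U" "x1 \<in> U" "\<And>y. y \<in> U \<Longrightarrow> ty True \<alpha> y" using ty_open[OF x1] by blast
  have U0: "U \<noteq> {}" using U by blast
  \<comment> \<open>Both g x0 and h x0 are placed in U, where \<alpha> has degree one, while
    \<alpha> has degree zero at x0. Conjugation by \<alpha> therefore turns degrees 0, 0, 0 into 0,
    1, 1.\<close>
  obtain g where g: "LG g x0" "g x0 \<in> U" "g x0 \<noteq> x0" using G.fresh[OF x0X U(1) U0, of "{x0}"] by auto
  obtain h where h: "LG h x0" "h x0 \<in> U" "h x0 \<noteq> x0" "h x0 \<noteq> g x0"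
    using G.fresh[OF x0X U(1) U0, of "{x0, g x0}"] by auto
  define f' g' h' where "f' = (\<lambda>y. \<alpha> y)" and "g' = (\<lambda>y. \<alpha> (g y))" and "h' = (\<lambda>y. \<alpha> (h y))"
  have t0: "ty False f' x0" using x0 by (simp add: f'_def)
  have "ty (False \<noteq> True) g' x0" unfolding g'_def by (rule ty_comp) (use g U in \<open>simp_all add: ty_False\<close>)
  then have t1: "ty True g' x0" by simp
  have "ty (False \<noteq> True) h' x0" unfolding h'_def by (rule ty_comp) (use h U in \<open>simp_all add: ty_False\<close>)
  then have t2: "ty True h' x0" by simp
  have gX: "g x0 \<in> X" "h x0 \<in> X" using g h G.L_dom by blast+
  have d0: "dist3 x0 f' g' h'"
    using H.F_inj[OF aF] x0X gX g h by (simp add: dist3_def f'_def g'_def h'_def)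
  have d1: "dist3 x0 (\<lambda>y. y) g h" using g h by (auto simp: dist3_def)
  have base: "good x0 f' g' h'"
  proof -
    have gd: "\<forall>\<^sub>F N in H.small x0. H.tc N (\<lambda>y. y) g h \<in> K"
      using good_same[of False "\<lambda>y. y" x0 g h] g h G.L_id[OF x0X] d1 by (simp add: ty_False good_def)
    have "\<forall>\<^sub>F N in H.small x0. H.tri N (\<lambda>y. y) g h"
      by (intro ev_tri LH_LG g h d1 G.L_id x0X)
    with gd show ?thesis unfolding good_def
    proof eventually_elim
      case (elim N)
      have "\<alpha> \<otimes>\<^bsub>H.B\<^esub> H.tc N (\<lambda>y. y) g h \<otimes>\<^bsub>H.B\<^esub> inv\<^bsub>H.B\<^esub> \<alpha> = H.tc N f' g' h'"
        using H.tc_conj[OF aF elim(2)] by (simp add: f'_def g'_def h'_def)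
      then show ?case using \<alpha> elim(1) K(1) by (metis subgroup.m_closed subgroup.m_inv_closed)
    qed
  qed
  \<comment> \<open>Minimality of G gives a degree-zero map k from x into the region around x0 where
    the given 3-cycle is good. Precomposition with k keeps the degrees, and \<open>good_move\<close>
    exchanges the resulting maps for f, g, h.\<close>
  have FTT: "good x f g h" if t: "ty False f x" "ty True g x" "ty True h x" and d: "dist3 x f g h" for x f g h
  proof -
    have x: "x \<in> X" using t ty_dom by blast
    have L: "LH f' x0" "LH g' x0" "LH h' x0" using t0 t1 t2 LH_ty by auto
    have "\<forall>\<^sub>F N in H.small x0. H.tc N f' g' h' \<in> K \<and> H.tri N f' g' h'"
      using base ev_tri[OF L d0] by (auto simp: good_def intro: eventually_conj)
    then obtain M where M: "clopenin T M" "x0 \<in> M" "\<And>N. clopenin T N \<Longrightarrow> N \<subseteq> M \<Longrightarrow> H.tc N f' g' h' \<in> K \<and> H.tri N f' g' h'"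
      unfolding H.eventually_small[OF x0X] by blast
    obtain V0 where V0: "openin T V0" "x0 \<in> V0" "\<And>y. y \<in> V0 \<Longrightarrow> ty False f' y" using ty_open[OF t0] by blast
    obtain V1 where V1: "openin T V1" "x0 \<in> V1" "\<And>y. y \<in> V1 \<Longrightarrow> ty True g' y" using ty_open[OF t1] by blast
    obtain V2 where V2: "openin T V2" "x0 \<in> V2" "\<And>y. y \<in> V2 \<Longrightarrow> ty True h' y" using ty_open[OF t2] by blast
    have "openin T (M \<inter> V0 \<inter> V1 \<inter> V2)" "M \<inter> V0 \<inter> V1 \<inter> V2 \<noteq> {}"
      using M V0 V1 V2 by (auto simp: clopenin_def)
    then obtain k where k: "LG k x" "k x \<in> M \<inter> V0 \<inter> V1 \<inter> V2" using G.min[OF x] by blast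
    define z where "z = k x"
    have zX: "z \<in> X" using k G.L_dom by (auto simp: z_def)
    have tz: "ty False f' z" "ty True g' z" "ty True h' z" using k V0 V1 V2 by (auto simp: z_def)
    have dz: "dist3 z f' g' h'" using H.tri_neq[of M f' g' h' z] M(3)[OF M(1)] k(2) by (simp add: dist3_def z_def)
    have gz: "good z f' g' h'" unfolding good_def H.eventually_small[OF zX] using M k(2) by (auto simp: z_def)
    have "good x (\<lambda>w. f' (k w)) (\<lambda>w. g' (k w)) (\<lambda>w. h' (k w))"
      by (rule good_reparam[OF LH_LG[OF k(1)] z_def _ _ _ dz gz]) (use tz LH_ty in auto)
    moreover have "ty (False \<noteq> False) (\<lambda>w. f' (k w)) x" "ty (False \<noteq> True) (\<lambda>w. g' (k w)) x" "ty (False \<noteq> True) (\<lambda>w. h' (k w)) x"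
      using ty_comp[of False k x] k(1) tz unfolding z_def ty_False[of k x, symmetric] by blast+
    moreover have "dist3 x (\<lambda>w. f' (k w)) (\<lambda>w. g' (k w)) (\<lambda>w. h' (k w))" using dz by (simp add: dist3_def z_def)
    ultimately show ?thesis
      using good_move[of False "\<lambda>w. f' (k w)" x True "\<lambda>w. g' (k w)" True "\<lambda>w. h' (k w)" f g h] t d by simp
  qed
  \<comment> \<open>Precomposition with lam flips all three degrees and reduces this pattern to the
    previous one at the point lam x.\<close>
  have TFF: "good x f g h" if t: "ty True f x" "ty False g x" "ty False h x" and d: "dist3 x f g h" for x f g h
  proof -
    have x: "x \<in> X" using t ty_dom by blast
    have l: "lam (lam x) = x" using lam_invol x by blast
    note tl = t[THEN ty_lam, simplified]
    have dl: "dist3 (lam x) (\<lambda>y. f (lam y)) (\<lambda>y. g (lam y)) (\<lambda>y. h (lam y))" using d l by (simp add: dist3_def)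
    have "good x (\<lambda>z. f (lam (lam z))) (\<lambda>z. g (lam (lam z))) (\<lambda>z. h (lam (lam z)))"
      by (rule good_reparam[OF LH_ty[OF ty_lam_self[OF x]] refl, of "\<lambda>y. f (lam y)" "\<lambda>y. g (lam y)" "\<lambda>y. h (lam y)"])
        (use FTT[OF tl dl] dl tl LH_ty in auto)
    moreover have "H.tc N (\<lambda>z. f (lam (lam z))) (\<lambda>z. g (lam (lam z))) (\<lambda>z. h (lam (lam z))) = H.tc N f g h"
      if "clopenin T N" for N
      by (rule H.tc_cong) (use H.clopen_subset[OF that] lam_invol in auto)
    ultimately show ?thesis unfolding good_def
      using H.small_clopen[OF x] by (auto elim: eventually_elim2)
  qed
  show ?thesis
  proof (rule H.alt_subset_local[OF K(1)])
    fix f g h x assume L: "LH f x" "LH g x" "LH h x" and ne: "f x \<noteq> g x" "g x \<noteq> h x" "f x \<noteq> h x"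
    have d: "dist3 x f g h" "dist3 x g h f" "dist3 x h f g" using ne by (auto simp: dist3_def)
    obtain a b c where t: "ty a f x" "ty b g x" "ty c h x" using L by (auto simp: LH_def)
    \<comment> \<open>Of three degrees in Z/2 two agree; a rotation puts these in the last two
      places.\<close>
    have one: "good x f g h" if "ty a f x" "ty b g x" "ty b h x" "dist3 x f g h" for a b f g h
      using that good_same[of a f x g h] FTT[of f x g h] TFF[of f x g h] by (cases a; cases b) auto
    have "good x f g h"
    proof -
      consider "b = c" | "a = c" | "a = b" by blast
      then show ?thesis
      proof cases
        case 1 then show ?thesis using one t d by blast
      next
        case 2
        then have "good x g h f" using one t d by blast
        then have "good x h f g" using good_rotate[OF L(2,3,1) d(2)] by blast
        then show ?thesis using good_rotate[OF L(3,1,2) d(3)] by blast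
      next
        case 3
        then have "good x h f g" using one t d by blast
        then show ?thesis using good_rotate[OF L(3,1,2) d(3)] by blast
      qed
    qed
    then show "\<forall>\<^sub>F N in H.small x. H.tc N f g h \<in> K" by (simp add: good_def)
  qed
qed

end

section \<open>Normalizer, mixed elements of D(H), and the correction of \<lambda>\<close>

context graded_germs begin

lemma normalizer_G:
  assumes aF: "\<alpha> \<in> H.F"
    and nrm: "\<And>\<delta>. \<delta> \<in> derived H.B G.F \<Longrightarrow> \<alpha> \<otimes>\<^bsub>H.B\<^esub> \<delta> \<otimes>\<^bsub>H.B\<^esub> inv\<^bsub>H.B\<^esub> \<alpha> \<in> G.F"
  shows "\<alpha> \<in> G.F \<or> \<alpha> \<otimes>\<^bsub>H.B\<^esub> \<Lambda> \<in> G.F"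
proof (rule ccontr)
  assume "\<not> ?thesis"
  then obtain x0 x1 where x0: "ty False \<alpha> x0" and x1: "ty True \<alpha> x1" using mixed[OF aF] by blast
  have x0X: "x0 \<in> X" using x0 ty_dom by blast
  obtain U where U: "openin T U" "x1 \<in> U" "\<And>y. y \<in> U \<Longrightarrow> ty True \<alpha> y" using ty_open[OF x1] by blast
  have U0: "U \<noteq> {}" using U by blast
  obtain g where g: "LG g x0" "g x0 \<in> U" "g x0 \<noteq> x0" using G.fresh[OF x0X U(1) U0, of "{x0}"] by auto
  obtain h where h: "LG h x0" "h x0 \<noteq> x0" "h x0 \<noteq> g x0" using G.fresh'[OF x0X, of "{x0, g x0}"] by auto
  have "\<forall>\<^sub>F N in G.small x0. G.tri N (\<lambda>y. y) g h"
    by (rule G.small_tri) (use g h G.L_id[OF x0X] in auto)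
  then obtain N where N: "clopenin T N" "x0 \<in> N" "G.tri N (\<lambda>y. y) g h" using G.small_ex[OF _ x0X] by blast
  define c where "c = G.tc N (\<lambda>y. y) g h"
  define c' where "c' = \<alpha> \<otimes>\<^bsub>H.B\<^esub> c \<otimes>\<^bsub>H.B\<^esub> inv\<^bsub>H.B\<^esub> \<alpha>"
  have c'G: "c' \<in> G.F" using nrm G.tc_derived[OF N(3)] by (simp add: c'_def c_def)
  have cF: "c \<in> H.F" using G.tc_F[OF N(3)] F_subset by (auto simp: c_def)
  have c': "c' (\<alpha> y) = \<alpha> (c y)" if "y \<in> X" for y
    unfolding c'_def using that aF cF by (simp add: H.F_apply H.F_mult H.F_inv H.F_closed H.F_inv_apply)
  \<comment> \<open>As c' and \<alpha> have degree zero here, so does their composite at x0. Near x0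
    it equals \<alpha> g, whose degree is that of \<alpha> at g x0, namely one.\<close>
  have "ty False c' (\<alpha> x0)" using c'G H.F_closed[OF aF x0X] G.F_L by (simp add: ty_False)
  then have "ty (False \<noteq> False) (\<lambda>y. c' (\<alpha> y)) x0" by (rule ty_comp[OF x0])
  then have "ty False (\<lambda>y. \<alpha> (g y)) x0"
    using ty_cong[of False "\<lambda>y. c' (\<alpha> y)" x0 N "\<lambda>y. \<alpha> (g y)"] N c' G.tc_apply(1)[OF N(3)] H.clopen_subset[OF N(1)]
    by (auto simp: c_def clopenin_def subset_iff)
  moreover have "ty (False \<noteq> True) (\<lambda>y. \<alpha> (g y)) x0" by (rule ty_comp) (use g U in \<open>simp_all add: ty_False\<close>)
  ultimately show False using ty_unique by fastforce
qed

text \<open>A 3-cycle through maps of degrees 1, 0, 0 has degree one where it passes from f to g and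
  degree zero where it passes from g to h. This is what makes M a proper subgroup of D(H).\<close>

lemma derived_not_in_G:
  assumes "X \<noteq> {}"
  shows "\<exists>\<delta> \<in> derived H.B H.F. \<delta> \<notin> G.F \<and> \<delta> \<otimes>\<^bsub>H.B\<^esub> \<Lambda> \<notin> G.F"
proof -
  obtain x where x: "x \<in> X" using assms by blast
  obtain f where f: "ty True f x" using fresh_ty[OF x, of "{}"] by auto
  obtain g where g: "ty False g x" "g x \<noteq> f x" using fresh_ty[OF x, of "{f x}"] by auto
  obtain h where h: "ty False h x" "h x \<noteq> f x" "h x \<noteq> g x" using fresh_ty[OF x, of "{f x, g x}"] by auto
  have "\<forall>\<^sub>F N in H.small x. H.tri N f g h"
    by (rule H.small_tri) (use f g h LH_ty in auto)
  then obtain N where N: "clopenin T N" "x \<in> N" "H.tri N f g h" using H.small_ex[OF _ x] by blast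
  define c where "c = H.tc N f g h"
  have cF: "c \<in> H.F" using H.tc_F[OF N(3)] by (simp add: c_def)
  have d: "f x \<in> X" "g x \<in> X" using f g ty_dom by blast+
  have c: "c (f y) = g y" "c (g y) = h y" if "y \<in> N" for y using H.tc_apply[OF N(3) that] by (simp_all add: c_def)
  have op: "openin T N" using N by (simp add: clopenin_def)
  have "c \<notin> G.F"
  proof
    assume "c \<in> G.F"
    then have "ty False c (f x)" using d mem_G_iff[OF cF] by blast
    then have "ty (True \<noteq> False) (\<lambda>y. c (f y)) x" by (rule ty_comp[OF f])
    then have "ty True g x" using ty_cong[of True "\<lambda>y. c (f y)" x N g] op N(2) c by simp
    then show False using g(1) ty_unique by blast
  qed
  moreover have "c \<otimes>\<^bsub>H.B\<^esub> \<Lambda> \<notin> G.F"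
  proof
    assume "c \<otimes>\<^bsub>H.B\<^esub> \<Lambda> \<in> G.F"
    then have "ty True c (g x)" using d mult_\<Lambda>_in_G[OF cF] by blast
    then have "ty (False \<noteq> True) (\<lambda>y. c (g y)) x" by (rule ty_comp[OF g(1)])
    then have "ty True h x" using ty_cong[of True "\<lambda>y. c (g y)" x N h] op N(2) c by simp
    then show False using h(1) ty_unique by blast
  qed
  ultimately show ?thesis using H.tc_derived[OF N(3)] c_def by blast
qed

text \<open>The conjugate of d by s is the commutator of s and d, times d.\<close>

lemma derived_conj_closed:
  assumes "s \<in> H.F" "d \<in> derived H.B H.F"
  shows "s \<otimes>\<^bsub>H.B\<^esub> d \<otimes>\<^bsub>H.B\<^esub> inv\<^bsub>H.B\<^esub> s \<in> derived H.B H.F"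
proof -
  have sub: "subgroup (derived H.B H.F) H.B"
    by (rule G.B.derived_is_subgroup) (use subgroup.subset[OF H.subgroup_F] in blast)
  have dF: "d \<in> H.F" using assms G.B.derived_incl[OF order_refl H.subgroup_F] by blast
  have C: "s \<in> carrier H.B" "d \<in> carrier H.B" using assms dF H.F_carrier by auto
  have "s \<otimes>\<^bsub>H.B\<^esub> d \<otimes>\<^bsub>H.B\<^esub> inv\<^bsub>H.B\<^esub> s \<otimes>\<^bsub>H.B\<^esub> inv\<^bsub>H.B\<^esub> d \<in> derived H.B H.F"
    unfolding derived_def using assms(1) dF by (blast intro: generate.incl)
  then have "s \<otimes>\<^bsub>H.B\<^esub> d \<otimes>\<^bsub>H.B\<^esub> inv\<^bsub>H.B\<^esub> s \<otimes>\<^bsub>H.B\<^esub> inv\<^bsub>H.B\<^esub> d \<otimes>\<^bsub>H.B\<^esub> d \<in> derived H.B H.F"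
    using assms(2) subgroup.m_closed[OF sub] by blast
  then show ?thesis using C by (simp add: G.B.m_assoc)
qed

text \<open>The clopen set \<open>D\<close> on which the restriction of \<open>\<Lambda>\<close> is corrected by an element of the smaller
  group grows by adding small \<open>N\<close> together with \<open>lam ` N\<close>: there \<open>\<Lambda>\<close> is a transposition, hence
  congruent to a transposition of the smaller group.\<close>

lemma exists_correction: "\<exists>\<beta>\<in>G.F. \<beta> \<otimes>\<^bsub>H.B\<^esub> \<Lambda> \<in> derived H.B H.F"
proof -
  have sub: "subgroup (derived H.B H.F) H.B"
    by (rule G.B.derived_is_subgroup) (use subgroup.subset[OF H.subgroup_F] in blast)
  define P where "P D \<longleftrightarrow> (\<exists>D' \<mu> \<beta>. clopenin T D' \<and> D \<subseteq> D' \<and> lam ` D' = D' \<and> \<mu> \<in> H.F \<and>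
     (\<forall>y\<in>X. \<mu> y = (if y \<in> D' then lam y else y)) \<and> \<beta> \<in> G.F \<and> \<beta> \<otimes>\<^bsub>H.B\<^esub> \<mu> \<in> derived H.B H.F)" for D
  have "P X"
  proof (rule H.cover_induct)
    show "P {}" unfolding P_def
      using G.one_F H.one_F subgroup.one_closed[OF sub]
      by (intro exI[of _ "{}"] exI[of _ "\<one>\<^bsub>H.B\<^esub>"]) (auto simp: BijGroup_one_apply)
    fix x assume x: "x \<in> X"
    \<comment> \<open>The 3-cycle through g, the identity and lam is s r, where s is a transposition
      of F(G) and r is a local piece of \<open>\<Lambda>\<close>. As 3-cycles lie in D(H), s
      corrects r.\<close>
    obtain g where g: "LG g x" "g x \<noteq> x" "g x \<noteq> lam x" using G.fresh'[OF x, of "{x, lam x}"] by auto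
    have "\<forall>\<^sub>F N in H.small x. H.tri N g (\<lambda>y. y) lam \<and> G.pm2 N g (\<lambda>y. y)"
    proof (intro eventually_conj)
      show "\<forall>\<^sub>F N in H.small x. H.tri N g (\<lambda>y. y) lam"
        by (rule H.small_tri) (use g x lam_free[OF x] ty_lam_self[OF x] LH_ty H.L_id LH_LG in auto)
      show "\<forall>\<^sub>F N in H.small x. G.pm2 N g (\<lambda>y. y)"
        using G.small_pm2[OF g(1) G.L_id[OF x] g(2)] .
    qed
    then obtain N where N: "clopenin T N" "x \<in> N" "H.tri N g (\<lambda>y. y) lam" "G.pm2 N g (\<lambda>y. y)"
      using H.small_ex[OF _ x] by blast
    have "P (D \<union> N)" if PD: "P D" for D
    proof -
      from PD obtain D' \<mu> \<beta> where D': "clopenin T D'" "D \<subseteq> D'" "lam ` D' = D'" and \<mu>: "\<mu> \<in> H.F"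
        "\<And>y. y\<in>X \<Longrightarrow> \<mu> y = (if y \<in> D' then lam y else y)" and \<beta>: "\<beta> \<in> G.F" "\<beta> \<otimes>\<^bsub>H.B\<^esub> \<mu> \<in> derived H.B H.F"
        unfolding P_def by blast
      define M where "M = N - D'"
      have M: "clopenin T M" "M \<subseteq> N" using N D' by (auto simp: M_def)
      have MX: "M \<subseteq> X" using M H.clopen_subset by blast
      have t: "H.tri M g (\<lambda>y. y) lam" "G.pm2 M g (\<lambda>y. y)" using N M H.tri_subset G.pm2_subset by blast+
      have pl: "H.pm2 M (\<lambda>y. y) lam" "H.pm2 M g (\<lambda>y. y)" using t by (auto simp: H.tri_def)
      define s where "s = H.swp M g (\<lambda>y. y)"
      define r where "r = H.swp M (\<lambda>y. y) lam"
      have F: "s \<in> G.F" "s \<in> H.F" "r \<in> H.F" "\<beta> \<in> H.F"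
        using G.swp_F[OF t(2)] H.swp_F[OF pl(1)] F_subset \<beta> by (auto simp: s_def r_def)
      have lM: "clopenin T (lam ` M)" using H.pm_image_clopen[of M lam] pl by (simp add: H.pm2_def)
      have lD: "lam y \<in> D' \<longleftrightarrow> y \<in> D'" if "y \<in> X" for y
        using D'(3) lam_invol[OF that] by (metis image_eqI)
      have dM: "M \<inter> lam ` M = {}" using pl by (simp add: H.pm2_def)
      have lMD: "lam ` M \<inter> D' = {}" using lD MX by (auto simp: M_def)
      define E where "E = D' \<union> (M \<union> lam ` M)"
      have "lam ` lam ` M = M"
      proof -
        have "lam ` lam ` M = (\<lambda>y. y) ` M" unfolding image_image using lam_invol MX by (intro image_cong) auto
        then show ?thesis by simp
      qed
      then have E: "clopenin T E" "D \<union> N \<subseteq> E" "lam ` E = E"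
        using D' M lM by (auto simp: E_def M_def image_Un)
      have \<mu>r: "(\<mu> \<otimes>\<^bsub>H.B\<^esub> r) y = (if y \<in> E then lam y else y)" if y: "y \<in> X" for y
      proof -
        have 1: "(\<mu> \<otimes>\<^bsub>H.B\<^esub> r) y = \<mu> (r y)" using H.F_apply[OF \<mu>(1) F(3) y] .
        have "\<mu> (r y) = (if y \<in> E then lam y else y)"
        proof (rule H.swp_cases[OF pl(1) y])
          fix w assume w: "w \<in> M" "y = w" "H.swp M (\<lambda>y. y) lam y = lam w"
          have "lam w \<in> X" "lam w \<notin> D'" using w MX lam_closed lMD by blast+
          then show ?thesis using w \<mu>(2)[of "lam w"] by (simp add: r_def E_def)
        next
          fix w assume w: "w \<in> M" "y = lam w" "H.swp M (\<lambda>y. y) lam y = w"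
          have "w \<in> X" "w \<notin> D'" using w MX by (auto simp: M_def)
          then show ?thesis using w \<mu>(2)[of "w"] lam_invol[of w] by (simp add: r_def E_def)
        next
          assume a: "y \<notin> (\<lambda>y. y) ` M" "y \<notin> lam ` M" "H.swp M (\<lambda>y. y) lam y = y"
          then show ?thesis using \<mu>(2)[OF y] by (simp add: r_def E_def)
        qed
        then show ?thesis using 1 by simp
      qed
      have sr: "s \<otimes>\<^bsub>H.B\<^esub> r \<in> derived H.B H.F" using H.tc_derived[OF t(1)] by (simp add: H.tc_def s_def r_def)
      note C = F(2-4)[THEN H.F_carrier] \<mu>(1)[THEN H.F_carrier]
      \<comment> \<open>Conjugating \<beta> \<mu> by s before multiplying by s r cancels the inner s
        and leaves (s \<beta>)(\<mu> r), with new correction s \<beta> and new partial involution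
        \<mu> r.\<close>
      have "(s \<otimes>\<^bsub>H.B\<^esub> (\<beta> \<otimes>\<^bsub>H.B\<^esub> \<mu>) \<otimes>\<^bsub>H.B\<^esub> inv\<^bsub>H.B\<^esub> s) \<otimes>\<^bsub>H.B\<^esub> (s \<otimes>\<^bsub>H.B\<^esub> r) \<in> derived H.B H.F"
        using derived_conj_closed[OF F(2) \<beta>(2)] sr subgroup.m_closed[OF sub] by blast
      moreover have "(s \<otimes>\<^bsub>H.B\<^esub> (\<beta> \<otimes>\<^bsub>H.B\<^esub> \<mu>) \<otimes>\<^bsub>H.B\<^esub> inv\<^bsub>H.B\<^esub> s) \<otimes>\<^bsub>H.B\<^esub> (s \<otimes>\<^bsub>H.B\<^esub> r) =
          s \<otimes>\<^bsub>H.B\<^esub> (\<beta> \<otimes>\<^bsub>H.B\<^esub> \<mu>) \<otimes>\<^bsub>H.B\<^esub> (inv\<^bsub>H.B\<^esub> s \<otimes>\<^bsub>H.B\<^esub> s) \<otimes>\<^bsub>H.B\<^esub> r"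
        using C by (simp only: G.B.m_assoc G.B.m_closed G.B.inv_closed)
      moreover have "\<dots> = (s \<otimes>\<^bsub>H.B\<^esub> \<beta>) \<otimes>\<^bsub>H.B\<^esub> (\<mu> \<otimes>\<^bsub>H.B\<^esub> r)" using C by (simp add: G.B.m_assoc)
      ultimately have "(s \<otimes>\<^bsub>H.B\<^esub> \<beta>) \<otimes>\<^bsub>H.B\<^esub> (\<mu> \<otimes>\<^bsub>H.B\<^esub> r) \<in> derived H.B H.F" by simp
      moreover have "s \<otimes>\<^bsub>H.B\<^esub> \<beta> \<in> G.F" "\<mu> \<otimes>\<^bsub>H.B\<^esub> r \<in> H.F" using F \<beta> \<mu> G.F_mult H.F_mult by auto
      ultimately show ?thesis unfolding P_def using E \<mu>r by blast
    qed
    then show "\<exists>N. clopenin T N \<and> x \<in> N \<and> (\<forall>D. clopenin T D \<longrightarrow> P D \<longrightarrow> P (D \<union> N))" using N by blast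
  qed
  then obtain D' \<mu> \<beta> where D': "clopenin T D'" "X \<subseteq> D'" and \<mu>: "\<mu> \<in> H.F"
    "\<And>y. y\<in>X \<Longrightarrow> \<mu> y = (if y \<in> D' then lam y else y)" and \<beta>: "\<beta> \<in> G.F" "\<beta> \<otimes>\<^bsub>H.B\<^esub> \<mu> \<in> derived H.B H.F"
    unfolding P_def by blast
  have "\<mu> = \<Lambda>" by (rule H.F_eqI[OF \<mu>(1) \<Lambda>_F]) (use \<mu>(2) D' in auto)
  then show ?thesis using \<beta> by blast
qed

theorem derived_subset_of_mixed:
  assumes K: "subgroup K H.B" "K \<subseteq> H.F" "derived H.B G.F \<subseteq> K"
    and \<alpha>: "\<alpha> \<in> K" "\<alpha> \<notin> G.F" "\<alpha> \<otimes>\<^bsub>H.B\<^esub> \<Lambda> \<notin> G.F"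
    and "H.pinf \<or> H.afin"
  shows "derived H.B H.F \<subseteq> K"
proof -
  interpret over_derived T LG lam K
    using K graded_germs_axioms by (simp add: over_derived_def over_derived_axioms_def)
  show ?thesis using alt_subset_of_mixed[OF \<alpha>] H.derived_subset_alt[OF assms(7)] by blast
qed

end

section \<open>Cantor spaces and effective ample groupoids\<close>

lemma cantor_clopen_base:
  fixes U :: "(nat \<Rightarrow> bool) set"
  defines "C \<equiv> product_topology (\<lambda>_::nat. discrete_topology (UNIV :: bool set)) UNIV"
  assumes "openin C U" "f \<in> U"
  shows "\<exists>N. clopenin C N \<and> f \<in> N \<and> N \<subseteq> U"
proof -
  obtain V where V: "finite {i. V i \<noteq> (UNIV :: bool set)}" "f \<in> Pi\<^sub>E UNIV V" "Pi\<^sub>E UNIV V \<subseteq> U"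
    using assms(2,3) unfolding C_def openin_product_topology_alt by auto
  have "openin C (Pi\<^sub>E UNIV V)" unfolding C_def openin_PiE_gen using V(1) by simp
  moreover have "closedin C (Pi\<^sub>E UNIV V)" unfolding C_def closedin_product_topology by simp
  ultimately show ?thesis using V by (auto simp: clopenin_def)
qed

lemma cantor_perfect:
  "\<not> openin (product_topology (\<lambda>_::nat. discrete_topology (UNIV :: bool set)) UNIV) {f}"
proof
  assume "openin (product_topology (\<lambda>_::nat. discrete_topology (UNIV :: bool set)) UNIV) {f}"
  then obtain V where V: "finite {i. V i \<noteq> (UNIV :: bool set)}" "f \<in> Pi\<^sub>E UNIV V" "Pi\<^sub>E UNIV V \<subseteq> {f}"
    unfolding openin_product_topology_alt by auto
  obtain j where j: "j \<notin> {i. V i \<noteq> UNIV}" using ex_new_if_finite[OF infinite_UNIV_nat V(1)] by blast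
  \<comment> \<open>Changing a coordinate that V leaves unrestricted stays inside the basic open
    set, so that set is not a singleton.\<close>
  have "f(j := \<not> f j) \<in> Pi\<^sub>E UNIV V" using V(2) j by (auto simp: PiE_iff)
  then have "f(j := \<not> f j) = f" using V(3) by blast
  then show False by (metis fun_upd_same)
qed

lemma cantor_spaceD:
  assumes "cantor_space T"
  shows "compact_space T" "Hausdorff_space T"
    "openin T U \<Longrightarrow> x \<in> U \<Longrightarrow> \<exists>N. clopenin T N \<and> x \<in> N \<and> N \<subseteq> U"
    "\<not> openin T {x}" "topspace T \<noteq> {}"
proof -
  define C where "C = product_topology (\<lambda>_::nat. discrete_topology (UNIV :: bool set)) UNIV"
  have hs: "T homeomorphic_space C" using assms by (simp add: cantor_space_def C_def)
  have "compact_space C" unfolding C_def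
    by (simp add: compact_space_product_topology compact_space_discrete_topology)
  then show "compact_space T" using homeomorphic_compact_space[OF hs] by blast
  have "Hausdorff_space C" unfolding C_def by (simp add: Hausdorff_space_product_topology)
  then show "Hausdorff_space T" using homeomorphic_Hausdorff_space[OF hs] by blast
  obtain h where h: "homeomorphic_map T C h" using hs homeomorphic_space by blast
  have inj: "inj_on h (topspace T)" and cont: "continuous_map T C h" and surj: "h ` topspace T = topspace C"
    using h unfolding homeomorphic_eq_everything_map by auto
  have op: "openin C (h ` U)" if "openin T U" for U
    using homeomorphic_imp_open_map[OF h] that by (simp add: open_map_def)
  show "topspace T \<noteq> {}" using surj by (auto simp: C_def)
  show "\<not> openin T {x}"
  proof
    assume "openin T {x}"
    then have "openin C {h x}" using op by fastforce
    then show False using cantor_perfect[of "h x"] by (simp add: C_def)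
  qed
  show "\<exists>N. clopenin T N \<and> x \<in> N \<and> N \<subseteq> U" if U: "openin T U" "x \<in> U"
  proof -
    have "openin C (h ` U)" "h x \<in> h ` U" using op U by auto
    from cantor_clopen_base[OF this[unfolded C_def]] obtain N where N: "clopenin C N" "h x \<in> N" "N \<subseteq> h ` U"
      by (auto simp: C_def)
    let ?N = "{y \<in> topspace T. h y \<in> N}"
    have UX: "U \<subseteq> topspace T" using U openin_subset by blast
    have "clopenin T ?N" unfolding clopenin_def
      using N(1) openin_continuous_map_preimage[OF cont] closedin_continuous_map_preimage[OF cont] by (simp add: clopenin_def)
    moreover have "?N \<subseteq> U"
    proof
      fix y assume y: "y \<in> ?N"
      then obtain u where "u \<in> U" "h y = h u" using N(3) by blast
      then show "y \<in> U" using y UX inj by (metis (mono_tags, lifting) inj_onD mem_Collect_eq subsetD)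
    qed
    ultimately show ?thesis using N(2) U(2) UX by blast
  qed
qed

section \<open>Algebra of arrows in a groupoid\<close>

locale grpd =
  fixes G :: "'g tgroupoid"
  assumes G: "groupoid G"
begin

lemma inv_closed: "g \<in> arrows G \<Longrightarrow> ginv G g \<in> arrows G"
  and inv_inv: "g \<in> arrows G \<Longrightarrow> ginv G (ginv G g) = g"
  using G by (auto simp: groupoid_def)

lemma src_inv: "g \<in> arrows G \<Longrightarrow> src G (ginv G g) = rng G g"
  and rng_inv: "g \<in> arrows G \<Longrightarrow> rng G (ginv G g) = src G g"
  by (auto simp: src_def rng_def inv_inv)

lemma comp:
  assumes "g \<in> arrows G" "h \<in> arrows G" "src G g = rng G h"
  shows "gmult G g h \<in> arrows G" "src G (gmult G g h) = src G h" "rng G (gmult G g h) = rng G g"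
    "gmult G (ginv G g) (gmult G g h) = h" "gmult G (gmult G g h) (ginv G h) = g"
proof -
  have "(g, h) \<in> composable G" using assms by (simp add: composable_def)
  then show "gmult G g h \<in> arrows G" "src G (gmult G g h) = src G h" "rng G (gmult G g h) = rng G g"
    "gmult G (ginv G g) (gmult G g h) = h" "gmult G (gmult G g h) (ginv G h) = g"
    using G unfolding groupoid_def by fastforce+
qed

lemma comp_inv_left: "v \<in> arrows G \<Longrightarrow> k \<in> arrows G \<Longrightarrow> rng G v = rng G k \<Longrightarrow>
    gmult G v (gmult G (ginv G v) k) = k"
  using comp(4)[of "ginv G v" k] by (simp add: inv_closed src_inv inv_inv)

lemma src_closed: "g \<in> arrows G \<Longrightarrow> src G g \<in> arrows G"
  and src_src: "g \<in> arrows G \<Longrightarrow> src G (src G g) = src G g"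
  and rng_src: "g \<in> arrows G \<Longrightarrow> rng G (src G g) = src G g"
  using groupoid_src_closed[OF G] by auto

lemma units_arrows: "x \<in> units G \<Longrightarrow> x \<in> arrows G"
  and units_src: "x \<in> units G \<Longrightarrow> src G x = x"
  and units_rng: "x \<in> units G \<Longrightarrow> rng G x = x"
  using src_closed src_src rng_src by (auto simp: units_def)

lemma src_units: "g \<in> arrows G \<Longrightarrow> src G g \<in> units G"
  by (simp add: units_def)

lemma rng_units: "g \<in> arrows G \<Longrightarrow> rng G g \<in> units G"
  using src_units[OF inv_closed] src_inv by simp

lemma mult_src: "g \<in> arrows G \<Longrightarrow> gmult G g (src G g) = g"
  using comp(4)[OF inv_closed _ src_inv, of g] by (simp add: inv_inv src_def)

lemma isotropy_eq:
  assumes "g \<in> arrows G" "h \<in> arrows G" "rng G g = rng G h" "gmult G (ginv G g) h \<in> units G"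
  shows "g = h"
proof -
  let ?k = "gmult G (ginv G g) h"
  have c: "src G (ginv G g) = rng G h" using assms src_inv by simp
  have "rng G ?k = src G g" using comp(3)[OF inv_closed[OF assms(1)] assms(2) c] rng_inv assms(1) by simp
  then have "?k = src G g" using units_rng[OF assms(4)] by simp
  then have "h = gmult G g (src G g)" using comp_inv_left[OF assms(1,2,3)] by simp
  then show ?thesis using mult_src[OF assms(1)] by simp
qed

end

text \<open>U need not be a bisection. Smaller ones are obtained from \<open>bisection_nbhd\<close>,
  and since arbitrary unions of open sets inducing f again induce f, there is a largest one;
  \<open>full_group_carrier\<close> relies on this.\<close>

definition germ :: "'g tgroupoid \<Rightarrow> ('g \<Rightarrow> 'g) \<Rightarrow> 'g \<Rightarrow> bool" where
  "germ G f x \<longleftrightarrow> (\<exists>U. openin (arr_top G) U \<and> x \<in> src G ` U \<and> (\<forall>h\<in>U. f (src G h) = rng G h))"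

lemma local_homeomorphism_continuous:
  assumes "local_homeomorphism A B f" shows "continuous_map A B f"
proof -
  have pt: "\<exists>U. openin A U \<and> x \<in> U \<and> openin B (f ` U) \<and> continuous_map (subtopology A U) B f" if "x \<in> topspace A" for x
  proof -
    obtain U where U: "openin A U" "x \<in> U" "openin B (f ` U)"
      "homeomorphic_map (subtopology A U) (subtopology B (f ` U)) f"
      using assms \<open>x \<in> topspace A\<close> unfolding local_homeomorphism_def by blast
    then show ?thesis
      using continuous_map_into_fulltopology[OF homeomorphic_imp_continuous_map[OF U(4)]] by blast
  qed
  show ?thesis unfolding continuous_map_def
  proof (intro conjI allI impI Pi_I)
    fix x assume "x \<in> topspace A"
    from pt[OF this] show "f x \<in> topspace B" using openin_subset by blast
  next
    fix V assume V: "openin B V"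
    show "openin A {x \<in> topspace A. f x \<in> V}"
    proof (subst openin_subopen, intro ballI)
      fix x assume x: "x \<in> {x \<in> topspace A. f x \<in> V}"
      then obtain U where U: "openin A U" "x \<in> U" "continuous_map (subtopology A U) B f" using pt by blast
      have "openin (subtopology A U) {y \<in> topspace (subtopology A U). f y \<in> V}"
        using openin_continuous_map_preimage[OF U(3) V] .
      then have "openin A {y \<in> topspace (subtopology A U). f y \<in> V}" using openin_trans_full U(1) by blast
      then show "\<exists>S. openin A S \<and> x \<in> S \<and> S \<subseteq> {x \<in> topspace A. f x \<in> V}"
        using x U by (intro exI[of _ "{y \<in> topspace (subtopology A U). f y \<in> V}"]) auto
    qed
  qed
qed

lemma local_homeomorphism_open:
  assumes "local_homeomorphism A B f" "openin A V" shows "openin B (f ` V)"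
proof (subst openin_subopen, intro ballI)
  fix y assume "y \<in> f ` V"
  then obtain x where x: "x \<in> V" "y = f x" by blast
  then have "x \<in> topspace A" using assms openin_subset by blast
  then obtain U where U: "openin A U" "x \<in> U" "openin B (f ` U)"
    "homeomorphic_map (subtopology A U) (subtopology B (f ` U)) f"
    using assms unfolding local_homeomorphism_def by blast
  have "openin (subtopology A U) (U \<inter> V)" using assms(2) by (simp add: openin_subtopology_Int2)
  then have "openin (subtopology B (f ` U)) (f ` (U \<inter> V))"
    using homeomorphic_imp_open_map[OF U(4)] by (simp add: open_map_def)
  then have "openin B (f ` (U \<inter> V))" using openin_trans_full U(3) by blast
  then show "\<exists>S. openin B S \<and> y \<in> S \<and> S \<subseteq> f ` V" using x U by (intro exI[of _ "f ` (U \<inter> V)"]) auto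
qed

section \<open>The germs and the full group of an effective ample groupoid\<close>

locale ample_effective = grpd G for G :: "'g tgroupoid" +
  assumes ample: "ample_groupoid G" and cantor: "cantor_space (unit_top G)"
    and effective: "effective_groupoid G"
begin

abbreviation "A \<equiv> arr_top G"
abbreviation "G0 \<equiv> units G"

lemma etale: "local_homeomorphism A (unit_top G) (rng G)" "Hausdorff_space A"
  and top_mult: "continuous_map (subtopology (prod_topology A A) (composable G)) A (\<lambda>(g, h). gmult G g h)"
  and top_inv: "continuous_map A A (ginv G)"
  using ample unfolding ample_groupoid_def etale_groupoid_def topological_groupoid_def by auto

lemma topspace_unit: "topspace (unit_top G) = G0"
  using units_arrows by (auto simp: unit_top_def arrows_def)

lemma open_arrows: "openin A U \<Longrightarrow> h \<in> U \<Longrightarrow> h \<in> arrows G"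
  using openin_subset by (auto simp: arrows_def)

lemma units_open: "openin A G0"
  using effective unfolding effective_groupoid_def by (metis openin_interior_of)

lemma isotropy_units:
  assumes "openin A U" "\<And>h. h \<in> U \<Longrightarrow> rng G h = src G h" shows "U \<subseteq> G0"
proof -
  have "U \<subseteq> {g \<in> arrows G. rng G g = src G g}" using assms open_arrows by blast
  from interior_of_maximal[OF this assms(1)] show ?thesis using effective by (simp add: effective_groupoid_def)
qed

lemma unit_open_iff: "openin (unit_top G) U \<longleftrightarrow> openin A U \<and> U \<subseteq> G0"
  unfolding unit_top_def using units_open openin_open_subtopology by blast

lemma inv_open: assumes "openin A U" shows "openin A (ginv G ` U)"
proof -
  have "ginv G ` U = {g \<in> topspace A. ginv G g \<in> U}"
  proof (intro subset_antisym subsetI)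
    fix y assume "y \<in> ginv G ` U"
    then obtain u where u: "u \<in> U" "y = ginv G u" by blast
    then have "u \<in> arrows G" using open_arrows assms by blast
    then show "y \<in> {g \<in> topspace A. ginv G g \<in> U}" using u inv_inv inv_closed by (auto simp: arrows_def)
  next
    fix y assume y: "y \<in> {g \<in> topspace A. ginv G g \<in> U}"
    then show "y \<in> ginv G ` U" using inv_inv[of y] by (metis (mono_tags, lifting) arrows_def image_eqI mem_Collect_eq)
  qed
  then show ?thesis using openin_continuous_map_preimage[OF top_inv assms] by simp
qed

lemma rng_open: "openin A U \<Longrightarrow> openin (unit_top G) (rng G ` U)"
  using local_homeomorphism_open[OF etale(1)] .

lemma rng_preimage: "openin (unit_top G) V \<Longrightarrow> openin A {g \<in> arrows G. rng G g \<in> V}"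
  using openin_continuous_map_preimage[OF local_homeomorphism_continuous[OF etale(1)]] by (simp add: arrows_def)

lemma src_open: assumes "openin A U" shows "openin (unit_top G) (src G ` U)"
proof -
  have "src G ` U = rng G ` ginv G ` U"
    unfolding image_image using open_arrows[OF assms] rng_inv by (intro image_cong) auto
  then show ?thesis using rng_open[OF inv_open[OF assms]] by simp
qed

lemma src_preimage: assumes "openin (unit_top G) V" shows "openin A {g \<in> arrows G. src G g \<in> V}"
proof -
  have "{g \<in> arrows G. src G g \<in> V} = ginv G ` {g \<in> arrows G. rng G g \<in> V}"
  proof (intro subset_antisym subsetI)
    fix g assume g: "g \<in> {g \<in> arrows G. src G g \<in> V}"
    then have "ginv G g \<in> {g \<in> arrows G. rng G g \<in> V}" "ginv G (ginv G g) = g"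
      using inv_closed rng_inv inv_inv by auto
    then show "g \<in> ginv G ` {g \<in> arrows G. rng G g \<in> V}" by (metis (no_types, lifting) image_eqI)
  qed (use inv_closed src_inv in auto)
  then show ?thesis using inv_open[OF rng_preimage[OF assms]] by simp
qed

lemma src_continuous: "continuous_map A (unit_top G) (src G)"
  using src_preimage src_units by (auto simp: continuous_map_def topspace_unit arrows_def)

lemma rng_section:
  assumes "g \<in> arrows G"
  shows "\<exists>V. openin A V \<and> g \<in> V \<and> inj_on (rng G) V"
proof -
  obtain V where V: "openin A V" "g \<in> V" "homeomorphic_map (subtopology A V) (subtopology (unit_top G) (rng G ` V)) (rng G)"
    using etale(1) assms unfolding local_homeomorphism_def arrows_def by blast
  have "topspace (subtopology A V) = V" using V(1) openin_subset by auto
  then show ?thesis using V homeomorphic_imp_injective_map by metis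
qed

lemma src_section:
  assumes "g \<in> arrows G"
  shows "\<exists>V. openin A V \<and> g \<in> V \<and> inj_on (src G) V"
proof -
  obtain V where V: "openin A V" "ginv G g \<in> V" "inj_on (rng G) V" using rng_section[OF inv_closed[OF assms]] by blast
  have "inj_on (src G) (ginv G ` V)"
    using V(3) open_arrows[OF V(1)] src_inv by (auto simp: inj_on_def)
  moreover have "g \<in> ginv G ` V" using V(2) inv_inv[OF assms] by force
  ultimately show ?thesis using inv_open[OF V(1)] by blast
qed

lemma bisection_nbhd:
  assumes "openin A U" "g \<in> U"
  shows "\<exists>V. openin A V \<and> g \<in> V \<and> V \<subseteq> U \<and> inj_on (src G) V \<and> inj_on (rng G) V"
proof -
  have "g \<in> arrows G" using assms open_arrows by blast
  then obtain V W where V: "openin A V" "g \<in> V" "inj_on (rng G) V" and W: "openin A W" "g \<in> W" "inj_on (src G) W"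
    using rng_section src_section by blast
  show ?thesis using assms V W
    by (intro exI[of _ "U \<inter> V \<inter> W"]) (auto intro: inj_on_subset)
qed

lemma germ_at: assumes "g \<in> arrows G" shows "\<exists>f. germ G f (src G g) \<and> f (src G g) = rng G g"
proof -
  obtain U where U: "openin A U" "g \<in> U" "inj_on (src G) U" using src_section[OF assms] by blast
  show ?thesis
    by (rule exI[of _ "\<lambda>y. rng G (inv_into U (src G) y)"]) (use U in \<open>auto simp: germ_def\<close>)
qed

text \<open>Near a product v0 u0, a local section of the range map through v0 recovers a left factor
  from the range of k alone. The matching right factor depends continuously on k and so stays in
  U.\<close>

lemma mult_open:
  assumes V: "openin A V" and U: "openin A U"
  shows "openin A {gmult G v u |v u. v \<in> V \<and> u \<in> U \<and> src G v = rng G u}"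
proof (subst openin_subopen, intro ballI)
  fix k0 assume "k0 \<in> {gmult G v u |v u. v \<in> V \<and> u \<in> U \<and> src G v = rng G u}"
  then obtain v0 u0 where k0: "k0 = gmult G v0 u0" "v0 \<in> V" "u0 \<in> U" "src G v0 = rng G u0" by blast
  have a: "v0 \<in> arrows G" "u0 \<in> arrows G" using k0 open_arrows U V by auto
  obtain V' where V': "openin A V'" "v0 \<in> V'" "V' \<subseteq> V" "inj_on (rng G) V'"
    using bisection_nbhd[OF V k0(2)] by blast
  define R where "R = rng G ` V'"
  have R: "openin (unit_top G) R" using rng_open[OF V'(1)] by (simp add: R_def)
  define \<sigma> where "\<sigma> = inv_into V' (rng G)"
  define W where "W = {k \<in> arrows G. rng G k \<in> R}"
  have W: "openin A W" using rng_preimage[OF R] by (simp add: W_def)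
  have \<sigma>: "\<sigma> y \<in> V'" "rng G (\<sigma> y) = y" if "y \<in> R" for y
    using that inv_into_into[of y "rng G" V'] f_inv_into_f[of y "rng G" V'] by (auto simp: R_def \<sigma>_def)
  have \<sigma>a: "\<sigma> y \<in> arrows G" if "y \<in> R" for y using \<sigma>(1)[OF that] open_arrows[OF V'(1)] by blast
  have \<sigma>c: "continuous_map (subtopology A W) A (\<lambda>k. \<sigma> (rng G k))"
    unfolding continuous_map_def
  proof (intro conjI allI impI Pi_I)
    fix k assume "k \<in> topspace (subtopology A W)"
    then show "\<sigma> (rng G k) \<in> topspace A" using \<sigma>a by (simp add: W_def arrows_def)
  next
    fix B assume B: "openin A B"
    have "{k \<in> topspace (subtopology A W). \<sigma> (rng G k) \<in> B} = W \<inter> {k \<in> arrows G. rng G k \<in> rng G ` (V' \<inter> B)}"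
    proof (intro subset_antisym subsetI)
      fix k assume k: "k \<in> {k \<in> topspace (subtopology A W). \<sigma> (rng G k) \<in> B}"
      then have "k \<in> W" by simp
      then have kR: "rng G k \<in> R" "k \<in> arrows G" by (auto simp: W_def)
      have "\<sigma> (rng G k) \<in> V' \<inter> B" "rng G (\<sigma> (rng G k)) = rng G k" using \<sigma> kR k by auto
      then have "rng G k \<in> rng G ` (V' \<inter> B)" by (metis image_eqI)
      then show "k \<in> W \<inter> {k \<in> arrows G. rng G k \<in> rng G ` (V' \<inter> B)}" using \<open>k \<in> W\<close> kR by blast
    next
      fix k assume k: "k \<in> W \<inter> {k \<in> arrows G. rng G k \<in> rng G ` (V' \<inter> B)}"
      then obtain v where v: "v \<in> V' \<inter> B" "rng G k = rng G v" by blast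
      then have "\<sigma> (rng G k) = v" using V'(4) by (simp add: \<sigma>_def)
      then show "k \<in> {k \<in> topspace (subtopology A W). \<sigma> (rng G k) \<in> B}" using v k by (auto simp: arrows_def)
    qed
    moreover have "openin A (W \<inter> {k \<in> arrows G. rng G k \<in> rng G ` (V' \<inter> B)})"
      using W rng_preimage rng_open V'(1) B by (simp add: openin_Int)
    ultimately show "openin (subtopology A W) {k \<in> topspace (subtopology A W). \<sigma> (rng G k) \<in> B}"
      using W by (simp add: openin_open_subtopology)
  qed
  define \<psi> where "\<psi> k = gmult G (ginv G (\<sigma> (rng G k))) k" for k
  have \<psi>c: "continuous_map (subtopology A W) A \<psi>"
  proof -
    have "continuous_map (subtopology A W) (subtopology (prod_topology A A) (composable G)) (\<lambda>k. (ginv G (\<sigma> (rng G k)), k))"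
    proof (rule continuous_map_into_subtopology)
      show "continuous_map (subtopology A W) (prod_topology A A) (\<lambda>k. (ginv G (\<sigma> (rng G k)), k))"
      proof (rule continuous_map_pairedI)
        show "continuous_map (subtopology A W) A (\<lambda>k. ginv G (\<sigma> (rng G k)))"
          using continuous_map_compose[OF \<sigma>c top_inv] by (simp add: comp_def)
        show "continuous_map (subtopology A W) A (\<lambda>k. k)"
          using continuous_map_from_subtopology[OF continuous_map_id, of A W] by (simp add: id_def)
      qed
      show "(\<lambda>k. (ginv G (\<sigma> (rng G k)), k)) \<in> topspace (subtopology A W) \<rightarrow> composable G"
        using \<sigma> \<sigma>a inv_closed src_inv by (auto simp: composable_def W_def)
    qed
    from continuous_map_compose[OF this top_mult] show ?thesis by (simp add: comp_def \<psi>_def[abs_def])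
  qed
  define S where "S = {k \<in> topspace (subtopology A W). \<psi> k \<in> U}"
  have "openin (subtopology A W) S" unfolding S_def using openin_continuous_map_preimage[OF \<psi>c U] .
  then have S: "openin A S" using openin_trans_full W by blast
  have "k0 \<in> S"
  proof -
    have r: "rng G k0 = rng G v0" "k0 \<in> arrows G" using comp(1,3)[OF a k0(4)] k0(1) by auto
    then have "k0 \<in> W" using V'(2) by (simp add: W_def R_def)
    moreover have "\<sigma> (rng G k0) = v0" using r V' by (simp add: \<sigma>_def)
    then have "\<psi> k0 = u0" using comp(4)[OF a k0(4)] k0(1) by (simp add: \<psi>_def)
    ultimately show ?thesis using k0(3) r by (simp add: S_def arrows_def)
  qed
  moreover have "S \<subseteq> {gmult G v u |v u. v \<in> V \<and> u \<in> U \<and> src G v = rng G u}"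
  proof
    fix k assume "k \<in> S"
    then have k: "k \<in> arrows G" "rng G k \<in> R" "\<psi> k \<in> U" by (auto simp: S_def W_def)
    let ?v = "\<sigma> (rng G k)"
    have v: "?v \<in> V" "?v \<in> arrows G" "rng G ?v = rng G k" using \<sigma> \<sigma>a k V'(3) by auto
    have "k = gmult G ?v (\<psi> k)" using comp_inv_left[OF v(2) k(1) v(3)] by (simp add: \<psi>_def)
    moreover have "src G ?v = rng G (\<psi> k)"
      unfolding \<psi>_def using comp(3)[OF inv_closed[OF v(2)] k(1)] v src_inv rng_inv by simp
    ultimately show "k \<in> {gmult G v u |v u. v \<in> V \<and> u \<in> U \<and> src G v = rng G u}" using v(1) k(3) by blast
  qed
  ultimately show "\<exists>S. openin A S \<and> k0 \<in> S \<and> S \<subseteq> {gmult G v u |v u. v \<in> V \<and> u \<in> U \<and> src G v = rng G u}"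
    using S by blast
qed

lemma germs: "germs (unit_top G) (germ G)"
proof
  show "compact_space (unit_top G)" "Hausdorff_space (unit_top G)" "\<not> openin (unit_top G) {x}" for x
    using cantor_spaceD[OF cantor] by auto
  show "\<exists>N. clopenin (unit_top G) N \<and> x \<in> N \<and> N \<subseteq> U" if "openin (unit_top G) U" "x \<in> U" for U x
    using cantor_spaceD(3)[OF cantor] that .
  show "germ G g x" if f: "germ G f x" and N: "openin (unit_top G) N" "x \<in> N" "\<And>y. y \<in> N \<Longrightarrow> g y = f y" for f g x N
  proof -
    obtain U where U: "openin A U" "x \<in> src G ` U" "\<And>h. h\<in>U \<Longrightarrow> f (src G h) = rng G h"
      using f unfolding germ_def by blast
    let ?U = "U \<inter> {g \<in> arrows G. src G g \<in> N}"
    have "openin A ?U" using U(1) src_preimage[OF N(1)] by blast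
    moreover have "x \<in> src G ` ?U" using U(1,2) N(2) open_arrows by auto
    ultimately show ?thesis unfolding germ_def using U(3) N(3) by (intro exI[of _ ?U]) auto
  qed
  show "germ G (\<lambda>y. y) x" if "x \<in> topspace (unit_top G)" for x
    unfolding germ_def using units_open that units_src units_rng
    by (intro exI[of _ G0]) (auto simp: topspace_unit image_iff)
  show "germ G (\<lambda>y. g (f y)) x" if f: "germ G f x" and g: "germ G g (f x)" for f g x
  proof -
    obtain U where U: "openin A U" "x \<in> src G ` U" "\<And>h. h\<in>U \<Longrightarrow> f (src G h) = rng G h"
      using f unfolding germ_def by blast
    obtain V where V: "openin A V" "f x \<in> src G ` V" "\<And>h. h\<in>V \<Longrightarrow> g (src G h) = rng G h"
      using g unfolding germ_def by blast
    let ?W = "{gmult G v u |v u. v \<in> V \<and> u \<in> U \<and> src G v = rng G u}"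
    obtain u v where uv: "u \<in> U" "src G u = x" "v \<in> V" "src G v = f x" using U(2) V(2) by (metis imageE)
    then have c: "src G v = rng G u" using U(3) by metis
    have "x \<in> src G ` ?W"
    proof (rule image_eqI)
      show "gmult G v u \<in> ?W" using uv c by blast
      show "x = src G (gmult G v u)" using comp(2)[of v u] c uv open_arrows U(1) V(1) by metis
    qed
    moreover have "g (f (src G h)) = rng G h" if hW: "h \<in> ?W" for h
    proof -
      obtain v u where h: "h = gmult G v u" "v \<in> V" "u \<in> U" "src G v = rng G u" using hW by blast
      then have "v \<in> arrows G" "u \<in> arrows G" using open_arrows U(1) V(1) by auto
      then show ?thesis using comp(2,3)[of v u] h U(3)[OF h(3)] V(3)[OF h(2)] by simp
    qed
    ultimately show ?thesis unfolding germ_def using mult_open[OF V(1) U(1)] by blast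
  qed
  show "\<exists>N. openin (unit_top G) N \<and> x \<in> N \<and> f ` N \<subseteq> B" if f: "germ G f x" and B: "openin (unit_top G) B" "f x \<in> B" for f x B
  proof -
    obtain U where U: "openin A U" "x \<in> src G ` U" "\<And>h. h\<in>U \<Longrightarrow> f (src G h) = rng G h"
      using f unfolding germ_def by blast
    let ?U = "U \<inter> {g \<in> arrows G. rng G g \<in> B}"
    have "openin A ?U" using U(1) rng_preimage[OF B(1)] by blast
    moreover have "x \<in> src G ` ?U" using U B(2) open_arrows by fastforce
    moreover have "f ` src G ` ?U \<subseteq> B" using U(3) by auto
    ultimately show ?thesis using src_open by blast
  qed
  show "\<exists>N N' g. openin (unit_top G) N \<and> openin (unit_top G) N' \<and> x \<in> N \<and> f ` N = N' \<and>
      (\<forall>y\<in>N. germ G f y \<and> germ G g (f y) \<and> g (f y) = y)" if f: "germ G f x" for f x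
  proof -
    obtain U0 where U0: "openin A U0" "x \<in> src G ` U0" "\<And>h. h\<in>U0 \<Longrightarrow> f (src G h) = rng G h"
      using f unfolding germ_def by blast
    then obtain u where u: "u \<in> U0" "x = src G u" by blast
    obtain U where U: "openin A U" "u \<in> U" "U \<subseteq> U0" "inj_on (src G) U" "inj_on (rng G) U"
      using bisection_nbhd[OF U0(1) u(1)] by blast
    have fU: "f (src G h) = rng G h" if "h \<in> U" for h using that U U0 by blast
    define g where "g = (\<lambda>y. src G (inv_into U (rng G) y))"
    have g: "g (rng G h) = src G h" if "h \<in> U" for h using that U(5) by (simp add: g_def)
    show ?thesis
    proof (intro exI conjI ballI)
      show "openin (unit_top G) (src G ` U)" "openin (unit_top G) (rng G ` U)" using src_open rng_open U by auto
      show "x \<in> src G ` U" using u U by blast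
      show "f ` src G ` U = rng G ` U" unfolding image_image using fU by auto
      fix y assume "y \<in> src G ` U"
      then obtain h where h: "h \<in> U" "y = src G h" by blast
      show "germ G f y" unfolding germ_def using U(1) fU h by blast
      show "g (f y) = y" using h fU g by simp
      show "germ G g (f y)" unfolding germ_def
      proof (intro exI conjI ballI)
        show "openin A (ginv G ` U)" using inv_open U(1) .
        show "f y \<in> src G ` ginv G ` U" using h fU src_inv[OF open_arrows[OF U(1) h(1)]] by (metis image_eqI)
        fix k assume "k \<in> ginv G ` U"
        then obtain w where w: "w \<in> U" "k = ginv G w" by blast
        then show "g (src G k) = rng G k" using g src_inv rng_inv open_arrows[OF U(1)] by simp
      qed
    qed
  qed
qed

lemma minimal_germs:
  assumes "minimal_groupoid G" shows "minimal_germs (unit_top G) (germ G)"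
proof -
  interpret P: germs "unit_top G" "germ G" by (rule germs)
  show ?thesis
  proof unfold_locales
    fix x U assume x: "x \<in> topspace (unit_top G)" and U: "openin (unit_top G) U" "U \<noteq> {}"
    obtain u where u: "u \<in> U" using U by blast
    have uX: "u \<in> G0" using U u openin_subset topspace_unit by blast
    have "u \<in> unit_top G closure_of (rng G ` {g \<in> arrows G. src G g = x})"
      using assms x uX unfolding minimal_groupoid_def topspace_unit by blast
    then obtain g where g: "g \<in> arrows G" "src G g = x" "rng G g \<in> U"
      unfolding in_closure_of using U(1) u by blast
    then show "\<exists>f. germ G f x \<and> f x \<in> U" using germ_at by metis
  qed
qed

text \<open>Effectiveness makes the union of all open sets of arrows inducing a given homeomorphism a
  bisection.\<close>

lemma same_map_bisection:
  assumes U: "openin A U" and f: "\<And>h. h \<in> U \<Longrightarrow> f (src G h) = rng G h" "inj_on f G0"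
  shows "inj_on (src G) U" "inj_on (rng G) U"
proof -
  have eq: "g = h" if gh: "g \<in> U" "h \<in> U" "rng G g = rng G h" for g h
  proof (rule isotropy_eq)
    show a: "g \<in> arrows G" "h \<in> arrows G" using gh open_arrows U by auto
    show "rng G g = rng G h" by fact
    let ?W = "{gmult G v u |v u. v \<in> ginv G ` U \<and> u \<in> U \<and> src G v = rng G u}"
    \<comment> \<open>For w and u in U with equal ranges, injectivity of f on the units gives equal
      sources, so each product w^{-1} u is isotropy. These products form an open set, and
      effectiveness puts it inside the units.\<close>
    have "?W \<subseteq> G0"
    proof (rule isotropy_units[OF mult_open[OF inv_open[OF U] U]])
      fix k assume "k \<in> ?W"
      then obtain w u where k: "k = gmult G (ginv G w) u" "w \<in> U" "u \<in> U" "src G (ginv G w) = rng G u" by blast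
      have wu: "w \<in> arrows G" "u \<in> arrows G" using k open_arrows U by auto
      then have "rng G w = rng G u" using k src_inv by simp
      then have "f (src G w) = f (src G u)" using f(1) k by simp
      then have "src G w = src G u" using f(2) src_units wu by (simp add: inj_on_def)
      then show "rng G k = src G k" using comp(2,3)[OF inv_closed[OF wu(1)] wu(2) k(4)] k(1) rng_inv wu by simp
    qed
    moreover have "gmult G (ginv G g) h \<in> ?W" using gh src_inv a by fastforce
    ultimately show "gmult G (ginv G g) h \<in> G0" by blast
  qed
  then show "inj_on (rng G) U" by (auto simp: inj_on_def)
  show "inj_on (src G) U" using eq f(1) by (metis inj_onI)
qed

text \<open>The source map is a homeomorphism from U onto a closed subset of the compact unit
  space.\<close>

lemma compact_of_closed_image:
  assumes U: "openin A U" "inj_on (src G) U" and C: "closedin (unit_top G) (src G ` U)"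
  shows "compactin A U"
proof -
  have UA: "U \<subseteq> topspace A" using U openin_subset by blast
  have "homeomorphic_map (subtopology A U) (subtopology (unit_top G) (src G ` U)) (src G)"
  proof (rule bijective_open_imp_homeomorphic_map)
    show "continuous_map (subtopology A U) (subtopology (unit_top G) (src G ` U)) (src G)"
      by (rule continuous_map_into_subtopology[OF continuous_map_from_subtopology[OF src_continuous]]) auto
    show "open_map (subtopology A U) (subtopology (unit_top G) (src G ` U)) (src G)"
      unfolding open_map_def using U(1) src_open
      by (auto simp: openin_open_subtopology)
    show "src G ` topspace (subtopology A U) = topspace (subtopology (unit_top G) (src G ` U))"
      using UA closedin_subset[OF C] by auto
    show "inj_on (src G) (topspace (subtopology A U))" using U(2) by (auto intro: inj_on_subset)
  qed
  then have hs: "subtopology A U homeomorphic_space subtopology (unit_top G) (src G ` U)"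
    using homeomorphic_map_imp_homeomorphic_space by blast
  have "compact_space (subtopology (unit_top G) (src G ` U))"
    using closedin_compact_space[OF cantor_spaceD(1)[OF cantor] C] compact_space_subtopology by blast
  then have "compact_space (subtopology A U)" using homeomorphic_compact_space[OF hs] by blast
  then show ?thesis using UA by (simp add: compactin_subspace)
qed

text \<open>Conversely to reading off germs from a full bisection, the bisection of \<alpha> is the
  largest open set of arrows inducing \<alpha>. Its source is the whole unit space because \<alpha>
  has a germ everywhere, and this makes it compact.\<close>

lemma full_group_carrier: "carrier (full_group G) = germs.F (unit_top G) (germ G)"
proof -
  interpret P: germs "unit_top G" "germ G" by (rule germs)
  show ?thesis
  proof (intro subset_antisym subsetI)
    fix \<alpha> assume "\<alpha> \<in> carrier (full_group G)"
    then obtain U where U: "full_bisection G U" "\<alpha> = bisection_map G U" by (auto simp: full_group_def)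
    have b: "openin A U" "inj_on (src G) U" "inj_on (rng G) U" "src G ` U = units G" "rng G ` U = units G"
      using U by (auto simp: full_bisection_def compact_open_bisection_def bisection_def)
    have a: "\<alpha> (src G h) = rng G h" if "h \<in> U" for h
      using that b U(2) by (auto simp: bisection_map_def)
    have "inj_on \<alpha> (units G)"
    proof (rule inj_onI)
      fix x y assume "x \<in> units G" "y \<in> units G" "\<alpha> x = \<alpha> y"
      then show "x = y" using a b(3,4) by (metis (no_types, lifting) imageE inj_onD)
    qed
    moreover have "\<alpha> ` units G = units G"
    proof -
      have "\<alpha> ` src G ` U = rng G ` U" unfolding image_image using a by (intro image_cong) auto
      then show ?thesis using b(4,5) by simp
    qed
    moreover have "\<alpha> \<in> extensional (units G)" using U by (simp add: bisection_map_def)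
    ultimately have "\<alpha> \<in> Bij (topspace (unit_top G))" by (simp add: Bij_def bij_betw_def topspace_unit)
    moreover have "germ G \<alpha> x" if "x \<in> units G" for x
      unfolding germ_def using b(1,4) a that by (intro exI[of _ U]) simp
    ultimately show "\<alpha> \<in> P.F" by (simp add: P.F_def topspace_unit)
  next
    fix \<alpha> assume "\<alpha> \<in> P.F"
    then have bij: "\<alpha> \<in> Bij (units G)" and L: "\<And>x. x \<in> units G \<Longrightarrow> germ G \<alpha> x" by (auto simp: P.F_def topspace_unit)
    define U where "U = \<Union>{U. openin A U \<and> (\<forall>h\<in>U. \<alpha> (src G h) = rng G h)}"
    have U: "openin A U" "\<And>h. h \<in> U \<Longrightarrow> \<alpha> (src G h) = rng G h" unfolding U_def by auto
    have inj: "inj_on (src G) U" "inj_on (rng G) U"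
      using same_map_bisection[OF U] bij by (auto simp: Bij_def bij_betw_def)
    have sU: "src G ` U = units G"
    proof (intro subset_antisym subsetI)
      show "x \<in> units G" if "x \<in> src G ` U" for x using that open_arrows[OF U(1)] src_units by blast
      fix x assume "x \<in> units G"
      from L[OF this] show "x \<in> src G ` U" unfolding germ_def U_def by blast
    qed
    have "rng G ` U = \<alpha> ` src G ` U" unfolding image_image using U(2) by auto
    then have rU: "rng G ` U = units G" using sU bij by (simp add: Bij_def bij_betw_def)
    have "compactin A U" using compact_of_closed_image[OF U(1) inj(1)] sU topspace_unit by (metis closedin_topspace)
    then have "full_bisection G U" using U inj sU rU open_arrows
      by (auto simp: full_bisection_def compact_open_bisection_def bisection_def)
    moreover have "\<alpha> = bisection_map G U"
    proof (rule extensionalityI)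
      show "\<alpha> \<in> extensional (units G)" using bij by (simp add: Bij_def)
      show "bisection_map G U \<in> extensional (units G)" by (simp add: bisection_map_def)
      fix x assume x: "x \<in> units G"
      then obtain h where h: "h \<in> U" "x = src G h" using sU by blast
      then show "\<alpha> x = bisection_map G U x" using x U(2)[OF h(1)] inj(1) by (simp add: bisection_map_def)
    qed
    ultimately show "\<alpha> \<in> carrier (full_group G)" by (auto simp: full_group_def)
  qed
qed

end

section \<open>Semidirect products with the group of order two\<close>

lemma (in grpd) assoc:
  assumes "g \<in> arrows G" "h \<in> arrows G" "k \<in> arrows G" "src G g = rng G h" "src G h = rng G k"
  shows "gmult G (gmult G g h) k = gmult G g (gmult G h k)"
  using G assms unfolding groupoid_def composable_def by auto

lemma Z2_simps: "carrier Z2 = {0, 1}" "\<one>\<^bsub>Z2\<^esub> = 0" "x \<otimes>\<^bsub>Z2\<^esub> y = (x + y) mod 2" "inv\<^bsub>Z2\<^esub> 0 = 0" "inv\<^bsub>Z2\<^esub> 1 = 1"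
proof -
  show c: "carrier Z2 = {0, 1}" by (auto simp: carrier_integer_mod_group)
  show o: "\<one>\<^bsub>Z2\<^esub> = 0" by simp
  show m: "x \<otimes>\<^bsub>Z2\<^esub> y = (x + y) mod 2" for x y by simp
  have Z: "group Z2" by simp
  show "inv\<^bsub>Z2\<^esub> 0 = 0" "inv\<^bsub>Z2\<^esub> 1 = 1"
    by (rule group.inv_equality[OF Z]; use c in simp)+
qed

locale semidirect_Z2 = ample_effective G for G :: "'g tgroupoid" +
  fixes lam :: "int \<Rightarrow> 'g \<Rightarrow> 'g" and H :: "('g \<times> int) tgroupoid"
  assumes action: "Z2_action G lam" and free: "free_on_units G lam"
    and H_eq: "H = semidirect G lam"
    and effective_H: "effective_groupoid H" and minimal: "minimal_groupoid G"
begin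

definition "l = lam 1"

lemma l_aut: "groupoid_automorphism G l"
  using action by (auto simp: Z2_action_def Z2_simps l_def)

lemma lam0: "g \<in> arrows G \<Longrightarrow> lam 0 g = g"
  using Z2_action_one[OF action] by (simp add: Z2_simps)

lemma l_homeo: "homeomorphic_map A A l"
  using l_aut by (simp add: groupoid_automorphism_def)

lemma l_closed: "g \<in> arrows G \<Longrightarrow> l g \<in> arrows G"
  using homeomorphic_imp_surjective_map[OF l_homeo] by (auto simp: arrows_def)

lemma l_l: "g \<in> arrows G \<Longrightarrow> l (l g) = g"
  using Z2_action_mult[OF action, of g 1 1] lam0 by (simp add: Z2_simps l_def)

lemma l_comp:
  assumes "g \<in> arrows G" "h \<in> arrows G" "src G g = rng G h"
  shows "src G (l g) = rng G (l h)" "l (gmult G g h) = gmult G (l g) (l h)"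
  using l_aut assms unfolding groupoid_automorphism_def composable_def by auto

lemma l_units: "x \<in> G0 \<Longrightarrow> l x \<in> G0"
  using groupoid_aut_units[OF action G, of 1] by (simp add: Z2_simps l_def)

lemma l_src: "g \<in> arrows G \<Longrightarrow> src G (l g) = l (src G g)"
  using l_comp(1)[of g "src G g"] src_closed rng_src units_rng[OF l_units[OF src_units]] by simp

lemma l_rng: "g \<in> arrows G \<Longrightarrow> rng G (l g) = l (rng G g)"
  using l_comp(1)[of "rng G g" g] units_arrows[OF rng_units] units_src[OF rng_units] units_src[OF l_units[OF rng_units]]
  by simp

lemma l_inv: assumes g: "g \<in> arrows G" shows "l (ginv G g) = ginv G (l g)"
proof -
  have i: "ginv G g \<in> arrows G" "src G g = rng G (ginv G g)" using g inv_closed rng_inv by auto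
  have lg: "l g \<in> arrows G" "l (ginv G g) \<in> arrows G" using g i l_closed by auto
  have "l (ginv G g) = gmult G (ginv G (l g)) (gmult G (l g) (l (ginv G g)))"
    using comp(4)[OF lg l_comp(1)[OF g i]] by simp
  also have "gmult G (l g) (l (ginv G g)) = src G (ginv G (l g))"
    using l_comp(2)[OF g i] l_rng[OF g] src_inv[OF lg(1)] by (simp add: rng_def)
  finally show ?thesis using mult_src[OF inv_closed[OF lg(1)]] by simp
qed

lemma H_simps:
  "arrows H = arrows G \<times> {0, 1}"
  "units H = G0 \<times> {0}"
  "g \<in> arrows G \<Longrightarrow> c \<in> {0, 1} \<Longrightarrow> rng H (g, c) = (rng G g, 0)"
  "g \<in> arrows G \<Longrightarrow> src H (g, 0) = (src G g, 0)"
  "g \<in> arrows G \<Longrightarrow> src H (g, 1) = (l (src G g), 0)"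
  "g \<in> arrows G \<Longrightarrow> ginv H (g, 0) = (ginv G g, 0)"
  "g \<in> arrows G \<Longrightarrow> ginv H (g, 1) = (ginv G (l g), 1)"
  "h \<in> arrows G \<Longrightarrow> gmult H (g, 0) (h, d) = (gmult G g h, d mod 2)"
  "gmult H (g, 1) (h, d) = (gmult G g (l h), (1 + d) mod 2)"
proof -
  show "arrows H = arrows G \<times> {0, 1}" "units H = G0 \<times> {0}"
    unfolding H_eq arrows_semidirect units_semidirect[OF G action] by (simp_all only: Z2_simps)
  show "rng H (g, c) = (rng G g, 0)" if "g \<in> arrows G" "c \<in> {0, 1}"
    using rng_semidirect[OF G action that(1), of c] that unfolding H_eq Z2_simps by blast
  show "src H (g, 0) = (src G g, 0)" "src H (g, 1) = (l (src G g), 0)" if g: "g \<in> arrows G"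
    using src_semidirect[OF G action g, of 0] src_semidirect[OF G action g, of 1] lam0[OF src_closed[OF g]]
    unfolding H_eq Z2_simps l_def by simp_all
  show "ginv H (g, 0) = (ginv G g, 0)" "ginv H (g, 1) = (ginv G (l g), 1)" if g: "g \<in> arrows G"
    using lam0[OF inv_closed[OF g]] l_inv[OF g] unfolding H_eq semidirect_def l_def by (simp_all add: Z2_simps del: inv_integer_mod_group)
  show "gmult H (g, 0) (h, d) = (gmult G g h, d mod 2)" if "h \<in> arrows G"
    using lam0[OF that] unfolding H_eq semidirect_def by simp
  show "gmult H (g, 1) (h, d) = (gmult G g (l h), (1 + d) mod 2)"
    unfolding H_eq semidirect_def l_def by simp
qed

lemma H_arrow_cases:
  assumes "k \<in> arrows H"
  obtains g where "k = (g, 0)" "g \<in> arrows G" | g where "k = (g, 1)" "g \<in> arrows G"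
  using assms H_simps(1) by auto

lemma groupoid_H: "groupoid H"
  unfolding groupoid_def
proof (intro conjI ballI allI impI)
  fix k assume k: "k \<in> arrows H"
  show "ginv H k \<in> arrows H"
    using k by (rule H_arrow_cases) (auto simp: H_simps inv_closed l_closed)
  show "ginv H (ginv H k) = k"
    using k by (rule H_arrow_cases) (auto simp: H_simps inv_closed l_closed inv_inv l_l simp flip: l_inv)
next
  fix p assume p: "p \<in> composable H"
  obtain k m where km: "p = (k, m)" by (cases p)
  have k: "k \<in> arrows H" "m \<in> arrows H" "src H k = rng H m" using p km by (auto simp: composable_def)
  obtain g c where g: "k = (g, c)" "g \<in> arrows G" "c = 0 \<or> c = 1" using k(1) H_simps(1) by auto
  obtain h d where h: "m = (h, d)" "h \<in> arrows G" "d = 0 \<or> d = 1" using k(2) H_simps(1) by auto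
  \<comment> \<open>The factor by which g is actually multiplied in G, twisted by l when the left
    arrow has degree one. With it each case is an identity in G.\<close>
  define h' where "h' = (if c = 0 then h else l h)"
  have h': "h' \<in> arrows G" using h(2) l_closed by (simp add: h'_def)
  have sr: "src G g = rng G h'"
    using k(3) g h l_l[OF src_closed[OF g(2)]] l_rng[OF h(2)] by (auto simp: h'_def H_simps)
  note cc = comp[OF g(2) h' sr]
  have lcc: "l (gmult G g h') = gmult G (l g) (l h')" using l_comp(2)[OF g(2) h' sr] .
  have lcc2: "gmult G (ginv G (l g)) (gmult G (l g) (l h')) = l h'"
     using comp(4)[OF l_closed[OF g(2)] l_closed[OF h'] l_comp(1)[OF g(2) h' sr]] .
  show "case p of (g, h) \<Rightarrow> gmult H g h \<in> arrows H \<and> src H (gmult H g h) = src H h \<and> rng H (gmult H g h) = rng H g \<and>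
        gmult H (ginv H g) (gmult H g h) = h \<and> gmult H (gmult H g h) (ginv H h) = g"
    using g(3) h(3) cc lcc lcc2 h'
    unfolding km g(1) h(1) h'_def
    by (elim disjE) (simp_all add: H_simps g(2) h(2) l_closed inv_closed l_src l_l src_closed l_inv)
next
  fix k m n assume kmn: "(k, m) \<in> composable H \<and> (m, n) \<in> composable H"
  have k: "k \<in> arrows H" "m \<in> arrows H" "n \<in> arrows H" "src H k = rng H m" "src H m = rng H n"
    using kmn by (auto simp: composable_def)
  obtain g c where g: "k = (g, c)" "g \<in> arrows G" "c = 0 \<or> c = 1" using k(1) H_simps(1) by auto
  obtain h d where h: "m = (h, d)" "h \<in> arrows G" "d = 0 \<or> d = 1" using k(2) H_simps(1) by auto
  obtain i e where i: "n = (i, e)" "i \<in> arrows G" "e = 0 \<or> e = 1" using k(3) H_simps(1) by auto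
  define i' where "i' = (if d = 0 then i else l i)"
  have i': "i' \<in> arrows G" using i(2) l_closed by (simp add: i'_def)
  have sr2: "src G h = rng G i'"
    using k(5) h i l_l[OF src_closed[OF h(2)]] l_rng[OF i(2)] by (auto simp: i'_def H_simps)
  define h' where "h' = (if c = 0 then h else l h)"
  define i'' where "i'' = (if c = 0 then i' else l i')"
  have h': "h' \<in> arrows G" "i'' \<in> arrows G" using h(2) i' l_closed by (auto simp: h'_def i''_def)
  have sr: "src G g = rng G h'"
    using k(4) g h l_l[OF src_closed[OF g(2)]] l_rng[OF h(2)] by (auto simp: h'_def H_simps)
  have sr3: "src G h' = rng G i''" using l_comp(1)[OF h(2) i' sr2] sr2 by (simp add: h'_def i''_def)
  have as: "gmult G (gmult G g h') i'' = gmult G g (gmult G h' i'')" using assoc[OF g(2) h' sr sr3] .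
  have lc: "l (gmult G h i') = gmult G (l h) (l i')" using l_comp(2)[OF h(2) i' sr2] .
  show "gmult H (gmult H k m) n = gmult H k (gmult H m n)"
    using g(3) h(3) i(3) as lc comp(1)[OF g(2) h'(1) sr] comp(1)[OF h(2) i' sr2]
    unfolding g(1) h(1) i(1) h'_def i''_def i'_def
    by (elim disjE) (simp_all add: H_simps g(2) h(2) i(2) l_closed l_l)
qed

sublocale HG: grpd H by unfold_locales (rule groupoid_H)

abbreviation "AH \<equiv> arr_top H"
abbreviation "T \<equiv> unit_top G"

lemma AH_eq: "AH = prod_topology A (discrete_topology {0, 1})"
  by (simp add: H_eq semidirect_def Z2_simps)

lemma AH_open_times: "openin A U \<Longrightarrow> c \<in> {0, 1} \<Longrightarrow> openin AH (U \<times> {c})"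
  unfolding AH_eq openin_prod_Times_iff by simp

lemma AH_open_iff:
  "openin AH W \<longleftrightarrow> W \<subseteq> arrows H \<and> openin A {g. (g, 0) \<in> W} \<and> openin A {g. (g, 1) \<in> W}"
proof
  assume W: "openin AH W"
  have sl: "openin A {g. (g, c) \<in> W}" for c
  proof (subst openin_subopen, intro ballI)
    fix g assume "g \<in> {g. (g, c) \<in> W}"
    then obtain U V where "openin A U" "g \<in> U" "c \<in> V" "U \<times> V \<subseteq> W"
      using W unfolding AH_eq openin_prod_topology_alt by blast
    then show "\<exists>S. openin A S \<and> g \<in> S \<and> S \<subseteq> {g. (g, c) \<in> W}" by blast
  qed
  moreover have "W \<subseteq> arrows H" using W openin_subset by (auto simp: arrows_def)
  ultimately show "W \<subseteq> arrows H \<and> openin A {g. (g, 0) \<in> W} \<and> openin A {g. (g, 1) \<in> W}" by blast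
next
  assume W: "W \<subseteq> arrows H \<and> openin A {g. (g, 0) \<in> W} \<and> openin A {g. (g, 1) \<in> W}"
  have "W = {g. (g, 0) \<in> W} \<times> {0} \<union> {g. (g, 1) \<in> W} \<times> {1}" using W H_simps(1) by auto
  moreover have "openin AH ({g. (g, 0) \<in> W} \<times> {0} \<union> {g. (g, 1) \<in> W} \<times> {1})"
    using W AH_open_times by (intro openin_Un) auto
  ultimately show "openin AH W" by simp
qed

lemma l_open: "openin A U \<Longrightarrow> openin A (l ` U)"
  using homeomorphic_imp_open_map[OF l_homeo] by (simp add: open_map_def)

lemma l_open_unit: "openin T U \<Longrightarrow> openin T (l ` U)"
  unfolding unit_open_iff using l_open l_units by auto

lemma H_src_in: "k \<in> arrows H \<Longrightarrow> src H k = (fst (src H k), 0) \<and> fst (src H k) \<in> G0"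
  by (erule H_arrow_cases) (auto simp: H_simps src_units l_units)

lemma H_rng_in: "k \<in> arrows H \<Longrightarrow> rng H k = (fst (rng H k), 0) \<and> fst (rng H k) \<in> G0"
  by (erule H_arrow_cases) (auto simp: H_simps rng_units)

lemma H_open_arrows: "openin AH W \<Longrightarrow> k \<in> W \<Longrightarrow> k \<in> arrows H"
  using AH_open_iff by blast

lemma H_src_open: assumes "openin AH W" shows "openin T {x. (x, 0) \<in> src H ` W}"
proof -
  have W: "W \<subseteq> arrows H" "openin A {g. (g, 0) \<in> W}" "openin A {g. (g, 1) \<in> W}" using assms AH_open_iff by auto
  have "{x. (x, 0) \<in> src H ` W} = src G ` {g. (g, 0) \<in> W} \<union> l ` src G ` {g. (g, 1) \<in> W}"
  proof (intro subset_antisym subsetI)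
    fix x assume "x \<in> {x. (x, 0) \<in> src H ` W}"
    then obtain k where k: "k \<in> W" "src H k = (x, 0)" by (metis imageE mem_Collect_eq)
    then have "k \<in> arrows H" using W by blast
    then show "x \<in> src G ` {g. (g, 0) \<in> W} \<union> l ` src G ` {g. (g, 1) \<in> W}"
      by (rule H_arrow_cases) (use k in \<open>auto simp: H_simps\<close>)
  next
    fix x assume "x \<in> src G ` {g. (g, 0) \<in> W} \<union> l ` src G ` {g. (g, 1) \<in> W}"
    then consider g where "x = src G g" "(g, 0) \<in> W" | g where "x = l (src G g)" "(g, 1) \<in> W" by blast
    then show "x \<in> {x. (x, 0) \<in> src H ` W}"
    proof cases
      case 1
      then have "src H (g, 0) = (x, 0)" using W H_simps by auto
      then show ?thesis using 1 by (metis image_eqI mem_Collect_eq)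
    next
      case 2
      then have "src H (g, 1) = (x, 0)" using W H_simps by auto
      then show ?thesis using 2 by (metis image_eqI mem_Collect_eq)
    qed
  qed
  then show ?thesis using src_open W l_open_unit by (metis openin_Un)
qed

lemma H_rng_preimage: assumes "openin T B" shows "openin AH {k \<in> arrows H. fst (rng H k) \<in> B}"
proof -
  have "{g. (g, 0) \<in> {k \<in> arrows H. fst (rng H k) \<in> B}} = {g \<in> arrows G. rng G g \<in> B}"
    "{g. (g, 1) \<in> {k \<in> arrows H. fst (rng H k) \<in> B}} = {g \<in> arrows G. rng G g \<in> B}"
    by (auto simp: H_simps)
  then show ?thesis unfolding AH_open_iff using rng_preimage[OF assms] by auto
qed

lemma H_src_preimage: assumes "openin T B" shows "openin AH {k \<in> arrows H. fst (src H k) \<in> B}"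
proof -
  have BX: "B \<subseteq> G0" using assms unit_open_iff by blast
  have "{g. (g, 0) \<in> {k \<in> arrows H. fst (src H k) \<in> B}} = {g \<in> arrows G. src G g \<in> B}"
    by (auto simp: H_simps)
  moreover have "{g. (g, 1) \<in> {k \<in> arrows H. fst (src H k) \<in> B}} = {g \<in> arrows G. src G g \<in> l ` B}"
  proof -
    have "l (src G g) \<in> B \<longleftrightarrow> src G g \<in> l ` B" if "g \<in> arrows G" for g
    proof
      show "src G g \<in> l ` B" if "l (src G g) \<in> B"
        using that l_l[OF src_closed[OF \<open>g \<in> arrows G\<close>]] by force
      show "l (src G g) \<in> B" if "src G g \<in> l ` B"
      proof -
        from that obtain b where "b \<in> B" "src G g = l b" by blast
        then show ?thesis using l_l[OF units_arrows] BX by auto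
      qed
    qed
    then have "fst (src H (g, 1)) \<in> B \<longleftrightarrow> src G g \<in> l ` B" if "g \<in> arrows G" for g
      using that by (simp only: H_simps fst_conv)
    then show ?thesis using H_simps(1) by (intro Set.Collect_cong) blast
  qed
  ultimately show ?thesis unfolding AH_open_iff using src_preimage assms l_open_unit by auto
qed

lemma H_bisection_nbhd:
  assumes W: "openin AH W" and k: "k \<in> W"
  shows "\<exists>V. openin AH V \<and> k \<in> V \<and> V \<subseteq> W \<and> inj_on (src H) V \<and> inj_on (rng H) V"
proof -
  obtain g c where g: "k = (g, c)" "g \<in> arrows G" "c \<in> {0, 1}" using H_open_arrows[OF W k] H_simps(1) by auto
  have "openin A {g. (g, c) \<in> W}" using W AH_open_iff g(3) by auto
  then obtain V where V: "openin A V" "g \<in> V" "V \<subseteq> {g. (g, c) \<in> W}" "inj_on (src G) V" "inj_on (rng G) V"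
    using bisection_nbhd[of "{g. (g, c) \<in> W}" g] k g(1) by blast
  have Va: "h \<in> arrows G" if "h \<in> V" for h using that open_arrows V(1) by blast
  have ls: "l (src G h) = l (src G h') \<longleftrightarrow> src G h = src G h'" if "h \<in> V" "h' \<in> V" for h h'
    using l_l[OF src_closed[OF Va[OF that(1)]]] l_l[OF src_closed[OF Va[OF that(2)]]] by metis
  have "inj_on (src H) (V \<times> {c})"
  proof (rule inj_onI)
    fix k m assume km: "k \<in> V \<times> {c}" "m \<in> V \<times> {c}" "src H k = src H m"
    then obtain h h' where h: "k = (h, c)" "m = (h', c)" "h \<in> V" "h' \<in> V" by blast
    then have "src G h = src G h'" using km(3) g(3) Va ls[OF h(3,4)] by (auto simp: H_simps)
    then show "k = m" using h V(4) by (simp add: inj_on_def)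
  qed
  moreover have "inj_on (rng H) (V \<times> {c})" using V(5) g(3) Va by (auto simp: inj_on_def H_simps)
  ultimately show ?thesis using AH_open_times[OF V(1) g(3)] V g(1) by (intro exI[of _ "V \<times> {c}"]) auto
qed

sublocale graded_germs "unit_top G" "germ G" l
proof -
  interpret P: minimal_germs "unit_top G" "germ G" using minimal_germs[OF minimal] .
  show "graded_germs (unit_top G) (germ G) l"
  proof unfold_locales
    show "l x \<in> topspace (unit_top G)" "l (l x) = x" "l x \<noteq> x" if "x \<in> topspace (unit_top G)" for x
      using that l_units l_l units_arrows free by (auto simp: topspace_unit free_on_units_def Z2_simps l_def)
    show "openin (unit_top G) (l ` U)" if "openin (unit_top G) U" for U using l_open_unit that .
    show "germ G (\<lambda>y. l (f (l y))) (l x)" if f: "germ G f x" for f x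
    proof -
      obtain U where U: "openin A U" "x \<in> src G ` U" "\<And>h. h\<in>U \<Longrightarrow> f (src G h) = rng G h"
        using f unfolding germ_def by blast
      have Ua: "h \<in> arrows G" if "h \<in> U" for h using that open_arrows U(1) by blast
      show ?thesis unfolding germ_def
      proof (intro exI conjI ballI)
        show "openin A (l ` U)" using l_open U(1) .
        obtain u where u: "u \<in> U" "x = src G u" using U(2) by blast
        then have "l x = src G (l u)" using l_src Ua by simp
        then show "l x \<in> src G ` l ` U" using u by blast
        fix h assume "h \<in> l ` U"
        then obtain u where "u \<in> U" "h = l u" by blast
        then show "l (f (l (src G h))) = rng G h" using l_src l_rng l_l[OF src_closed] Ua U(3) by simp
      qed
    qed
    \<comment> \<open>If arrows h of G induced l near x, the arrows (h, 1) would form an open set of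
      isotropy in H, since their source is l (s h) = r h. Effectiveness of H would make them units,
      but units have second component 0.\<close>
    show "\<not> germ G l x" if x: "x \<in> topspace (unit_top G)" for x
    proof
      assume "germ G l x"
      then obtain U where U: "openin A U" "x \<in> src G ` U" "\<And>h. h\<in>U \<Longrightarrow> l (src G h) = rng G h"
        unfolding germ_def by blast
      have "U \<times> {1} \<subseteq> {k \<in> arrows H. rng H k = src H k}"
        using U(3) open_arrows[OF U(1)] by (auto simp: H_simps)
      then have "U \<times> {1} \<subseteq> units H"
        using interior_of_maximal[OF _ AH_open_times[OF U(1)], of 1] effective_H unfolding effective_groupoid_def by auto
      then show False using U(2) H_simps(2) by auto
    qed
  qed
qed

text \<open>This justifies the abstract germs of H. An open set of arrows of H is the union of two
  slices, and the slice containing an arrow with source x gives the degree; the degree-one slice has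
  its sources twisted by l.\<close>

lemma LH_iff:
  "LH f x \<longleftrightarrow> (\<exists>W. openin AH W \<and> (x, 0) \<in> src H ` W \<and> (\<forall>k\<in>W. rng H k = (f (fst (src H k)), 0)))"
proof
  assume "LH f x"
  then obtain b where b: "ty b f x" by (auto simp: LH_def)
  show "\<exists>W. openin AH W \<and> (x, 0) \<in> src H ` W \<and> (\<forall>k\<in>W. rng H k = (f (fst (src H k)), 0))"
  proof (cases b)
    case False
    then have "germ G f x" using b by (simp add: ty_False)
    then obtain U where U: "openin A U" "x \<in> src G ` U" "\<And>h. h\<in>U \<Longrightarrow> f (src G h) = rng G h"
      unfolding germ_def by blast
    have Ua: "h \<in> arrows G" if "h \<in> U" for h using that open_arrows U(1) by blast
    obtain u where u: "u \<in> U" "x = src G u" using U(2) by blast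
    have "(x, 0) = src H (u, 0)" using u Ua by (simp add: H_simps)
    then have "(x, 0) \<in> src H ` (U \<times> {0})" using u by blast
    then show ?thesis using AH_open_times[OF U(1), of 0] U(3) Ua by (intro exI[of _ "U \<times> {0}"]) (auto simp: H_simps)
  next
    case True
    then have "germ G (\<lambda>y. f (l y)) (l x)" and x: "x \<in> G0" using b by (simp_all add: ty_True topspace_unit)
    then obtain U where U: "openin A U" "l x \<in> src G ` U" "\<And>h. h\<in>U \<Longrightarrow> f (l (src G h)) = rng G h"
      unfolding germ_def by blast
    have Ua: "h \<in> arrows G" if "h \<in> U" for h using that open_arrows U(1) by blast
    obtain u where u: "u \<in> U" "l x = src G u" using U(2) by blast
    have "(x, 0) = src H (u, 1)" using u Ua l_l[OF units_arrows[OF x]] by (simp add: H_simps flip: u(2))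
    then have "(x, 0) \<in> src H ` (U \<times> {1})" using u by blast
    then show ?thesis using AH_open_times[OF U(1), of 1] U(3) Ua by (intro exI[of _ "U \<times> {1}"]) (auto simp: H_simps)
  qed
next
  assume "\<exists>W. openin AH W \<and> (x, 0) \<in> src H ` W \<and> (\<forall>k\<in>W. rng H k = (f (fst (src H k)), 0))"
  then obtain W where W: "openin AH W" "(x, 0) \<in> src H ` W" "\<And>k. k\<in>W \<Longrightarrow> rng H k = (f (fst (src H k)), 0)" by blast
  have Wa: "k \<in> arrows H" if "k \<in> W" for k using that H_open_arrows W(1) by blast
  obtain k where k: "k \<in> W" "src H k = (x, 0)" using W(2) by (metis imageE)
  have x: "x \<in> G0" using H_src_in[OF Wa[OF k(1)]] k(2) by simp
  from Wa[OF k(1)] show "LH f x"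
  proof (cases rule: H_arrow_cases)
    case (1 g)
    have "germ G f x" unfolding germ_def
    proof (intro exI conjI ballI)
      show "openin A {g. (g, 0) \<in> W}" using W(1) AH_open_iff by blast
      show "x \<in> src G ` {g. (g, 0) \<in> W}" using k 1 by (auto simp: H_simps)
      fix h assume h: "h \<in> {g. (g, 0) \<in> W}"
      then have "h \<in> arrows G" using Wa H_simps(1) by auto
      then show "f (src G h) = rng G h" using W(3)[of "(h, 0)"] h by (simp add: H_simps)
    qed
    then show ?thesis using LH_LG by blast
  next
    case (2 g)
    have "germ G (\<lambda>y. f (l y)) (l x)" unfolding germ_def
    proof (intro exI conjI ballI)
      show "openin A {g. (g, 1) \<in> W}" using W(1) AH_open_iff by blast
      have "l x = src G g" using k 2 l_l[OF src_closed] by (auto simp: H_simps)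
      then show "l x \<in> src G ` {g. (g, 1) \<in> W}" using k 2 by auto
      fix h assume h: "h \<in> {g. (g, 1) \<in> W}"
      then have "h \<in> arrows G" using Wa H_simps(1) by auto
      then show "f (l (src G h)) = rng G h" using W(3)[of "(h, 1)"] h by (simp add: H_simps)
    qed
    then have "ty True f x" using x by (simp add: ty_True topspace_unit)
    then show ?thesis using LH_ty by blast
  qed
qed

end

section \<open>Full bisections and the full group of the semidirect product\<close>

context semidirect_Z2 begin

definition "\<iota> = transport_units G lam"

lemma \<iota>_apply: "x \<in> G0 \<Longrightarrow> \<iota> \<alpha> (x, 0) = (\<alpha> x, 0)"
  using H_simps(2) by (simp add: \<iota>_def transport_units_def flip: H_eq)

lemma \<iota>_extensional: "\<iota> \<alpha> \<in> extensional (units H)"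
  by (simp add: \<iota>_def transport_units_def flip: H_eq)

lemma H_units_open: "openin AH (units H)"
  using effective_H unfolding effective_groupoid_def by (metis openin_interior_of)

text \<open>Within each slice this is \<open>same_map_bisection\<close> for G. Two arrows with equal
  range in different slices would give \<alpha> both degrees at one point, contrary to
  \<open>ty_unique\<close>.\<close>

lemma H_same_map_inj:
  assumes \<alpha>: "\<alpha> \<in> H.F" and W: "openin AH W" and m: "\<And>k. k \<in> W \<Longrightarrow> rng H k = (\<alpha> (fst (src H k)), 0)"
  shows "inj_on (src H) W" "inj_on (rng H) W"
proof -
  have Wa: "k \<in> arrows H" if "k \<in> W" for k using that H_open_arrows W by blast
  have inj: "\<alpha> x = \<alpha> y \<longleftrightarrow> x = y" if "x \<in> G0" "y \<in> G0" for x y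
    using H.F_inj[OF \<alpha>] that by (simp add: topspace_unit)
  have slice: "openin A {g. (g, 0) \<in> W}" "openin A {g. (g, 1) \<in> W}" using W AH_open_iff by auto
  have s0: "\<alpha> (src G g) = rng G g" "g \<in> arrows G" if "(g, 0) \<in> W" for g
    using m[OF that] Wa[OF that] by (auto simp: H_simps)
  have s1: "\<alpha> (l (src G g)) = rng G g" "g \<in> arrows G" if "(g, 1) \<in> W" for g
    using m[OF that] Wa[OF that] by (auto simp: H_simps)
  have i0: "inj_on (rng G) {g. (g, 0) \<in> W}"
    by (rule same_map_bisection(2)[OF slice(1), of \<alpha>]) (use s0 inj in \<open>auto simp: inj_on_def\<close>)
  have ll: "l x = l y \<longleftrightarrow> x = y" if "x \<in> G0" "y \<in> G0" for x y
    using l_l[OF units_arrows[OF that(1)]] l_l[OF units_arrows[OF that(2)]] by metis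
  have "inj_on (\<lambda>y. \<alpha> (l y)) G0"
    using inj l_units ll by (auto simp: inj_on_def)
  then have i1: "inj_on (rng G) {g. (g, 1) \<in> W}"
    by (intro same_map_bisection(2)[OF slice(2), of "\<lambda>y. \<alpha> (l y)"]) (use s1 in auto)
  have mixed: False if gh: "(g, 0) \<in> W" "(h, 1) \<in> W" "rng G g = rng G h" for g h
  proof -
    have x: "src G g \<in> G0" "l (src G h) \<in> G0" using s0 s1 gh src_units l_units by auto
    have "\<alpha> (src G g) = \<alpha> (l (src G h))" using s0(1)[OF gh(1)] s1(1)[OF gh(2)] gh(3) by simp
    then have e: "src G g = l (src G h)" using inj x by blast
    have "germ G \<alpha> (src G g)" unfolding germ_def
      by (intro exI[of _ "{g. (g, 0) \<in> W}"]) (use slice s0 gh in auto)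
    then have "ty False \<alpha> (src G g)" by (simp add: ty_False)
    moreover have "l (src G g) = src G h" using e l_l[OF units_arrows[OF src_units[OF s1(2)[OF gh(2)]]]] by simp
    then have "germ G (\<lambda>y. \<alpha> (l y)) (l (src G g))" unfolding germ_def
      by (intro exI[of _ "{g. (g, 1) \<in> W}"]) (use slice s1 gh in auto)
    then have "ty True \<alpha> (src G g)" using x by (simp add: ty_True topspace_unit)
    ultimately show False using ty_unique by blast
  qed
  have eq: "k = k'" if k: "k \<in> W" "k' \<in> W" "rng H k = rng H k'" for k k'
  proof -
    obtain g c where g: "k = (g, c)" "g \<in> arrows G" "c = 0 \<or> c = 1" using Wa[OF k(1)] H_simps(1) by auto
    obtain h d where h: "k' = (h, d)" "h \<in> arrows G" "d = 0 \<or> d = 1" using Wa[OF k(2)] H_simps(1) by auto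
    have r: "rng G g = rng G h" using k(3) g h by (auto simp: H_simps)
    then have "c = d" using g h mixed k by metis
    then have "g = h" using g h k(1,2) r i0 i1 by (auto simp: inj_on_def)
    then show ?thesis using g h \<open>c = d\<close> by simp
  qed
  then show "inj_on (rng H) W" by (auto simp: inj_on_def)
  show "inj_on (src H) W"
  proof (rule inj_onI)
    fix k k' assume "k \<in> W" "k' \<in> W" "src H k = src H k'"
    then show "k = k'" using eq[of k k'] m[of k] m[of k'] by simp
  qed
qed

lemma compact_slice: "compactin A U \<Longrightarrow> c \<in> {0, 1} \<Longrightarrow> compactin AH (U \<times> {c})"
  unfolding AH_eq compactin_Times by (simp add: compactin_discrete_topology)

text \<open>W is the largest open set of arrows inducing \<alpha>. Its compactness is proved slice
  by slice: the source set of each slice is open, and its complement is the l-image of the other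
  one, so both are closed.\<close>

lemma exists_bisection:
  assumes \<alpha>: "\<alpha> \<in> H.F"
  shows "\<exists>W. full_bisection H W \<and> (\<forall>k\<in>W. rng H k = (\<alpha> (fst (src H k)), 0))"
proof -
  define W where "W = \<Union>{W. openin AH W \<and> (\<forall>k\<in>W. rng H k = (\<alpha> (fst (src H k)), 0))}"
  have W: "openin AH W" and m: "\<And>k. k \<in> W \<Longrightarrow> rng H k = (\<alpha> (fst (src H k)), 0)" unfolding W_def by auto
  have Wa: "k \<in> arrows H" if "k \<in> W" for k using that H_open_arrows W by blast
  note inj = H_same_map_inj[OF \<alpha> W m]
  have sW: "src H ` W = units H"
  proof (intro subset_antisym subsetI)
    show "x \<in> units H" if "x \<in> src H ` W" for x using that Wa HG.src_units by auto
    fix p assume "p \<in> units H"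
    then obtain x where x: "p = (x, 0)" "x \<in> G0" using H_simps(2) by auto
    then have "LH \<alpha> x" using H.F_L[OF \<alpha>] by (simp add: topspace_unit)
    then obtain W' where "openin AH W'" "(x, 0) \<in> src H ` W'" "\<forall>k\<in>W'. rng H k = (\<alpha> (fst (src H k)), 0)"
      unfolding LH_iff by blast
    then show "p \<in> src H ` W" unfolding W_def x(1) by blast
  qed
  have "\<alpha> ` G0 = G0" using H.F_image[OF \<alpha>] by (simp add: topspace_unit)
  moreover have "rng H ` W = (\<lambda>p. (\<alpha> (fst p), 0)) ` src H ` W" unfolding image_image using m by (intro image_cong) auto
  moreover have "(\<lambda>p. (\<alpha> (fst p), 0)) ` (G0 \<times> {0}) = (\<alpha> ` G0) \<times> {0}" by force
  ultimately have rW: "rng H ` W = units H" unfolding sW H_simps(2) by simp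
  define U0 where "U0 = {g. (g, 0) \<in> W}"
  define U1 where "U1 = {g. (g, 1) \<in> W}"
  have U: "openin A U0" "openin A U1" using W AH_open_iff by (auto simp: U0_def U1_def)
  have Ua: "g \<in> arrows G" if "g \<in> U0 \<union> U1" for g using that Wa H_simps(1) by (auto simp: U0_def U1_def)
  have injU: "inj_on (src G) U0" "inj_on (src G) U1"
  proof -
    show "inj_on (src G) U0"
    proof (rule inj_onI)
      fix g h assume gh: "g \<in> U0" "h \<in> U0" "src G g = src G h"
      then have "src H (g, 0) = src H (h, 0)" using Ua by (simp add: H_simps)
      then show "g = h" using inj(1) gh by (auto simp: inj_on_def U0_def)
    qed
    show "inj_on (src G) U1"
    proof (rule inj_onI)
      fix g h assume gh: "g \<in> U1" "h \<in> U1" "src G g = src G h"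
      then have "src H (g, 1) = src H (h, 1)" using Ua by (simp add: H_simps)
      then show "g = h" using inj(1) gh by (auto simp: inj_on_def U1_def)
    qed
  qed
  have m0: "x \<in> src G ` U0 \<longleftrightarrow> (\<exists>g. (g, 0) \<in> W \<and> src H (g, 0) = (x, 0))" for x
    using Ua by (auto simp: U0_def H_simps image_iff)
  have m1: "l x \<in> src G ` U1 \<longleftrightarrow> (\<exists>g. (g, 1) \<in> W \<and> src H (g, 1) = (x, 0))" if x: "x \<in> G0" for x
  proof -
    have "l x = src G g \<longleftrightarrow> src H (g, 1) = (x, 0)" if "g \<in> U1" for g
    proof -
      have g: "g \<in> arrows G" using Ua that by blast
      have "l x = src G g \<longleftrightarrow> l (src G g) = x"
        using l_l[OF units_arrows[OF x]] l_l[OF src_closed[OF g]] by metis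
      then show ?thesis using g by (simp only: H_simps prod.inject simp_thms)
    qed
    then show ?thesis unfolding U1_def by blast
  qed
  \<comment> \<open>Exactly one arrow of W has source x. It has degree zero if x is a source of U0,
    and degree one if l x is a source of U1.\<close>
  have part: "x \<in> src G ` U0 \<longleftrightarrow> l x \<notin> src G ` U1" if x: "x \<in> G0" for x
  proof -
    have "(x, 0) \<in> src H ` W" using sW x H_simps(2) by auto
    then obtain k where k: "k \<in> W" "src H k = (x, 0)" by (metis imageE)
    have uq: "k' = k" if "k' \<in> W" "src H k' = (x, 0)" for k' using inj(1) k that by (metis inj_onD)
    from Wa[OF k(1)] show ?thesis unfolding m0 m1[OF x]
    proof (cases rule: H_arrow_cases)
      case (1 g)
      then show "(\<exists>g. (g, 0) \<in> W \<and> src H (g, 0) = (x, 0)) \<longleftrightarrow> \<not> (\<exists>g. (g, 1) \<in> W \<and> src H (g, 1) = (x, 0))"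
        using k uq by (metis Pair_inject zero_neq_one)
    next
      case (2 g)
      then show "(\<exists>g. (g, 0) \<in> W \<and> src H (g, 0) = (x, 0)) \<longleftrightarrow> \<not> (\<exists>g. (g, 1) \<in> W \<and> src H (g, 1) = (x, 0))"
        using k uq by (metis Pair_inject zero_neq_one)
    qed
  qed
  have sub: "src G ` U0 \<subseteq> G0" "src G ` U1 \<subseteq> G0" using Ua src_units by auto
  have lm: "x \<in> l ` D \<longleftrightarrow> l x \<in> D" if "x \<in> G0" "D \<subseteq> G0" for x D
  proof
    assume "x \<in> l ` D"
    then obtain y where "y \<in> D" "x = l y" by blast
    then show "l x \<in> D" using l_l[OF units_arrows] that(2) by auto
  next
    assume "l x \<in> D"
    then show "x \<in> l ` D" using l_l[OF units_arrows[OF that(1)]] by force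
  qed
  have lsub: "l ` D \<subseteq> G0" if "D \<subseteq> G0" for D using that l_units by blast
  have compl: "G0 - P = l ` Q" if "P \<subseteq> G0" "Q \<subseteq> G0" "\<And>x. x \<in> G0 \<Longrightarrow> x \<in> P \<longleftrightarrow> l x \<notin> Q" for P Q
  proof (rule Set.set_eqI)
    show "x \<in> G0 - P \<longleftrightarrow> x \<in> l ` Q" for x
      using that(3) lm[OF _ that(2)] lsub[OF that(2)] by (cases "x \<in> G0") (simp, blast)
  qed
  have c0: "G0 - src G ` U0 = l ` src G ` U1" using compl[OF sub part] .
  have part': "x \<in> src G ` U1 \<longleftrightarrow> l x \<notin> src G ` U0" if x: "x \<in> G0" for x
    using part[OF l_units[OF x]] l_l[OF units_arrows[OF x]] by simp
  have c1: "G0 - src G ` U1 = l ` src G ` U0" using compl[OF sub(2,1) part'] .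
  have "closedin T (src G ` U0)" "closedin T (src G ` U1)"
    unfolding closedin_def topspace_unit c0 c1 using sub l_open_unit src_open U by auto
  then have "compactin A U0" "compactin A U1" using compact_of_closed_image U injU by auto
  then have "compactin AH (U0 \<times> {0} \<union> U1 \<times> {1})" using compact_slice by (intro compactin_Un) auto
  moreover have "U0 \<times> {0} \<union> U1 \<times> {1} = W" using Wa H_simps(1) by (auto simp: U0_def U1_def)
  ultimately have "full_bisection H W"
    using W inj sW rW Wa by (auto simp: full_bisection_def compact_open_bisection_def bisection_def)
  then show ?thesis using m by blast
qed

lemma full_group_H: "carrier (full_group H) = \<iota> ` H.F"
proof (intro subset_antisym subsetI)
  fix \<beta> assume "\<beta> \<in> carrier (full_group H)"
  then obtain W where W: "full_bisection H W" "\<beta> = bisection_map H W" by (auto simp: full_group_def)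
  have b: "openin AH W" "inj_on (src H) W" "inj_on (rng H) W" "src H ` W = units H" "rng H ` W = units H"
    using W by (auto simp: full_bisection_def compact_open_bisection_def bisection_def)
  have Wa: "k \<in> arrows H" if "k \<in> W" for k using that H_open_arrows b(1) by blast
  have m: "\<beta> (src H k) = rng H k" if "k \<in> W" for k
    using that b W(2) by (auto simp: bisection_map_def)
  define \<alpha> where "\<alpha> = restrict (\<lambda>x. fst (\<beta> (x, 0))) G0"
  have \<alpha>m: "rng H k = (\<alpha> (fst (src H k)), 0)" if "k \<in> W" for k
  proof -
    have "src H k = (fst (src H k), 0)" "fst (src H k) \<in> G0" using H_src_in[OF Wa[OF that]] by auto
    then have "\<alpha> (fst (src H k)) = fst (rng H k)" using m[OF that] by (simp add: \<alpha>_def)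
    then show ?thesis using H_rng_in[OF Wa[OF that]] by simp
  qed
  have ex: "\<exists>k\<in>W. src H k = (x, 0) \<and> rng H k = (\<alpha> x, 0)" if x: "x \<in> G0" for x
  proof -
    have "(x, 0) \<in> src H ` W" using b(4) x H_simps(2) by auto
    then obtain k where "k \<in> W" "src H k = (x, 0)" by (metis imageE)
    then show ?thesis using \<alpha>m by (intro bexI[of _ k]) auto
  qed
  have "inj_on \<alpha> G0"
  proof (rule inj_onI)
    fix x y assume xy: "x \<in> G0" "y \<in> G0" "\<alpha> x = \<alpha> y"
    obtain k k' where "k \<in> W" "k' \<in> W" "src H k = (x, 0)" "src H k' = (y, 0)" "rng H k = rng H k'"
      using ex[OF xy(1)] ex[OF xy(2)] xy(3) by metis
    then show "x = y" using b(3) by (metis Pair_inject inj_onD)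
  qed
  moreover have "\<alpha> ` G0 = G0"
  proof (intro subset_antisym subsetI)
    fix y assume "y \<in> \<alpha> ` G0"
    then obtain x where x: "x \<in> G0" "y = \<alpha> x" by blast
    then obtain k where "k \<in> W" "rng H k = (y, 0)" using ex by blast
    then show "y \<in> G0" using H_rng_in[OF Wa] by (metis fst_conv)
  next
    fix y assume "y \<in> G0"
    then have "(y, 0) \<in> rng H ` W" using b(5) H_simps(2) by auto
    then obtain k where k: "k \<in> W" "rng H k = (y, 0)" by (metis imageE)
    then have "\<alpha> (fst (src H k)) = y" using \<alpha>m by simp
    then show "y \<in> \<alpha> ` G0" using H_src_in[OF Wa[OF k(1)]] by blast
  qed
  ultimately have "\<alpha> \<in> Bij (topspace T)" by (simp add: Bij_def bij_betw_def topspace_unit \<alpha>_def)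
  moreover have "LH \<alpha> x" if "x \<in> G0" for x
    unfolding LH_iff using b(1) ex[OF that] \<alpha>m by (intro exI[of _ W]) force
  ultimately have \<alpha>F: "\<alpha> \<in> H.F" by (simp add: H.F_def topspace_unit)
  have "\<beta> = \<iota> \<alpha>"
  proof (rule extensionalityI[of _ "units H"])
    show "\<beta> \<in> extensional (units H)" using W by (simp add: bisection_map_def)
    show "\<iota> \<alpha> \<in> extensional (units H)" by (rule \<iota>_extensional)
    fix p assume "p \<in> units H"
    then obtain x where x: "p = (x, 0)" "x \<in> G0" using H_simps(2) by auto
    then obtain k where "k \<in> W" "src H k = p" "rng H k = (\<alpha> x, 0)" using ex by blast
    then show "\<beta> p = \<iota> \<alpha> p" using m[of k] \<iota>_apply[OF x(2)] x(1) by simp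
  qed
  then show "\<beta> \<in> \<iota> ` H.F" using \<alpha>F by blast
next
  fix \<beta> assume "\<beta> \<in> \<iota> ` H.F"
  then obtain \<alpha> where \<alpha>: "\<alpha> \<in> H.F" "\<beta> = \<iota> \<alpha>" by blast
  obtain W where W: "full_bisection H W" "\<And>k. k\<in>W \<Longrightarrow> rng H k = (\<alpha> (fst (src H k)), 0)" using exists_bisection[OF \<alpha>(1)] by blast
  have b: "inj_on (src H) W" "src H ` W = units H"
    using W(1) by (auto simp: full_bisection_def compact_open_bisection_def bisection_def)
  have "\<beta> = bisection_map H W"
  proof (rule extensionalityI[of _ "units H"])
    show "\<beta> \<in> extensional (units H)" using \<alpha> \<iota>_extensional by simp
    show "bisection_map H W \<in> extensional (units H)" by (simp add: bisection_map_def)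
    fix p assume p: "p \<in> units H"
    then obtain x where x: "p = (x, 0)" "x \<in> G0" using H_simps(2) by auto
    obtain k where k: "k \<in> W" "p = src H k" using b(2) p by blast
    have "bisection_map H W p = rng H k" using p k b(1) by (simp add: bisection_map_def)
    also have "\<dots> = (\<alpha> x, 0)" using W(2)[OF k(1)] k(2) x(1) by (metis fst_conv)
    finally show "\<beta> p = bisection_map H W p" using \<alpha>(2) \<iota>_apply[OF x(2)] x by simp
  qed
  then show "\<beta> \<in> carrier (full_group H)" using W(1) by (auto simp: full_group_def)
qed

lemma bisection_pm:
  assumes W: "openin AH W" "inj_on (src H) W" "inj_on (rng H) W" and D: "clopenin T D" "src H ` W = D \<times> {0}"
  shows "\<exists>f. H.pm D f \<and> (\<forall>k\<in>W. rng H k = (f (fst (src H k)), 0)) \<and> f ` D \<times> {0::int} = rng H ` W"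
proof -
  have Wa: "k \<in> arrows H" if "k \<in> W" for k using that H_open_arrows W(1) by blast
  define f where "f x = fst (rng H (inv_into W (src H) (x, 0)))" for x
  have m: "rng H k = (f (fst (src H k)), 0)" if "k \<in> W" for k
  proof -
    have "src H k = (fst (src H k), 0)" using H_src_in[OF Wa[OF that]] by blast
    then have "f (fst (src H k)) = fst (rng H k)" using W(2) that by (metis f_def inv_into_f_f)
    then show ?thesis using H_rng_in[OF Wa[OF that]] by simp
  qed
  have ex: "\<exists>k\<in>W. src H k = (x, 0) \<and> rng H k = (f x, 0)" if x: "x \<in> D" for x
  proof -
    have "(x, 0) \<in> src H ` W" using D x by auto
    then obtain k where "k \<in> W" "src H k = (x, 0)" by (metis imageE)
    then show ?thesis using m by (intro bexI[of _ k]) auto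
  qed
  have "inj_on f D"
  proof (rule inj_onI)
    fix x y assume xy: "x \<in> D" "y \<in> D" "f x = f y"
    obtain k k' where "k \<in> W" "k' \<in> W" "src H k = (x, 0)" "src H k' = (y, 0)" "rng H k = rng H k'"
      using ex[OF xy(1)] ex[OF xy(2)] xy(3) by metis
    then show "x = y" using W(3) by (metis Pair_inject inj_onD)
  qed
  moreover have "LH f x" if "x \<in> D" for x
    unfolding LH_iff using W(1) ex[OF that] m by (intro exI[of _ W]) force
  ultimately have "H.pm D f" using D(1) by (simp add: H.pm_def)
  moreover have "f ` D \<times> {0::int} = rng H ` W"
  proof (intro subset_antisym subsetI)
    fix p assume "p \<in> f ` D \<times> {0::int}"
    then obtain x where "x \<in> D" "p = (f x, 0)" by auto
    then show "p \<in> rng H ` W" using ex by (metis image_eqI)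
  next
    fix p assume "p \<in> rng H ` W"
    then obtain k where k: "k \<in> W" "p = rng H k" by blast
    have "src H k \<in> D \<times> {0}" using D(2) k(1) by blast
    then have "fst (src H k) \<in> D" by auto
    then show "p \<in> f ` D \<times> {0::int}" using m[OF k(1)] k(2) by auto
  qed
  ultimately show ?thesis using m by blast
qed

lemma pinf_of_purely_infinite:
  assumes "purely_infinite H" shows H.pinf
  unfolding H.pinf_def
proof (intro allI impI)
  fix D assume D: "clopenin T D"
  have DX: "D \<subseteq> G0" using H.clopen_subset[OF D] by (simp add: topspace_unit)
  have op: "openin (unit_top H) (E \<times> {0})" if "openin T E" for E
  proof -
    have "openin A E" "E \<subseteq> G0" using that unit_open_iff by auto
    then show ?thesis unfolding unit_top_def openin_open_subtopology[OF H_units_open]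
      using AH_open_times H_simps(2) by auto
  qed
  have ts: "topspace (unit_top H) = G0 \<times> {0}"
    using openin_subset[OF H_units_open] H_simps(2) by (simp add: unit_top_def inf.absorb2)
  have "closedin (unit_top H) (D \<times> {0})"
  proof -
    have "G0 \<times> {0 :: int} - D \<times> {0} = (G0 - D) \<times> {0}" by auto
    moreover have "openin T (G0 - D)" using D unfolding clopenin_def closedin_def topspace_unit by blast
    ultimately show ?thesis unfolding closedin_def ts using op DX by auto
  qed
  moreover have "openin (unit_top H) (D \<times> {0})" using op D by (simp add: clopenin_def)
  ultimately obtain U V where UV: "compact_open_bisection H U" "compact_open_bisection H V"
     "src H ` U = D \<times> {0}" "src H ` V = D \<times> {0}" "rng H ` U \<inter> rng H ` V = {}" "rng H ` U \<union> rng H ` V \<subseteq> D \<times> {0}"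
    using assms unfolding purely_infinite_def by meson
  obtain f where f: "H.pm D f" "f ` D \<times> {0} = rng H ` U"
    using bisection_pm[OF _ _ _ D UV(3)] UV(1) by (auto simp: compact_open_bisection_def bisection_def)
  obtain g where g: "H.pm D g" "g ` D \<times> {0} = rng H ` V"
    using bisection_pm[OF _ _ _ D UV(4)] UV(2) by (auto simp: compact_open_bisection_def bisection_def)
  have fD: "y \<in> f ` D \<longleftrightarrow> (y, 0) \<in> rng H ` U" "y \<in> g ` D \<longleftrightarrow> (y, 0) \<in> rng H ` V" for y
    unfolding f(2)[symmetric] g(2)[symmetric] by simp_all
  have "f ` D \<inter> g ` D = {}"
  proof (rule ccontr)
    assume "f ` D \<inter> g ` D \<noteq> {}"
    then obtain y where "y \<in> f ` D" "y \<in> g ` D" by auto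
    then have "(y, 0) \<in> rng H ` U \<inter> rng H ` V" unfolding fD by (rule IntI)
    then show False unfolding UV(5) by (rule emptyE)
  qed
  moreover have "f ` D \<subseteq> D" "g ` D \<subseteq> D"
  proof -
    have "y \<in> D" if "(y, 0) \<in> rng H ` U \<union> rng H ` V" for y using subsetD[OF UV(6) that] by simp
    then show "f ` D \<subseteq> D" "g ` D \<subseteq> D" by (metis UnI1 UnI2 fD subsetI)+
  qed
  ultimately show "\<exists>f g. H.pm2 D f g \<and> f ` D \<subseteq> D \<and> g ` D \<subseteq> D" using f(1) g(1) unfolding H.pm2_def by blast
qed

lemma H_Hausdorff: "Hausdorff_space AH"
  unfolding AH_eq using etale(2) by (simp add: Hausdorff_space_prod_topology)

end

section \<open>From elementary subgroupoids to finite systems of partial maps\<close>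

context semidirect_Z2 begin

text \<open>The source set of a bisection neighbourhood is only open. Restricting to a clopen D
  inside it gives a partial map in the sense of \<open>pm\<close>.\<close>

lemma H_clopen_section:
  assumes W: "openin AH W" "k \<in> W"
  shows "\<exists>V D f. openin AH V \<and> k \<in> V \<and> V \<subseteq> W \<and> src H ` V = D \<times> {0} \<and> H.pm D f \<and>
      (\<forall>k\<in>V. rng H k = (f (fst (src H k)), 0)) \<and> f ` D \<times> {0::int} = rng H ` V"
proof -
  obtain V where V: "openin AH V" "k \<in> V" "V \<subseteq> W" "inj_on (src H) V" "inj_on (rng H) V"
    using H_bisection_nbhd[OF W] by blast
  have Va: "h \<in> arrows H" if "h \<in> V" for h using that H_open_arrows V(1) by blast
  have kk: "src H k = (fst (src H k), 0)" using H_src_in[OF Va[OF V(2)]] by blast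
  then have "fst (src H k) \<in> {x. (x, 0) \<in> src H ` V}" using V(2) by (metis image_eqI mem_Collect_eq)
  then obtain D where D: "clopenin T D" "fst (src H k) \<in> D" "D \<subseteq> {x. (x, 0) \<in> src H ` V}"
    using H.clopen_base[OF H_src_open[OF V(1)]] by blast
  define V' where "V' = V \<inter> {h \<in> arrows H. fst (src H h) \<in> D}"
  have V': "openin AH V'" unfolding V'_def using V(1) H_src_preimage D(1) by (simp add: clopenin_def openin_Int)
  have kV': "k \<in> V'" using V(2) Va D(2) by (auto simp: V'_def)
  have inj: "inj_on (src H) V'" "inj_on (rng H) V'" using V(4,5) by (auto simp: V'_def inj_on_def)
  have sV': "src H ` V' = D \<times> {0}"
  proof (intro subset_antisym subsetI)
    fix p assume "p \<in> src H ` V'"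
    then obtain h where h: "h \<in> arrows H" "fst (src H h) \<in> D" "p = src H h" by (auto simp: V'_def)
    then show "p \<in> D \<times> {0}" using H_src_in[OF h(1)] by (metis SigmaI singletonI)
  next
    fix p :: "'g \<times> int" assume "p \<in> D \<times> {0}"
    then obtain x where x: "x \<in> D" "p = (x, 0)" by auto
    then have "(x, 0) \<in> src H ` V" using D(3) by blast
    then obtain h where h: "h \<in> V" "src H h = (x, 0)" by (metis imageE)
    then have "h \<in> V'" using Va x by (simp add: V'_def)
    then show "p \<in> src H ` V'" using h x by (metis image_eqI)
  qed
  obtain f where "H.pm D f" "\<forall>k\<in>V'. rng H k = (f (fst (src H k)), 0)" "f ` D \<times> {0::int} = rng H ` V'"
    using bisection_pm[OF V' inj D(1) sV'] by blast
  moreover have "V' \<subseteq> W" using V(3) by (auto simp: V'_def)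
  ultimately show ?thesis using V' kV' sV' by blast
qed

text \<open>Around a unit of K the induced map is chosen to be the identity. By principality every
  other arrow of K has distinct source and range, and separating them makes the map leave its
  domain. Compactness of K leaves finitely many maps, and the groupoid structure of K becomes the
  equivalence relation.\<close>

lemma elementary_towers:
  assumes K: "elementary_subgroupoid K H"
  shows "\<exists>\<Phi>. H.towers \<Phi> \<and> (\<forall>x y. (x, y) \<in> H.graph \<Phi> \<longleftrightarrow> (\<exists>k\<in>K. src H k = (x, 0) \<and> rng H k = (y, 0)))"
proof -
  have sg: "subgroupoid K H" and cpt: "compactin AH K" and op: "openin AH K"
    and pr: "principal_groupoid (restrict_groupoid H K)" and un: "units (restrict_groupoid H K) = units H"
    using K by (auto simp: elementary_subgroupoid_def)
  have Ka: "k \<in> arrows H" if "k \<in> K" for k using that sg by (auto simp: subgroupoid_def)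
  have restr: "arrows (restrict_groupoid H K) = K" "src (restrict_groupoid H K) = src H"
    "rng (restrict_groupoid H K) = rng H"
    using openin_subset[OF op] by (auto simp: arrows_def restrict_groupoid_def src_def[abs_def] rng_def[abs_def])
  have iso: "k \<in> units H" if "k \<in> K" "rng H k = src H k" for k
    using pr that unfolding principal_groupoid_def restr un by blast
  have sK: "src H ` K = units H" using un unfolding units_def[of "restrict_groupoid H K"] restr by simp
  have good: "\<exists>V D f. openin AH V \<and> k \<in> V \<and> V \<subseteq> K \<and> src H ` V = D \<times> {0} \<and> H.pm D f \<and>
      (\<forall>k\<in>V. rng H k = (f (fst (src H k)), 0)) \<and> ((\<forall>x\<in>D. f x = x) \<or> f ` D \<inter> D = {})" if k: "k \<in> K" for k
  proof (cases "rng H k = src H k")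
    case True
    then have "openin AH (K \<inter> units H)" "k \<in> K \<inter> units H" using op H_units_open iso k by auto
    from H_clopen_section[OF this] obtain V D f where V: "openin AH V" "k \<in> V" "V \<subseteq> K \<inter> units H"
      "src H ` V = D \<times> {0}" "H.pm D f" "\<forall>k\<in>V. rng H k = (f (fst (src H k)), 0)" by (elim exE conjE)
    have "f x = x" if x: "x \<in> D" for x
    proof -
      have "(x, 0) \<in> src H ` V" using V(4) x by auto
      then obtain h where h: "h \<in> V" "src H h = (x, 0)" by (metis imageE)
      then have "h \<in> units H" using V(3) by blast
      then have "rng H h = src H h" using HG.units_src HG.units_rng by simp
      then show ?thesis using V(6) h by auto
    qed
    then show ?thesis using V by blast
  next
    case False
    have ka: "k \<in> arrows H" using k Ka by blast
    have ne: "fst (src H k) \<noteq> fst (rng H k)" using False H_src_in[OF ka] H_rng_in[OF ka] by metis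
    have xx: "fst (src H k) \<in> topspace T" "fst (rng H k) \<in> topspace T"
      using H_src_in[OF ka] H_rng_in[OF ka] topspace_unit by auto
    obtain S R where SR: "openin T S" "openin T R" "fst (src H k) \<in> S" "fst (rng H k) \<in> R" "S \<inter> R = {}"
      using H.Hausdorff_sep[OF xx ne] by blast
    define W where "W = K \<inter> {h \<in> arrows H. fst (src H h) \<in> S} \<inter> {h \<in> arrows H. fst (rng H h) \<in> R}"
    have W: "openin AH W" unfolding W_def using op H_src_preimage H_rng_preimage SR by (intro openin_Int) auto
    have kW: "k \<in> W" using k ka SR by (simp add: W_def)
    from H_clopen_section[OF W kW] obtain V D f where V: "openin AH V" "k \<in> V" "V \<subseteq> W" "src H ` V = D \<times> {0}" "H.pm D f"
      "\<forall>k\<in>V. rng H k = (f (fst (src H k)), 0)" "f ` D \<times> {0::int} = rng H ` V" by (elim exE conjE)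
    have "D \<subseteq> S"
    proof
      fix x assume "x \<in> D"
      then have "(x, 0) \<in> src H ` V" using V(4) by auto
      then obtain h where "h \<in> V" "src H h = (x, 0)" by (metis imageE)
      then have "h \<in> W" "fst (src H h) = x" using V(3) by auto
      then show "x \<in> S" by (simp add: W_def)
    qed
    moreover have "f ` D \<subseteq> R"
    proof
      fix y assume "y \<in> f ` D"
      then have "(y, 0) \<in> rng H ` V" unfolding V(7)[symmetric] by blast
      then obtain h where "h \<in> V" "rng H h = (y, 0)" by (metis imageE)
      then have "h \<in> W" "fst (rng H h) = y" using V(3) by auto
      then show "y \<in> R" by (simp add: W_def)
    qed
    ultimately have "f ` D \<inter> D = {}" using SR(5) by blast
    moreover have "V \<subseteq> K" using V(3) by (auto simp: W_def)
    ultimately show ?thesis using V by blast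
  qed
  define sec where "sec V p \<longleftrightarrow> src H ` V = fst p \<times> {0} \<and> H.pm (fst p) (snd p) \<and>
      (\<forall>k\<in>V. rng H k = (snd p (fst (src H k)), 0)) \<and>
      ((\<forall>x\<in>fst p. snd p x = x) \<or> snd p ` fst p \<inter> fst p = {})" for V p
  define \<V> where "\<V> = {V. openin AH V \<and> V \<subseteq> K \<and> (\<exists>p. sec V p)}"
  have "K \<subseteq> \<Union>\<V>"
  proof
    fix k assume "k \<in> K"
    from good[OF this] obtain V D f where "openin AH V" "k \<in> V" "V \<subseteq> K" "src H ` V = D \<times> {0}" "H.pm D f"
      "\<forall>k\<in>V. rng H k = (f (fst (src H k)), 0)" "(\<forall>x\<in>D. f x = x) \<or> f ` D \<inter> D = {}" by (elim exE conjE)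
    then have "sec V (D, f)" by (simp add: sec_def)
    then show "k \<in> \<Union>\<V>" unfolding \<V>_def using \<open>openin AH V\<close> \<open>k \<in> V\<close> \<open>V \<subseteq> K\<close> by blast
  qed
  moreover have "\<forall>V\<in>\<V>. openin AH V" by (simp add: \<V>_def)
  ultimately obtain \<F> where \<F>: "finite \<F>" "\<F> \<subseteq> \<V>" "K \<subseteq> \<Union>\<F>"
    using cpt unfolding compactin_def by meson
  define P where "P V = (SOME p. sec V p)" for V
  have "sec V (P V)" if V: "V \<in> \<F>" for V
  proof -
    have "\<exists>p. sec V p" using V \<F>(2) by (auto simp: \<V>_def)
    then show ?thesis unfolding P_def by (rule someI_ex)
  qed
  then have P: "src H ` V = fst (P V) \<times> {0}" "H.pm (fst (P V)) (snd (P V))"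
    "k \<in> V \<Longrightarrow> rng H k = (snd (P V) (fst (src H k)), 0)"
    "(\<forall>x\<in>fst (P V). snd (P V) x = x) \<or> snd (P V) ` fst (P V) \<inter> fst (P V) = {}" if "V \<in> \<F>" for V k
    using that unfolding sec_def by blast+
  define \<Phi> where "\<Phi> = P ` \<F>"
  have gr: "(x, y) \<in> H.graph \<Phi> \<longleftrightarrow> (\<exists>k\<in>K. src H k = (x, 0) \<and> rng H k = (y, 0))" for x y
  proof
    assume "(x, y) \<in> H.graph \<Phi>"
    then obtain D f where Df: "(D, f) \<in> \<Phi>" "x \<in> D" "y = f x" by (auto simp: H.graph_def)
    then obtain V where V: "V \<in> \<F>" "(D, f) = P V" by (auto simp: \<Phi>_def)
    then have DP: "D = fst (P V)" "f = snd (P V)" by (metis fst_conv, metis snd_conv)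
    then have "(x, 0) \<in> src H ` V" using P(1)[OF V(1)] Df(2) by auto
    then obtain k where k: "k \<in> V" "src H k = (x, 0)" by (metis imageE)
    then have "rng H k = (y, 0)" using P(3)[OF V(1) k(1)] Df(3) DP by simp
    moreover have "k \<in> K" using k V(1) \<F>(2) by (auto simp: \<V>_def)
    ultimately show "\<exists>k\<in>K. src H k = (x, 0) \<and> rng H k = (y, 0)" using k by blast
  next
    assume "\<exists>k\<in>K. src H k = (x, 0) \<and> rng H k = (y, 0)"
    then obtain k where k: "k \<in> K" "src H k = (x, 0)" "rng H k = (y, 0)" by blast
    then obtain V where V: "V \<in> \<F>" "k \<in> V" using \<F>(3) by blast
    have "src H k \<in> fst (P V) \<times> {0}" using P(1)[OF V(1)] V(2) by blast
    then have "x \<in> fst (P V)" using k(2) by simp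
    moreover have "y = snd (P V) x" using P(3)[OF V] k(2,3) by simp
    moreover have "(fst (P V), snd (P V)) \<in> \<Phi>" using V(1) by (simp add: \<Phi>_def)
    ultimately show "(x, y) \<in> H.graph \<Phi>" unfolding H.graph_def by blast
  qed
  have "equiv (topspace T) (H.graph \<Phi>)"
  proof (rule equivI)
    show "H.graph \<Phi> \<subseteq> topspace T \<times> topspace T"
    proof (rule subrelI)
      fix x y assume "(x, y) \<in> H.graph \<Phi>"
      then obtain k where k: "k \<in> K" "src H k = (x, 0)" "rng H k = (y, 0)" using gr by blast
      then show "(x, y) \<in> topspace T \<times> topspace T"
        using H_src_in[OF Ka[OF k(1)]] H_rng_in[OF Ka[OF k(1)]] by (simp add: topspace_unit)
    qed
    show "refl_on (topspace T) (H.graph \<Phi>)"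
    proof (rule refl_onI)
      fix x assume "x \<in> topspace T"
      then have "(x, 0) \<in> src H ` K" using sK H_simps(2) topspace_unit by auto
      then obtain k where k: "k \<in> K" "src H k = (x, 0)" by (metis imageE)
      have i: "ginv H k \<in> K" using k sg by (auto simp: subgroupoid_def)
      have "(ginv H k, k) \<in> composable H" using Ka[OF k(1)] HG.inv_closed HG.src_inv by (auto simp: composable_def)
      then have "src H k \<in> K" using i k(1) sg by (auto simp: subgroupoid_def src_def)
      then show "(x, x) \<in> H.graph \<Phi>" unfolding gr
        using HG.src_src[OF Ka[OF k(1)]] HG.rng_src[OF Ka[OF k(1)]] k(2) by (intro bexI[of _ "src H k"]) simp_all
    qed
    show "sym (H.graph \<Phi>)"
    proof (rule symI)
      fix x y assume "(x, y) \<in> H.graph \<Phi>"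
      then obtain k where k: "k \<in> K" "src H k = (x, 0)" "rng H k = (y, 0)" using gr by blast
      have "ginv H k \<in> K" using k sg by (auto simp: subgroupoid_def)
      then show "(y, x) \<in> H.graph \<Phi>" unfolding gr
        using HG.src_inv[OF Ka[OF k(1)]] HG.rng_inv[OF Ka[OF k(1)]] k by (intro bexI[of _ "ginv H k"]) simp_all
    qed
    show "trans (H.graph \<Phi>)"
    proof (rule transI)
      fix x y z assume "(x, y) \<in> H.graph \<Phi>" "(y, z) \<in> H.graph \<Phi>"
      then obtain k m where k: "k \<in> K" "src H k = (x, 0)" "rng H k = (y, 0)"
        and m: "m \<in> K" "src H m = (y, 0)" "rng H m = (z, 0)" using gr by blast
      have c: "(m, k) \<in> composable H" using k m Ka by (auto simp: composable_def)
      then have "gmult H m k \<in> K" using k m sg by (auto simp: subgroupoid_def)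
      moreover have "src H (gmult H m k) = (x, 0)" "rng H (gmult H m k) = (z, 0)"
        using HG.comp(2,3)[OF Ka[OF m(1)] Ka[OF k(1)]] k m by auto
      ultimately show "(x, z) \<in> H.graph \<Phi>" unfolding gr by blast
    qed
  qed
  moreover have "\<forall>(D, f) \<in> \<Phi>. H.pm D f \<and> ((\<forall>x\<in>D. f x = x) \<or> f ` D \<inter> D = {})"
    using P(2,4) unfolding \<Phi>_def by (simp add: case_prod_beta)
  ultimately have "H.towers \<Phi>" unfolding H.towers_def using \<F>(1) by (simp add: \<Phi>_def)
  then show ?thesis using gr by blast
qed

text \<open>Almost finiteness is applied to the union C of the bisections of \<alpha> and \<beta>.
  Each point of an orbit at which the arrow of \<alpha> or \<beta> is not in K yields a different
  element of the exceptional set, so the estimate bounds the number of such points.\<close>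

lemma afin_of_almost_finite:
  assumes af: "almost_finite H" shows H.afin
  unfolding H.afin_def
proof (intro ballI)
  fix \<alpha> \<beta> assume \<alpha>: "\<alpha> \<in> H.F" and \<beta>: "\<beta> \<in> H.F"
  obtain Wa where Wa: "full_bisection H Wa" "\<And>k. k\<in>Wa \<Longrightarrow> rng H k = (\<alpha> (fst (src H k)), 0)" using exists_bisection[OF \<alpha>] by blast
  obtain Wb where Wb: "full_bisection H Wb" "\<And>k. k\<in>Wb \<Longrightarrow> rng H k = (\<beta> (fst (src H k)), 0)" using exists_bisection[OF \<beta>] by blast
  define C where "C = Wa \<union> Wb"
  have "compactin AH C" using Wa Wb by (auto simp: C_def full_bisection_def compact_open_bisection_def intro: compactin_Un)
  then obtain K where K: "elementary_subgroupoid K H" and cnt: "\<And>x. x \<in> units H \<Longrightarrow>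
      real (card (gset_mult H C (src_fibre H K x) - src_fibre H K x)) / real (card (src_fibre H K x)) < 1/4"
    using af unfolding almost_finite_def by (metis zero_less_divide_1_iff zero_less_numeral)
  obtain \<Phi> where \<Phi>: "H.towers \<Phi>" "\<And>x y. (x, y) \<in> H.graph \<Phi> \<longleftrightarrow> (\<exists>k\<in>K. src H k = (x, 0) \<and> rng H k = (y, 0))"
    using elementary_towers[OF K] by blast
  have sg: "subgroupoid K H" and Kc: "closedin AH K" and op: "openin AH K"
    and pr: "principal_groupoid (restrict_groupoid H K)" and un: "units (restrict_groupoid H K) = units H"
    using K compactin_imp_closedin[OF H_Hausdorff] by (auto simp: elementary_subgroupoid_def)
  have Ka: "k \<in> arrows H" if "k \<in> K" for k using that sg by (auto simp: subgroupoid_def)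
  have restr: "arrows (restrict_groupoid H K) = K" "src (restrict_groupoid H K) = src H"
    "rng (restrict_groupoid H K) = rng H"
    using openin_subset[OF op] by (auto simp: arrows_def restrict_groupoid_def src_def[abs_def] rng_def[abs_def])
  have iso: "k \<in> units H" if "k \<in> K" "rng H k = src H k" for k
    using pr that unfolding principal_groupoid_def restr un by blast
  have Kinv: "ginv H k \<in> K" if "k \<in> K" for k using that sg by (auto simp: subgroupoid_def)
  have Kmult: "gmult H k m \<in> K" if "k \<in> K" "m \<in> K" "src H k = rng H m" for k m
    using that sg Ka by (auto simp: subgroupoid_def composable_def)
  have fin: "finite (H.graph \<Phi> `` {x})" for x
  proof -
    have "H.graph \<Phi> `` {x} \<subseteq> (\<lambda>p. snd p x) ` \<Phi>" by (force simp: H.graph_def)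
    then show ?thesis using \<Phi>(1) finite_surj by (auto simp: H.towers_def)
  qed
  \<comment> \<open>Principality makes the range map injective on a source fibre of K, so fibres and
    orbits have the same size.\<close>
  have orb: "bij_betw (\<lambda>k. fst (rng H k)) (src_fibre H K (x, 0)) (H.graph \<Phi> `` {x})" for x
    unfolding bij_betw_def
  proof
    show "inj_on (\<lambda>k. fst (rng H k)) (src_fibre H K (x, 0))"
    proof (rule inj_onI)
      fix k m assume "k \<in> src_fibre H K (x, 0)" "m \<in> src_fibre H K (x, 0)" and e: "fst (rng H k) = fst (rng H m)"
      then have k: "k \<in> K" "src H k = (x, 0)" and m: "m \<in> K" "src H m = (x, 0)" by (auto simp: src_fibre_def)
      have r: "rng H k = rng H m" using e H_rng_in[OF Ka[OF k(1)]] H_rng_in[OF Ka[OF m(1)]] by metis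
      have c: "src H (ginv H k) = rng H m" using HG.src_inv[OF Ka[OF k(1)]] r by simp
      note cc = HG.comp(2,3)[OF HG.inv_closed[OF Ka[OF k(1)]] Ka[OF m(1)] c]
      have "gmult H (ginv H k) m \<in> units H"
        by (rule iso[OF Kmult[OF Kinv[OF k(1)] m(1) c]]) (use cc HG.rng_inv[OF Ka[OF k(1)]] k m in simp)
      then show "k = m" using HG.isotropy_eq[OF Ka[OF k(1)] Ka[OF m(1)] r] by blast
    qed
    show "(\<lambda>k. fst (rng H k)) ` src_fibre H K (x, 0) = H.graph \<Phi> `` {x}"
    proof (intro subset_antisym subsetI)
      fix y assume "y \<in> (\<lambda>k. fst (rng H k)) ` src_fibre H K (x, 0)"
      then obtain k where k: "k \<in> K" "src H k = (x, 0)" "y = fst (rng H k)" by (auto simp: src_fibre_def)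
      then show "y \<in> H.graph \<Phi> `` {x}" using \<Phi>(2) H_rng_in[OF Ka[OF k(1)]] by auto
    next
      fix y assume "y \<in> H.graph \<Phi> `` {x}"
      then obtain k where k: "k \<in> K" "src H k = (x, 0)" "rng H k = (y, 0)" using \<Phi>(2) by auto
      then have "k \<in> src_fibre H K (x, 0)" "y = fst (rng H k)" by (simp_all add: src_fibre_def)
      then show "y \<in> (\<lambda>k. fst (rng H k)) ` src_fibre H K (x, 0)" by blast
    qed
  qed
  have finK: "finite (src_fibre H K (x, 0))" and cardK: "card (src_fibre H K (x, 0)) = card (H.graph \<Phi> `` {x})" for x
    using bij_betw_finite[OF orb] bij_betw_same_card[OF orb] fin by auto
  have inja: "inj_on (src H) Wa" "inj_on (src H) Wb" "openin AH Wa" "openin AH Wb" "src H ` Wa = units H" "src H ` Wb = units H"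
    using Wa(1) Wb(1) by (auto simp: full_bisection_def compact_open_bisection_def bisection_def)
  \<comment> \<open>\<open>card\<close> is 0 on infinite sets, so the estimate carries information
    only once the exceptional set is known to be finite. Each arrow of the fibre has at most two
    composable arrows in C, one from each bisection.\<close>
  have finC: "finite (gset_mult H C (src_fibre H K (x, 0)))" for x
  proof -
    have "gset_mult H C (src_fibre H K (x, 0)) \<subseteq>
        (\<lambda>k. gmult H (inv_into Wa (src H) (rng H k)) k) ` src_fibre H K (x, 0) \<union>
        (\<lambda>k. gmult H (inv_into Wb (src H) (rng H k)) k) ` src_fibre H K (x, 0)"
    proof
      fix p assume "p \<in> gset_mult H C (src_fibre H K (x, 0))"
      then obtain c k where c: "p = gmult H c k" "c \<in> C" "k \<in> src_fibre H K (x, 0)" "src H c = rng H k"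
        by (auto simp: gset_mult_def composable_def)
      then have "c = inv_into Wa (src H) (rng H k) \<or> c = inv_into Wb (src H) (rng H k)"
        using inja(1,2) unfolding C_def by (metis UnE inv_into_f_f)
      then show "p \<in> (\<lambda>k. gmult H (inv_into Wa (src H) (rng H k)) k) ` src_fibre H K (x, 0) \<union>
        (\<lambda>k. gmult H (inv_into Wb (src H) (rng H k)) k) ` src_fibre H K (x, 0)" using c(1,3) by blast
    qed
    then show ?thesis using finK by (meson finite_UnI finite_imageI finite_subset)
  qed
  have main: "\<exists>Y. clopenin T Y \<and> (\<forall>y\<in>Y. (y, \<gamma> y) \<in> H.graph \<Phi>) \<and>
      (\<forall>x\<in>topspace T. 4 * card (H.graph \<Phi> `` {x} - Y) < card (H.graph \<Phi> `` {x}))"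
    if \<gamma>: "\<gamma> \<in> H.F" and WC: "W \<subseteq> C" and m: "\<And>k. k\<in>W \<Longrightarrow> rng H k = (\<gamma> (fst (src H k)), 0)"
      and W: "inj_on (src H) W" "openin AH W" "src H ` W = units H" for \<gamma> W
  proof -
    \<comment> \<open>The units whose arrow in W lies in K. Being compact in a Hausdorff space, K is
      also closed, so W - K is open and its sources form the open complement of Y.\<close>
    define Y where "Y = {x. (x, 0) \<in> src H ` (W \<inter> K)}"
    have Ya: "k \<in> arrows H" if "k \<in> W" for k using that H_open_arrows W(2) by blast
    have Yo: "openin T Y" unfolding Y_def by (rule H_src_open) (use W op in auto)
    have "openin T {x. (x, 0) \<in> src H ` (W - K)}" by (rule H_src_open) (use W Kc in auto)
    moreover have "topspace T - Y = {x. (x, 0) \<in> src H ` (W - K)}"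
    proof (rule Set.set_eqI)
      fix x
      show "x \<in> topspace T - Y \<longleftrightarrow> x \<in> {x. (x, 0) \<in> src H ` (W - K)}"
      proof (cases "x \<in> G0")
        case True
        then have "(x, 0) \<in> src H ` W" using W(3) H_simps(2) by auto
        then obtain k where k: "k \<in> W" "src H k = (x, 0)" by (metis imageE)
        have "(x, 0) \<in> src H ` (W \<inter> S) \<longleftrightarrow> k \<in> S" for S
        proof
          assume "(x, 0) \<in> src H ` (W \<inter> S)"
          then obtain k' where "(x, 0) = src H k'" "k' \<in> W \<inter> S" by (rule imageE)
          then show "k \<in> S" using inj_onD[OF W(1), of k' k] k by simp
        next
          assume "k \<in> S"
          then show "(x, 0) \<in> src H ` (W \<inter> S)" using k by (intro image_eqI[of _ _ k]) simp_all
        qed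
        from this[of K] this[of "- K"] show ?thesis using True by (simp add: Y_def topspace_unit Diff_eq)
      next
        case False
        have "(x, 0) \<notin> src H ` W" using False W(3) H_simps(2) by auto
        then show ?thesis using False by (auto simp: topspace_unit)
      qed
    qed
    ultimately have Yc: "clopenin T Y" using Yo openin_subset[OF Yo] by (simp add: clopenin_def closedin_def)
    have "(y, \<gamma> y) \<in> H.graph \<Phi>" if "y \<in> Y" for y
    proof -
      have "(y, 0) \<in> src H ` (W \<inter> K)" using that by (simp add: Y_def)
      then obtain k where "(y, 0) = src H k" "k \<in> W \<inter> K" by (rule imageE)
      then show ?thesis unfolding \<Phi>(2) using m[of k] by (intro bexI[of _ k]) (simp_all flip: \<open>(y, 0) = src H k\<close>)
    qed
    moreover have "4 * card (H.graph \<Phi> `` {x} - Y) < card (H.graph \<Phi> `` {x})" if x: "x \<in> topspace T" for x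
    proof -
      define S where "S = gset_mult H C (src_fibre H K (x, 0)) - src_fibre H K (x, 0)"
      \<comment> \<open>For y in the orbit but not in Y, take k in K from x to y and the arrow u of
        W at y. Then w = u k is not in K, as otherwise u = w k^{-1} would be; and y is recovered
        from w as the preimage under \<gamma> of its range.\<close>
      have "H.graph \<Phi> `` {x} - Y \<subseteq> (\<lambda>w. inv_into G0 \<gamma> (fst (rng H w))) ` S"
      proof
        fix y assume y: "y \<in> H.graph \<Phi> `` {x} - Y"
        then obtain k where k: "k \<in> K" "src H k = (x, 0)" "rng H k = (y, 0)" using \<Phi>(2) by auto
        have yG: "y \<in> G0" using H_rng_in[OF Ka[OF k(1)]] k(3) by simp
        then have "(y, 0) \<in> src H ` W" using W(3) H_simps(2) by auto
        then obtain u where u: "u \<in> W" "src H u = (y, 0)" by (metis imageE)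
        have uK: "u \<notin> K"
        proof
          assume "u \<in> K"
          then have "(y, 0) \<in> src H ` (W \<inter> K)" using u by (metis IntI image_eqI)
          then show False using y by (simp add: Y_def)
        qed
        have c: "src H u = rng H k" using u k by simp
        define w where "w = gmult H u k"
        note cc = HG.comp[OF Ya[OF u(1)] Ka[OF k(1)] c, folded w_def]
        have "w \<in> gset_mult H C (src_fibre H K (x, 0))"
        proof -
          have "u \<in> C" "k \<in> src_fibre H K (x, 0)" "(u, k) \<in> composable H"
            using u(1) WC k c Ya[OF u(1)] Ka[OF k(1)] by (auto simp: src_fibre_def composable_def)
          then show ?thesis unfolding gset_mult_def w_def by blast
        qed
        moreover have "w \<notin> K"
        proof
          assume "w \<in> K"
          then have "gmult H w (ginv H k) \<in> K"
            using Kmult Kinv[OF k(1)] cc(2) HG.rng_inv[OF Ka[OF k(1)]] by simp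
          then show False using cc(5) uK by simp
        qed
        ultimately have "w \<in> S" by (auto simp: S_def src_fibre_def)
        moreover have "inv_into G0 \<gamma> (fst (rng H w)) = y"
        proof -
          have "fst (rng H w) = \<gamma> y" using cc(3) m[OF u(1)] u(2) by simp
          moreover have "inj_on \<gamma> G0" using H.F_inj[OF \<gamma>] by (auto simp: inj_on_def topspace_unit)
          ultimately show ?thesis using yG by simp
        qed
        ultimately show "y \<in> (\<lambda>w. inv_into G0 \<gamma> (fst (rng H w))) ` S" by (metis image_eqI)
      qed
      moreover have fS: "finite S" using finC by (simp add: S_def)
      ultimately have le: "card (H.graph \<Phi> `` {x} - Y) \<le> card S" by (rule surj_card_le[rotated])
      have "equiv (topspace T) (H.graph \<Phi>)" using \<Phi>(1) by (simp add: H.towers_def)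
      then have "x \<in> H.graph \<Phi> `` {x}" using x by (rule equiv_class_self)
      then have pos: "card (H.graph \<Phi> `` {x}) > 0" using fin card_gt_0_iff by blast
      have "(x, 0) \<in> units H" using x H_simps(2) by (simp add: topspace_unit)
      from cnt[OF this] have "4 * card S < card (H.graph \<Phi> `` {x})"
        using pos unfolding S_def[symmetric] cardK by (simp add: field_simps)
      then show ?thesis using le by simp
    qed
    ultimately show ?thesis using Yc by blast
  qed
  obtain Y where Y: "clopenin T Y" "\<forall>y\<in>Y. (y, \<alpha> y) \<in> H.graph \<Phi>"
      "\<forall>x\<in>topspace T. 4 * card (H.graph \<Phi> `` {x} - Y) < card (H.graph \<Phi> `` {x})"
    using main[OF \<alpha> _ Wa(2) inja(1,3,5)] by (auto simp: C_def)
  obtain Z where Z: "clopenin T Z" "\<forall>y\<in>Z. (y, \<beta> y) \<in> H.graph \<Phi>"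
      "\<forall>x\<in>topspace T. 4 * card (H.graph \<Phi> `` {x} - Z) < card (H.graph \<Phi> `` {x})"
    using main[OF \<beta> _ Wb(2) inja(2,4,6)] by (auto simp: C_def)
  show "\<exists>\<Phi> Y Z. H.towers \<Phi> \<and> clopenin T Y \<and> clopenin T Z \<and>
     (\<forall>y\<in>Y. (y, \<alpha> y) \<in> H.graph \<Phi>) \<and> (\<forall>z\<in>Z. (z, \<beta> z) \<in> H.graph \<Phi>) \<and>
     (\<forall>x\<in>topspace T. 4 * card (H.graph \<Phi> `` {x} - Y) < card (H.graph \<Phi> `` {x}) \<and>
            4 * card (H.graph \<Phi> `` {x} - Z) < card (H.graph \<Phi> `` {x}))"
    using \<Phi>(1) Y Z by blast
qed

end

section \<open>The normalizer of an extended derived subgroup\<close>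

text \<open>Conjugation is a homomorphism, so it maps the derived subgroup of S onto that of the
  conjugate of S, which is contained in S.\<close>

lemma (in group) derived_conj_stable:
  assumes S: "S \<subseteq> carrier G" and s: "s \<in> carrier G" and stable: "\<And>x. x \<in> S \<Longrightarrow> s \<otimes> x \<otimes> inv s \<in> S"
    and d: "d \<in> derived G S"
  shows "s \<otimes> d \<otimes> inv s \<in> derived G S"
proof -
  interpret c: group_hom G G "\<lambda>x. s \<otimes> x \<otimes> inv s"
    by unfold_locales (use s conj_mult in \<open>auto simp: hom_def\<close>)
  have "s \<otimes> d \<otimes> inv s \<in> derived G ((\<lambda>x. s \<otimes> x \<otimes> inv s) ` S)"
    unfolding c.derived_img[OF S] using d by blast
  then show ?thesis using mono_derived[of "(\<lambda>x. s \<otimes> x \<otimes> inv s) ` S" S] stable by blast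
qed

text \<open>The purely group-theoretic part. FG together with FG t is a subgroup Nm, since t is an
  involution normalizing FG, and \<open>norm\<close> confines the normalizer to it. Two elements of
  DH in FG t differ by an element of FG \<inter> DH, which \<open>inj\<close> places in DG, so they
  form a single coset of DG.\<close>

lemma (in group) normalizer_extension:
  fixes FG FH t
  defines "DG \<equiv> derived G FG" and "DH \<equiv> derived G FH"
  assumes FG: "subgroup FG G" and FH: "subgroup FH G" and sub: "FG \<subseteq> FH"
    and t: "t \<in> FH" "t \<notin> FG" "t \<otimes> t = \<one>" and tFG: "\<And>x. x \<in> FG \<Longrightarrow> t \<otimes> x \<otimes> t \<in> FG"
    and norm: "\<And>x. x \<in> FH \<Longrightarrow> (\<And>d. d \<in> DG \<Longrightarrow> x \<otimes> d \<otimes> inv x \<in> FG) \<Longrightarrow> x \<in> FG \<or> x \<otimes> t \<in> FG"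
    and max: "\<And>K x. subgroup K G \<Longrightarrow> K \<subseteq> FH \<Longrightarrow> DG \<subseteq> K \<Longrightarrow> x \<in> K \<Longrightarrow> x \<notin> FG \<Longrightarrow> x \<otimes> t \<notin> FG \<Longrightarrow> DH \<subseteq> K"
    and proper: "\<exists>d\<in>DH. d \<notin> FG \<and> d \<otimes> t \<notin> FG"
    and inj: "FG \<inter> DH \<subseteq> DG"
    and b: "b \<in> FG" "b \<otimes> t \<in> DH"
  shows "DG \<inter> (DG #> (b \<otimes> t)) = {} \<and>
    DG \<union> (DG #> (b \<otimes> t)) = {x \<in> DH. x \<in> FG \<or> x \<otimes> t \<in> FG} \<and>
    DG \<union> (DG #> (b \<otimes> t)) = normalizer (G\<lparr>carrier := DH\<rparr>) DG \<and>
    maximal_subgroup (DG \<union> (DG #> (b \<otimes> t))) (G\<lparr>carrier := DH\<rparr>) \<and>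
    DG \<lhd> G\<lparr>carrier := DG \<union> (DG #> (b \<otimes> t))\<rparr> \<and>
    card (rcosets\<^bsub>G\<lparr>carrier := DG \<union> (DG #> (b \<otimes> t))\<rparr>\<^esub> DG) = 2"
proof -
  have C: "x \<in> carrier G" if "x \<in> FH" for x using that subgroup.mem_carrier[OF FH] by blast
  have CG: "x \<in> carrier G" if "x \<in> FG" for x using that subgroup.mem_carrier[OF FG] by blast
  have sDG: "subgroup DG G" unfolding DG_def by (rule derived_is_subgroup) (use CG in blast)
  have sDH: "subgroup DH G" unfolding DH_def by (rule derived_is_subgroup) (use C in blast)
  have DGH: "DG \<subseteq> DH" unfolding DG_def DH_def by (rule mono_derived[OF sub])
  have DGF: "DG \<subseteq> FG" unfolding DG_def by (rule derived_incl[OF order_refl FG])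
  have DHF: "DH \<subseteq> FH" unfolding DH_def by (rule derived_incl[OF order_refl FH])
  note mG = subgroup.m_closed[OF FG] and iG = subgroup.m_inv_closed[OF FG]
  note mD = subgroup.m_closed[OF sDG] and iD = subgroup.m_inv_closed[OF sDG]
  note mH = subgroup.m_closed[OF sDH] and iH = subgroup.m_inv_closed[OF sDH]
  have tc: "t \<in> carrier G" and bc: "b \<in> carrier G" using t(1) C b(1) CG by auto
  have ti: "inv t = t" using inv_equality[OF t(3) tc tc] .
  have tt: "x \<otimes> t \<otimes> t = x" if "x \<in> carrier G" for x using that tc t(3) by (simp add: m_assoc)
  define Nm where "Nm = {x \<in> FH. x \<in> FG \<or> x \<otimes> t \<in> FG}"
  have NmI: "x \<otimes> t \<in> Nm" if "x \<in> FG" for x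
    using that sub t(1) subgroup.m_closed[OF FH] tt CG by (auto simp: Nm_def)
  have NmG: "x \<in> Nm" if "x \<in> FG" for x using that sub by (auto simp: Nm_def)
  have NmE: "x \<in> FG \<or> (\<exists>g\<in>FG. x = g \<otimes> t)" if "x \<in> Nm" for x
  proof -
    have "x \<in> FG \<or> x \<otimes> t \<in> FG" "x \<in> carrier G" using that C by (auto simp: Nm_def)
    then show ?thesis using tt by metis
  qed
  have tg: "t \<otimes> g = (t \<otimes> g \<otimes> t) \<otimes> t" if "g \<in> FG" for g using CG[OF that] tc tt by simp
  have sNm: "subgroup Nm G"
  proof (rule subgroupI)
    show "Nm \<subseteq> carrier G" using C by (auto simp: Nm_def)
    show "Nm \<noteq> {}" using NmG b(1) by blast
    show "inv x \<in> Nm" if x: "x \<in> Nm" for x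
      using NmE[OF x]
    proof
      assume "x \<in> FG" then show ?thesis using NmG iG by blast
    next
      assume "\<exists>g\<in>FG. x = g \<otimes> t"
      then obtain g where g: "g \<in> FG" "x = g \<otimes> t" by blast
      then have "inv x = t \<otimes> inv g" using CG tc ti inv_mult_group by simp
      then show ?thesis using NmI[OF tFG[OF iG[OF g(1)]]] tg[OF iG[OF g(1)]] by simp
    qed
    show "x \<otimes> y \<in> Nm" if x: "x \<in> Nm" and y: "y \<in> Nm" for x y
    proof -
      have l: "g \<otimes> y \<in> Nm" if "g \<in> FG" for g
        using NmE[OF y]
      proof
        assume "y \<in> FG" then show ?thesis using NmG mG that by blast
      next
        assume "\<exists>h\<in>FG. y = h \<otimes> t"
        then obtain h where h: "h \<in> FG" "y = h \<otimes> t" by blast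
        then have "g \<otimes> y = (g \<otimes> h) \<otimes> t" using CG that tc by (simp add: m_assoc)
        then show ?thesis using NmI mG that h(1) by simp
      qed
      have ty: "t \<otimes> y \<in> Nm"
        using NmE[OF y]
      proof
        assume "y \<in> FG" then show ?thesis using NmI[OF tFG] tg by simp
      next
        assume "\<exists>h\<in>FG. y = h \<otimes> t"
        then obtain h where h: "h \<in> FG" "y = h \<otimes> t" by blast
        then have "t \<otimes> y = t \<otimes> h \<otimes> t" using CG tc by (simp add: m_assoc)
        then show ?thesis using NmG tFG h(1) by simp
      qed
      have yc: "y \<in> carrier G" using y C by (auto simp: Nm_def)
      from NmE[OF x] show ?thesis
      proof
        assume "x \<in> FG" then show ?thesis using l by blast
      next
        assume "\<exists>g\<in>FG. x = g \<otimes> t"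
        then obtain g where g: "g \<in> FG" "x = g \<otimes> t" by blast
        have xy: "x \<otimes> y = g \<otimes> (t \<otimes> y)" using g CG tc yc by (simp add: m_assoc)
        from NmE[OF ty] show ?thesis
        proof
          assume "t \<otimes> y \<in> FG" then show ?thesis using xy NmG mG g(1) by simp
        next
          assume "\<exists>h\<in>FG. t \<otimes> y = h \<otimes> t"
          then obtain h where h: "h \<in> FG" "t \<otimes> y = h \<otimes> t" by blast
          then have "x \<otimes> y = (g \<otimes> h) \<otimes> t" using xy g CG tc by (simp add: m_assoc)
          then show ?thesis using NmI mG g(1) h(1) by simp
        qed
      qed
    qed
  qed
  have NmF: "x \<otimes> f \<otimes> inv x \<in> FG" if x: "x \<in> Nm" and f: "f \<in> FG" for x f
    using NmE[OF x]
  proof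
    assume "x \<in> FG" then show ?thesis using mG iG f by blast
  next
    assume "\<exists>g\<in>FG. x = g \<otimes> t"
    then obtain g where g: "g \<in> FG" "x = g \<otimes> t" by blast
    have "x \<otimes> f \<otimes> inv x = g \<otimes> (t \<otimes> f \<otimes> t) \<otimes> inv g"
      using g CG[OF g(1)] CG[OF f] tc ti by (simp add: inv_mult_group m_assoc)
    then show ?thesis using mG iG g(1) tFG f by simp
  qed
  have NmD: "x \<otimes> d \<otimes> inv x \<in> DG" if x: "x \<in> Nm" and d: "d \<in> DG" for x d
    unfolding DG_def
    by (rule derived_conj_stable[OF subgroup.subset[OF FG]])
      (use x d NmF subgroup.mem_carrier[OF sNm] in \<open>auto simp: DG_def\<close>)
  define m where "m = b \<otimes> t"
  have m: "m \<in> DH" "m \<in> carrier G" "m \<in> Nm" using b NmI bc tc by (auto simp: m_def)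
  have cos: "x \<in> DG #> m \<longleftrightarrow> (\<exists>d\<in>DG. x = d \<otimes> m)" for x by (auto simp: r_coset_def)
  define M where "M = DG \<union> (DG #> m)"
  \<comment> \<open>The right-hand side does not involve b; this is the independence of the choice.
    As an intersection of subgroups it is also visibly a subgroup.\<close>
  have M_eq: "M = DH \<inter> Nm"
  proof (intro subset_antisym subsetI)
    fix x assume "x \<in> M"
    then consider "x \<in> DG" | d where "d \<in> DG" "x = d \<otimes> m" unfolding M_def using cos by blast
    then show "x \<in> DH \<inter> Nm"
    proof cases
      case 1 then show ?thesis using DGH DGF NmG by blast
    next
      case 2
      then have "x \<in> DH" using DGH m(1) mH by blast
      moreover have "x \<in> Nm" using 2 m(3) DGF NmG subgroup.m_closed[OF sNm] by blast
      ultimately show ?thesis by blast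
    qed
  next
    fix x assume x: "x \<in> DH \<inter> Nm"
    then have xN: "x \<in> Nm" by blast
    from NmE[OF xN] show "x \<in> M"
    proof
      assume "x \<in> FG" then show ?thesis using x inj by (auto simp: M_def)
    next
      assume "\<exists>g\<in>FG. x = g \<otimes> t"
      then obtain g where g: "g \<in> FG" "x = g \<otimes> t" by blast
      have gc: "g \<in> carrier G" using CG g(1) by blast
      \<comment> \<open>With x = g t and m = b t the involution cancels, and the quotient g b^{-1}
        lies in FG as well as in DH.\<close>
      have "x \<otimes> inv m = g \<otimes> ((t \<otimes> t) \<otimes> inv b)"
        unfolding m_def g(2) using gc bc tc ti by (simp only: inv_mult_group m_assoc m_closed inv_closed)
      then have "x \<otimes> inv m = g \<otimes> inv b" using t(3) bc by simp
      moreover have "x \<otimes> inv m \<in> DH" using x m(1) mH iH by blast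
      ultimately have "x \<otimes> inv m \<in> DG" using inj mG[OF g(1) iG[OF b(1)]] by auto
      moreover have "x = (x \<otimes> inv m) \<otimes> m" using m(2) gc tc g(2) by (simp add: m_assoc)
      ultimately show ?thesis unfolding M_def using cos by blast
    qed
  qed
  have sM: "subgroup M G" unfolding M_eq using subgroups_Inter_pair[OF sDH sNm] .
  have MDH: "M \<subseteq> DH" using M_eq by blast
  have DGM: "DG \<subseteq> M" by (simp add: M_def)
  have disj: "DG \<inter> (DG #> m) = {}"
  proof (rule ccontr)
    assume "DG \<inter> (DG #> m) \<noteq> {}"
    then obtain d where "d \<in> DG" "d \<in> DG #> m" by (meson IntE equals0I)
    moreover from this obtain d' where "d' \<in> DG" "d = d' \<otimes> m" unfolding cos by (elim bexE)
    ultimately have d: "d \<in> DG" "d' \<in> DG" "d = d' \<otimes> m" by auto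
    then have "d \<in> FG" "d' \<in> FG" "d' \<in> carrier G" using DGF CG by auto
    have "t = inv b \<otimes> (inv d' \<otimes> d)"
      using d(3) bc tc \<open>d' \<in> carrier G\<close> by (simp add: m_def inv_solve_left m_assoc[symmetric])
    then have "t \<in> FG" using \<open>d \<in> FG\<close> \<open>d' \<in> FG\<close> b(1) mG iG by metis
    then show False using t(2) by blast
  qed
  have invH: "inv\<^bsub>G\<lparr>carrier := DH\<rparr>\<^esub> x = inv x" if "x \<in> DH" for x using m_inv_consistent[OF sDH that] .
  have nrm: "normalizer (G\<lparr>carrier := DH\<rparr>) DG = M"
  proof -
    \<comment> \<open>\<open>normalizer\<close> is the stabilizer of DG under conjugation on
      subsets, so equality of DG with its conjugate is required. For x in Nm this is obtained by
      treating both x and its inverse.\<close>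
    have "x \<in> normalizer (G\<lparr>carrier := DH\<rparr>) DG \<longleftrightarrow> x \<in> DH \<and> (\<lambda>d. x \<otimes> d \<otimes> inv x) ` DG = DG" for x
    proof (cases "x \<in> DH")
      case True
      have "x <# DG #> inv x = (\<lambda>d. x \<otimes> d \<otimes> inv x) ` DG" by (auto simp: l_coset_def r_coset_def)
      then show ?thesis using True DGH invH[OF True]
        unfolding normalizer_def stabilizer_def by (simp add: l_coset_def r_coset_def)
    next
      case False
      then show ?thesis unfolding normalizer_def stabilizer_def by simp
    qed
    moreover have "(\<lambda>d. x \<otimes> d \<otimes> inv x) ` DG = DG \<longleftrightarrow> x \<in> Nm" if x: "x \<in> DH" for x
    proof
      assume e: "(\<lambda>d. x \<otimes> d \<otimes> inv x) ` DG = DG"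
      have "x \<in> FG \<or> x \<otimes> t \<in> FG" by (rule norm) (use e x DHF DGF in blast)+
      then show "x \<in> Nm" using x DHF by (auto simp: Nm_def)
    next
      assume xN: "x \<in> Nm"
      have xc: "x \<in> carrier G" using xN subgroup.mem_carrier[OF sNm] by blast
      show "(\<lambda>d. x \<otimes> d \<otimes> inv x) ` DG = DG"
      proof (intro subset_antisym subsetI)
        show "d \<in> DG" if "d \<in> (\<lambda>d. x \<otimes> d \<otimes> inv x) ` DG" for d using that NmD[OF xN] by blast
        fix d assume d: "d \<in> DG"
        have dc: "d \<in> carrier G" using d subgroup.mem_carrier[OF sDG] by blast
        have ix: "inv x \<in> Nm" using subgroup.m_inv_closed[OF sNm xN] .
        have "inv x \<otimes> d \<otimes> x \<in> DG" using NmD[OF ix d] xc by simp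
        moreover have "d = x \<otimes> (inv x \<otimes> d \<otimes> x) \<otimes> inv x"
        proof -
          have "x \<otimes> (inv x \<otimes> d \<otimes> x) \<otimes> inv x = (x \<otimes> inv x) \<otimes> d \<otimes> (x \<otimes> inv x)"
            using xc dc by (simp only: m_assoc m_closed inv_closed)
          then show ?thesis using xc dc by simp
        qed
        ultimately show "d \<in> (\<lambda>d. x \<otimes> d \<otimes> inv x) ` DG" by blast
      qed
    qed
    ultimately show ?thesis unfolding M_eq by blast
  qed
  have mx: "maximal_subgroup M (G\<lparr>carrier := DH\<rparr>)"
    unfolding maximal_subgroup_def
  proof (intro conjI allI impI)
    show "subgroup M (G\<lparr>carrier := DH\<rparr>)" using subgroup_incl[OF sM sDH MDH] .
    show "M \<noteq> carrier (G\<lparr>carrier := DH\<rparr>)" using proper DHF by (auto simp: M_eq Nm_def)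
    fix K assume K: "subgroup K (G\<lparr>carrier := DH\<rparr>) \<and> M \<subseteq> K"
    have KG: "subgroup K G" using incl_subgroup[OF sDH] K by blast
    have KH: "K \<subseteq> DH" using K subgroup.subset by fastforce
    show "K = M \<or> K = carrier (G\<lparr>carrier := DH\<rparr>)"
    proof (cases "K \<subseteq> M")
      case True then show ?thesis using K by blast
    next
      case False
      then obtain x where x: "x \<in> K" "x \<notin> M" by blast
      then have "x \<notin> FG" "x \<otimes> t \<notin> FG" using KH DHF by (auto simp: M_eq Nm_def)
      then have "DH \<subseteq> K" using max[OF KG _ _ x(1)] KH DHF DGM K by blast
      then show ?thesis using KH by simp
    qed
  qed
  have gM: "group (G\<lparr>carrier := M\<rparr>)" using subgroup_imp_group[OF sM] .
  have nm: "DG \<lhd> G\<lparr>carrier := M\<rparr>"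
  proof -
    have "subgroup DG (G\<lparr>carrier := M\<rparr>)" using subgroup_incl[OF sDG sM DGM] .
    moreover have "x \<otimes> d \<otimes> inv\<^bsub>G\<lparr>carrier := M\<rparr>\<^esub> x \<in> DG" if "x \<in> M" "d \<in> DG" for x d
      using NmD[of x d] that m_inv_consistent[OF sM that(1)] by (simp add: M_eq)
    ultimately show ?thesis unfolding group.normal_inv_iff[OF gM] by simp
  qed
  have "rcosets\<^bsub>G\<lparr>carrier := M\<rparr>\<^esub> DG = {DG, DG #> m}"
  proof -
    have r: "DG #>\<^bsub>G\<lparr>carrier := M\<rparr>\<^esub> x = DG #> x" for x by (simp add: r_coset_def)
    have "rcosets\<^bsub>G\<lparr>carrier := M\<rparr>\<^esub> DG = (\<lambda>x. DG #> x) ` M" by (auto simp: RCOSETS_def r)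
    also have "\<dots> = {DG, DG #> m}"
    proof (intro subset_antisym subsetI)
      fix c assume "c \<in> (\<lambda>x. DG #> x) ` M"
      then obtain x where x: "x \<in> M" "c = DG #> x" by blast
      show "c \<in> {DG, DG #> m}"
      proof (cases "x \<in> DG")
        case True
        then show ?thesis using x(2) coset_join2[OF _ sDG True] subgroup.mem_carrier[OF sDG] by simp
      next
        case False
        then have "x \<in> DG #> m" using x(1) by (simp add: M_def)
        then show ?thesis using x(2) repr_independence[OF _ m(2) sDG] by simp
      qed
    next
      fix c assume c: "c \<in> {DG, DG #> m}"
      have "\<one> \<in> M" "DG #> \<one> = DG" "m \<in> M"
        using subgroup.one_closed[OF sM] coset_mult_one[OF subgroup.subset[OF sDG]] m by (auto simp: M_eq)
      then show "c \<in> (\<lambda>x. DG #> x) ` M" using c by (metis image_eqI insertE singletonD)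
    qed
    finally show ?thesis .
  qed
  moreover have "DG \<noteq> DG #> m"
    using disj subgroup.one_closed[OF sDG] by blast
  ultimately have "card (rcosets\<^bsub>G\<lparr>carrier := M\<rparr>\<^esub> DG) = 2" by simp
  moreover have "M = {x \<in> DH. x \<in> FG \<or> x \<otimes> t \<in> FG}" unfolding M_eq Nm_def using DHF by blast
  ultimately show ?thesis
    using disj nrm mx nm unfolding M_def m_def by simp
qed

lemma (in group) subgroup_set_mult_absorb:
  assumes "subgroup D G" "S \<subseteq> D" "S \<noteq> {}" shows "D <#> S = D"
proof (intro subset_antisym subsetI)
  fix x assume "x \<in> D <#> S"
  then show "x \<in> D" using assms subgroup.m_closed[OF assms(1)] by (auto simp: set_mult_def)
next
  fix x assume x: "x \<in> D"
  obtain s where s: "s \<in> S" using assms by blast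
  then have sD: "s \<in> D" using assms by blast
  have c: "x \<in> carrier G" "s \<in> carrier G" using x sD subgroup.mem_carrier[OF assms(1)] by auto
  have "x \<otimes> inv s \<in> D" using x sD subgroup.m_closed[OF assms(1)] subgroup.m_inv_closed[OF assms(1)] by blast
  moreover have "x = (x \<otimes> inv s) \<otimes> s" using c by (simp add: m_assoc)
  ultimately show "x \<in> D <#> S" using s by (auto simp: set_mult_def)
qed

text \<open>A kernel element has the same image coset as the identity.\<close>

lemma abelianization_map_inj_kernel:
  assumes G: "group \<Gamma>" "group \<Delta>" and h: "\<phi> \<in> hom \<Gamma> \<Delta>"
    and inj: "inj_on (abelianization_map \<Gamma> \<Delta> \<phi>) (carrier (abelianization \<Gamma>))"
    and x: "x \<in> carrier \<Gamma>" "\<phi> x \<in> derived \<Delta> (carrier \<Delta>)"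
  shows "x \<in> derived \<Gamma> (carrier \<Gamma>)"
proof -
  interpret \<Gamma>: group \<Gamma> by fact
  interpret \<Delta>: group \<Delta> by fact
  interpret h: group_hom \<Gamma> \<Delta> \<phi> using h by unfold_locales
  define D where "D = derived \<Gamma> (carrier \<Gamma>)"
  define D' where "D' = derived \<Delta> (carrier \<Delta>)"
  have D: "subgroup D \<Gamma>" "subgroup D' \<Delta>"
    unfolding D_def D'_def using \<Gamma>.derived_is_subgroup \<Delta>.derived_is_subgroup by blast+
  have D\<Gamma>: "D \<subseteq> carrier \<Gamma>" using subgroup.subset[OF D(1)] .
  have im: "\<phi> ` D \<subseteq> D'"
  proof -
    have "\<phi> ` carrier \<Gamma> \<subseteq> carrier \<Delta>" by auto
    then show ?thesis unfolding D_def D'_def h.derived_img[OF order_refl, symmetric] by (rule \<Delta>.mono_derived)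
  qed
  have val: "abelianization_map \<Gamma> \<Delta> \<phi> (D #>\<^bsub>\<Gamma>\<^esub> y) = D'" "D #>\<^bsub>\<Gamma>\<^esub> y \<in> carrier (abelianization \<Gamma>)"
    if y: "y \<in> carrier \<Gamma>" "\<phi> y \<in> D'" for y
  proof -
    show c: "D #>\<^bsub>\<Gamma>\<^esub> y \<in> carrier (abelianization \<Gamma>)"
      using y(1) by (auto simp: abelianization_def FactGroup_def RCOSETS_def D_def)
    have "\<phi> ` (D #>\<^bsub>\<Gamma>\<^esub> y) \<subseteq> D'"
    proof
      fix z assume "z \<in> \<phi> ` (D #>\<^bsub>\<Gamma>\<^esub> y)"
      then obtain d where d: "d \<in> D" "z = \<phi> (d \<otimes>\<^bsub>\<Gamma>\<^esub> y)" by (auto simp: r_coset_def)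
      then have "z = \<phi> d \<otimes>\<^bsub>\<Delta>\<^esub> \<phi> y" using D\<Gamma> y by auto
      moreover have "\<phi> d \<in> D'" using im d by blast
      ultimately show "z \<in> D'" using y(2) subgroup.m_closed[OF D(2)] by blast
    qed
    moreover have "\<phi> ` (D #>\<^bsub>\<Gamma>\<^esub> y) \<noteq> {}" using \<Gamma>.rcos_self[OF y(1) D(1)] by blast
    ultimately show "abelianization_map \<Gamma> \<Delta> \<phi> (D #>\<^bsub>\<Gamma>\<^esub> y) = D'"
      unfolding abelianization_map_def using c \<Delta>.subgroup_set_mult_absorb[OF D(2)] by (simp add: D'_def)
  qed
  have "\<phi> \<one>\<^bsub>\<Gamma>\<^esub> \<in> D'" using subgroup.one_closed[OF D(2)] by simp
  then have "D #>\<^bsub>\<Gamma>\<^esub> x = D #>\<^bsub>\<Gamma>\<^esub> \<one>\<^bsub>\<Gamma>\<^esub>"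
    using val[of x] val[of "\<one>\<^bsub>\<Gamma>\<^esub>"] x inj unfolding D'_def[symmetric] by (metis \<Gamma>.one_closed inj_onD)
  also have "\<dots> = D" using \<Gamma>.coset_mult_one[OF D\<Gamma>] .
  finally show ?thesis using \<Gamma>.rcos_self[OF x(1) D(1)] by (simp add: D_def)
qed

section \<open>Transport along \<iota> to permutations of the units of H\<close>

context semidirect_Z2 begin

abbreviation "BT \<equiv> BijGroup (topspace T)"
abbreviation "BH \<equiv> BijGroup (units H)"

lemma \<iota>_Bij: assumes "f \<in> Bij (topspace T)" shows "\<iota> f \<in> Bij (units H)"
proof -
  have f: "bij_betw f G0 G0" using assms by (simp add: Bij_def topspace_unit)
  have "bij_betw (\<iota> f) (units H) (units H)"
    unfolding H_simps(2)
  proof (rule bij_betw_imageI)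
    show "inj_on (\<iota> f) (G0 \<times> {0})" using f \<iota>_apply by (auto simp: inj_on_def bij_betw_def)
    have "\<iota> f ` (G0 \<times> {0}) = (f ` G0) \<times> {0}" using \<iota>_apply by (auto simp: image_iff)
    then show "\<iota> f ` (G0 \<times> {0}) = G0 \<times> {0}" using f by (simp add: bij_betw_def)
  qed
  then show ?thesis using \<iota>_extensional by (simp add: Bij_def)
qed

lemma \<iota>_eqI: "(\<And>x. x \<in> G0 \<Longrightarrow> f x = g x) \<Longrightarrow> \<iota> f = \<iota> g"
  using \<iota>_apply H_simps(2) by (intro extensionalityI[OF \<iota>_extensional \<iota>_extensional]) auto

lemma \<iota>_inj: "inj_on \<iota> (carrier BT)"
proof (rule inj_onI)
  fix f g assume fg: "f \<in> carrier BT" "g \<in> carrier BT" "\<iota> f = \<iota> g"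
  show "f = g"
    by (rule Bij_eqI[of _ "topspace T"])
      (use fg \<iota>_apply[of _ f] \<iota>_apply[of _ g] in \<open>auto simp: BijGroup_carrier topspace_unit\<close>)
qed

lemma \<iota>_hom: "\<iota> \<in> hom BT BH"
proof (rule homI)
  show "\<iota> f \<in> carrier BH" if "f \<in> carrier BT" for f using \<iota>_Bij that by (simp add: BijGroup_carrier)
  fix f g assume "f \<in> carrier BT" "g \<in> carrier BT"
  then have fg: "f \<in> Bij (topspace T)" "g \<in> Bij (topspace T)" by (simp_all add: BijGroup_carrier)
  have "f \<otimes>\<^bsub>BT\<^esub> g \<in> Bij (topspace T)" using fg G.B.m_closed by (simp add: BijGroup_carrier)
  have mH: "\<iota> f \<otimes>\<^bsub>BH\<^esub> \<iota> g \<in> Bij (units H)"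
    using fg \<iota>_Bij monoid.m_closed[OF group.is_monoid[OF group_BijGroup]] by (metis BijGroup_carrier)
  show "\<iota> (f \<otimes>\<^bsub>BT\<^esub> g) = \<iota> f \<otimes>\<^bsub>BH\<^esub> \<iota> g"
  proof (rule extensionalityI[OF \<iota>_extensional])
    show "\<iota> f \<otimes>\<^bsub>BH\<^esub> \<iota> g \<in> extensional (units H)" using mH by (simp add: Bij_def)
    fix p assume p: "p \<in> units H"
    then obtain x where x: "p = (x, 0)" "x \<in> G0" using H_simps(2) by auto
    have xT: "x \<in> topspace T" using x(2) by (simp add: topspace_unit)
    have gx: "g x \<in> G0" using Bij_closed[OF fg(2) xT] by (simp add: topspace_unit)
    have "(\<iota> f \<otimes>\<^bsub>BH\<^esub> \<iota> g) p = \<iota> f (\<iota> g p)" using \<iota>_Bij fg p by (simp add: BijGroup_mult_apply)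
    also have "\<dots> = (f (g x), 0)" using x \<iota>_apply gx by simp
    also have "\<dots> = \<iota> (f \<otimes>\<^bsub>BT\<^esub> g) p" using x \<iota>_apply[OF x(2)] BijGroup_mult_apply[OF fg xT] by simp
    finally show "\<iota> (f \<otimes>\<^bsub>BT\<^esub> g) p = (\<iota> f \<otimes>\<^bsub>BH\<^esub> \<iota> g) p" by simp
  qed
qed

sublocale BH: group "BijGroup (units H)" by (rule group_BijGroup)

sublocale I: group_hom "BijGroup (topspace T)" "BijGroup (units H)" \<iota>
  by unfold_locales (rule \<iota>_hom)

lemma full_group_G_eq: "full_group G = BT\<lparr>carrier := G.F\<rparr>"
proof -
  have "full_group G = BT\<lparr>carrier := carrier (full_group G)\<rparr>" by (simp add: full_group_def topspace_unit)
  then show ?thesis by (simp add: full_group_carrier)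
qed

lemma full_group_H_eq: "full_group H = BH\<lparr>carrier := \<iota> ` H.F\<rparr>"
proof -
  have "full_group H = BH\<lparr>carrier := carrier (full_group H)\<rparr>" by (simp add: full_group_def)
  then show ?thesis by (simp add: full_group_H)
qed

lemma subgroup_FG: "subgroup (\<iota> ` G.F) BH" and subgroup_FH: "subgroup (\<iota> ` H.F) BH"
  using I.subgroup_img_is_subgroup[OF G.subgroup_F] I.subgroup_img_is_subgroup[OF H.subgroup_F] by auto

lemma F_car: "G.F \<subseteq> carrier BT" "H.F \<subseteq> carrier BT"
  using subgroup.subset[OF G.subgroup_F] subgroup.subset[OF H.subgroup_F] by auto

lemma derived_G_eq: "\<iota> ` full_group_derived G = derived BH (\<iota> ` G.F)"
  unfolding full_group_derived_def full_group_G_eq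
  using G.B.derived_consistent[OF order_refl G.subgroup_F] I.derived_img[OF F_car(1)] by simp

lemma derived_H_eq: "full_group_derived H = derived BH (\<iota> ` H.F)"
  unfolding full_group_derived_def full_group_H_eq
  using BH.derived_consistent[OF order_refl subgroup_FH] by simp

lemma \<iota>_mem: "f \<in> carrier BT \<Longrightarrow> S \<subseteq> carrier BT \<Longrightarrow> \<iota> f \<in> \<iota> ` S \<longleftrightarrow> f \<in> S"
  using inj_on_image_mem_iff[OF \<iota>_inj] by blast

lemma \<Lambda>_car: "\<Lambda> \<in> carrier BT" using \<Lambda>_F F_car by blast

lemma \<iota>_l: "\<iota> l = \<iota> \<Lambda>"
  by (rule \<iota>_eqI) (simp add: topspace_unit)

lemma exists_correction_H: "\<exists>\<beta>\<in>G.F. \<iota> \<beta> \<otimes>\<^bsub>BH\<^esub> \<iota> \<Lambda> \<in> derived BH (\<iota> ` H.F)"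
proof -
  obtain \<beta> where \<beta>: "\<beta> \<in> G.F" "\<beta> \<otimes>\<^bsub>BT\<^esub> \<Lambda> \<in> derived BT H.F" using exists_correction by blast
  have "\<iota> (\<beta> \<otimes>\<^bsub>BT\<^esub> \<Lambda>) \<in> \<iota> ` derived BT H.F" using \<beta>(2) by blast
  then show ?thesis using \<beta>(1) \<Lambda>_car F_car I.derived_img[OF F_car(2)] by (intro bexI[of _ \<beta>]) auto
qed

text \<open>\<open>\<iota>\<close> is an injective homomorphism, so each hypothesis of
  \<open>normalizer_extension\<close> is the image of a statement about germs on the unit space of
  G.\<close>

lemma normalizer_maximal:
  assumes afpi: "almost_finite H \<or> purely_infinite H"
    and inj: "inj_on (abelianization_map (full_group G) (full_group H) \<iota>) (carrier (abelianization (full_group G)))"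
    and \<beta>: "\<beta> \<in> G.F" "\<iota> \<beta> \<otimes>\<^bsub>BH\<^esub> \<iota> \<Lambda> \<in> derived BH (\<iota> ` H.F)"
  defines "DG \<equiv> derived BH (\<iota> ` G.F)" and "DH \<equiv> derived BH (\<iota> ` H.F)"
  defines "M \<equiv> DG \<union> (DG #>\<^bsub>BH\<^esub> (\<iota> \<beta> \<otimes>\<^bsub>BH\<^esub> \<iota> \<Lambda>))"
  shows "DG \<inter> (DG #>\<^bsub>BH\<^esub> (\<iota> \<beta> \<otimes>\<^bsub>BH\<^esub> \<iota> \<Lambda>)) = {} \<and>
    M = {x \<in> DH. x \<in> \<iota> ` G.F \<or> x \<otimes>\<^bsub>BH\<^esub> \<iota> \<Lambda> \<in> \<iota> ` G.F} \<and>
    M = normalizer (BH\<lparr>carrier := DH\<rparr>) DG \<and>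
    maximal_subgroup M (BH\<lparr>carrier := DH\<rparr>) \<and>
    DG \<lhd> BH\<lparr>carrier := M\<rparr> \<and>
    card (rcosets\<^bsub>BH\<lparr>carrier := M\<rparr>\<^esub> DG) = 2"
  unfolding M_def DG_def DH_def
proof (rule BH.normalizer_extension[OF subgroup_FG subgroup_FH])
  have ne: "topspace T \<noteq> {}" using cantor_spaceD(5)[OF cantor] .
  have dG: "derived BH (\<iota> ` G.F) = \<iota> ` derived BT G.F" and dH: "derived BH (\<iota> ` H.F) = \<iota> ` derived BT H.F"
    using I.derived_img F_car by auto
  have dcar: "derived BT G.F \<subseteq> carrier BT" "derived BT H.F \<subseteq> carrier BT"
    using G.B.derived_in_carrier F_car by auto
  show "\<iota> ` G.F \<subseteq> \<iota> ` H.F" using F_subset by blast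
  show "\<iota> \<Lambda> \<in> \<iota> ` H.F" using \<Lambda>_F by blast
  show "\<iota> \<Lambda> \<notin> \<iota> ` G.F" using \<iota>_mem[OF \<Lambda>_car F_car(1)] \<Lambda>_notin_G[OF ne] by blast
  show "\<iota> \<Lambda> \<otimes>\<^bsub>BH\<^esub> \<iota> \<Lambda> = \<one>\<^bsub>BH\<^esub>"
    using I.hom_mult[OF \<Lambda>_car \<Lambda>_car] \<Lambda>_invol I.hom_one by simp
  show "\<iota> \<Lambda> \<otimes>\<^bsub>BH\<^esub> x \<otimes>\<^bsub>BH\<^esub> \<iota> \<Lambda> \<in> \<iota> ` G.F" if x: "x \<in> \<iota> ` G.F" for x
  proof -
    obtain f where f: "f \<in> G.F" "x = \<iota> f" using x by blast
    have fc: "f \<in> carrier BT" using f(1) F_car by blast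
    have "\<iota> (\<Lambda> \<otimes>\<^bsub>BT\<^esub> f \<otimes>\<^bsub>BT\<^esub> \<Lambda>) \<in> \<iota> ` G.F" using \<Lambda>_conj_G[OF f(1)] by blast
    then show ?thesis using f(2) fc \<Lambda>_car by simp
  qed
  show "x \<in> \<iota> ` G.F \<or> x \<otimes>\<^bsub>BH\<^esub> \<iota> \<Lambda> \<in> \<iota> ` G.F"
    if x: "x \<in> \<iota> ` H.F" and n: "\<And>d. d \<in> derived BH (\<iota> ` G.F) \<Longrightarrow> x \<otimes>\<^bsub>BH\<^esub> d \<otimes>\<^bsub>BH\<^esub> inv\<^bsub>BH\<^esub> x \<in> \<iota> ` G.F" for x
  proof -
    obtain f where f: "f \<in> H.F" "x = \<iota> f" using x by blast
    have fc: "f \<in> carrier BT" using f(1) F_car by blast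
    have "f \<in> G.F \<or> f \<otimes>\<^bsub>BT\<^esub> \<Lambda> \<in> G.F"
    proof (rule normalizer_G[OF f(1)])
      fix d assume d: "d \<in> derived BT G.F"
      have dc: "d \<in> carrier BT" using d dcar by blast
      have "\<iota> f \<otimes>\<^bsub>BH\<^esub> \<iota> d \<otimes>\<^bsub>BH\<^esub> inv\<^bsub>BH\<^esub> \<iota> f \<in> \<iota> ` G.F" using n[of "\<iota> d"] d f(2) dG by blast
      then have "\<iota> (f \<otimes>\<^bsub>BT\<^esub> d \<otimes>\<^bsub>BT\<^esub> inv\<^bsub>BT\<^esub> f) \<in> \<iota> ` G.F" using fc dc by simp
      then show "f \<otimes>\<^bsub>BT\<^esub> d \<otimes>\<^bsub>BT\<^esub> inv\<^bsub>BT\<^esub> f \<in> G.F"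
        using \<iota>_mem[OF _ F_car(1)] fc dc by (meson G.B.inv_closed G.B.m_closed)
    qed
    then show ?thesis using f(2) fc \<Lambda>_car by (metis I.hom_mult image_eqI)
  qed
  show "derived BH (\<iota> ` H.F) \<subseteq> K"
    if K: "subgroup K BH" "K \<subseteq> \<iota> ` H.F" "derived BH (\<iota> ` G.F) \<subseteq> K"
      and x: "x \<in> K" "x \<notin> \<iota> ` G.F" "x \<otimes>\<^bsub>BH\<^esub> \<iota> \<Lambda> \<notin> \<iota> ` G.F" for K x
  proof -
    \<comment> \<open>Maximality was proved for groups of permutations of the unit space of G, so it
      is applied to the preimage of K in F(H).\<close>
    define K0 where "K0 = {f \<in> H.F. \<iota> f \<in> K}"
    obtain f where f: "f \<in> H.F" "x = \<iota> f" using x K by blast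
    have fc: "f \<in> carrier BT" using f(1) F_car by blast
    have K0c: "f \<in> carrier BT" if "f \<in> K0" for f using that F_car by (auto simp: K0_def)
    have "derived BT H.F \<subseteq> K0"
    proof (rule derived_subset_of_mixed)
      show "subgroup K0 BT"
      proof (rule G.B.subgroupI)
        show "K0 \<subseteq> carrier BT" using K0c by blast
        show "K0 \<noteq> {}" using f x(1) by (auto simp: K0_def)
        show "inv\<^bsub>BT\<^esub> f \<in> K0" if "f \<in> K0" for f
          using that K0c[OF that] H.F_inv subgroup.m_inv_closed[OF K(1)] by (simp add: K0_def)
        show "f \<otimes>\<^bsub>BT\<^esub> g \<in> K0" if "f \<in> K0" "g \<in> K0" for f g
          using that K0c H.F_mult subgroup.m_closed[OF K(1)] by (simp add: K0_def)
      qed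
      show "K0 \<subseteq> H.F" by (auto simp: K0_def)
      show "derived BT G.F \<subseteq> K0"
        using G_derived_subset G.B.derived_incl[OF order_refl H.subgroup_F] K(3) unfolding dG K0_def by blast
      show "f \<in> K0" using f x(1) by (simp add: K0_def)
      show "f \<notin> G.F" using f x(2) by blast
      show "f \<otimes>\<^bsub>BT\<^esub> \<Lambda> \<notin> G.F" using x(3) f(2) fc \<Lambda>_car by (metis I.hom_mult image_eqI)
      show "H.pinf \<or> H.afin" using afpi pinf_of_purely_infinite afin_of_almost_finite by blast
    qed
    then show ?thesis unfolding dH K0_def by blast
  qed
  show "\<exists>d\<in>derived BH (\<iota> ` H.F). d \<notin> \<iota> ` G.F \<and> d \<otimes>\<^bsub>BH\<^esub> \<iota> \<Lambda> \<notin> \<iota> ` G.F"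
  proof -
    obtain d where d: "d \<in> derived BT H.F" "d \<notin> G.F" "d \<otimes>\<^bsub>BT\<^esub> \<Lambda> \<notin> G.F" using derived_not_in_G[OF ne] by blast
    have dc: "d \<in> carrier BT" using d(1) dcar by blast
    have "\<iota> d \<notin> \<iota> ` G.F" "\<iota> (d \<otimes>\<^bsub>BT\<^esub> \<Lambda>) \<notin> \<iota> ` G.F"
      using \<iota>_mem[OF _ F_car(1)] dc d(2,3) \<Lambda>_car G.B.m_closed by blast+
    then show ?thesis unfolding dH using d(1) dc \<Lambda>_car by auto
  qed
  \<comment> \<open>This is where injectivity on abelianizations enters: an element of F(G) that
    becomes trivial in the abelianization of F(H) is already trivial in that of F(G).\<close>
  show "\<iota> ` G.F \<inter> derived BH (\<iota> ` H.F) \<subseteq> derived BH (\<iota> ` G.F)"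
  proof
    fix y assume y: "y \<in> \<iota> ` G.F \<inter> derived BH (\<iota> ` H.F)"
    then obtain f where f: "f \<in> G.F" "y = \<iota> f" by blast
    have g: "group (full_group G)" "group (full_group H)"
      unfolding full_group_G_eq full_group_H_eq
      using G.B.subgroup_imp_group[OF G.subgroup_F] BH.subgroup_imp_group[OF subgroup_FH] by auto
    have h: "\<iota> \<in> hom (full_group G) (full_group H)"
      unfolding full_group_G_eq full_group_H_eq
      using F_subset F_car by (intro homI) (auto simp: subset_iff)
    have "f \<in> full_group_derived G"
      unfolding full_group_derived_def
      by (rule abelianization_map_inj_kernel[OF g h inj])
        (use f y derived_H_eq in \<open>auto simp: full_group_G_eq full_group_derived_def\<close>)
    then show "y \<in> derived BH (\<iota> ` G.F)" using f(2) derived_G_eq by blast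
  qed
  show "\<iota> \<beta> \<in> \<iota> ` G.F" using \<beta> by blast
  show "\<iota> \<beta> \<otimes>\<^bsub>BH\<^esub> \<iota> \<Lambda> \<in> derived BH (\<iota> ` H.F)" using \<beta> by blast
qed

end

theorem theorem5p14:
  fixes G :: "'g tgroupoid" and H :: "('g \<times> int) tgroupoid"
    and lam :: "int \<Rightarrow> 'g \<Rightarrow> 'g" and a :: int
    and \<iota> :: "('g \<Rightarrow> 'g) \<Rightarrow> 'g \<times> int \<Rightarrow> 'g \<times> int"
    and DG DH :: "('g \<times> int \<Rightarrow> 'g \<times> int) set"
    and M :: "('g \<Rightarrow> 'g) \<Rightarrow> ('g \<times> int \<Rightarrow> 'g \<times> int) set"
  assumes ample: "ample_groupoid G" and cantor: "cantor_space (unit_top G)"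
    and action: "Z2_action G lam" and free: "free_on_units G lam"
    and H_eq: "H = semidirect G lam"
    and effective: "effective_groupoid G" "effective_groupoid H"
    and minimal: "minimal_groupoid G" "minimal_groupoid H"
    and af_or_pi: "almost_finite G \<or> purely_infinite G" "almost_finite H \<or> purely_infinite H"
    and a: "a \<in> carrier Z2" "a \<noteq> \<one>\<^bsub>Z2\<^esub>"
    and \<iota>_eq: "\<iota> = transport_units G lam"
    and DG_eq: "DG = \<iota> ` full_group_derived G"
    and DH_eq: "DH = full_group_derived H"
    and M_eq: "M = (\<lambda>\<beta>. DG \<union>
      (DG #>\<^bsub>full_group H\<^esub> (\<iota> \<beta> \<otimes>\<^bsub>full_group H\<^esub> \<iota> (lam a))))"
    and notin: "\<iota> (lam a) \<notin> DH"
  shows "(\<exists>\<beta> \<in> carrier (full_group G). \<iota> \<beta> \<otimes>\<^bsub>full_group H\<^esub> \<iota> (lam a) \<in> DH) \<and>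
    (inj_on (abelianization_map (full_group G) (full_group H) \<iota>)
        (carrier (abelianization (full_group G))) \<longrightarrow>
      (\<forall>\<beta> \<in> carrier (full_group G). \<iota> \<beta> \<otimes>\<^bsub>full_group H\<^esub> \<iota> (lam a) \<in> DH \<longrightarrow>
        DG \<inter> (DG #>\<^bsub>full_group H\<^esub> (\<iota> \<beta> \<otimes>\<^bsub>full_group H\<^esub> \<iota> (lam a))) = {} \<and>
        M \<beta> = normalizer ((full_group H)\<lparr>carrier := DH\<rparr>) DG \<and>
        (\<forall>\<beta>' \<in> carrier (full_group G). \<iota> \<beta>' \<otimes>\<^bsub>full_group H\<^esub> \<iota> (lam a) \<in> DH \<longrightarrow> M \<beta>' = M \<beta>) \<and>
        maximal_subgroup (M \<beta>) ((full_group H)\<lparr>carrier := DH\<rparr>) \<and>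
        DG \<lhd> (full_group H)\<lparr>carrier := M \<beta>\<rparr> \<and>
        card (rcosets\<^bsub>(full_group H)\<lparr>carrier := M \<beta>\<rparr>\<^esub> DG) = 2))"
proof -
  have grpd: "groupoid G"
    using ample by (simp add: ample_groupoid_def etale_groupoid_def topological_groupoid_def)
  interpret S: semidirect_Z2 G lam H
    by unfold_locales (use grpd ample cantor action free H_eq effective minimal in auto)
  have a1: "a = 1" using a by (auto simp: Z2_simps)
  have \<iota>: "\<iota> = S.\<iota>" by (simp add: \<iota>_eq S.\<iota>_def)
  have l: "\<iota> (lam a) = S.\<iota> S.\<Lambda>" unfolding \<iota> a1 S.l_def[symmetric] by (rule S.\<iota>_l)
  have DG: "DG = derived S.BH (S.\<iota> ` S.G.F)" unfolding DG_eq \<iota> by (rule S.derived_G_eq)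
  have DH: "DH = derived S.BH (S.\<iota> ` S.H.F)" unfolding DH_eq by (rule S.derived_H_eq)
  have FG: "carrier (full_group G) = S.G.F" by (simp add: S.full_group_G_eq)
  have mult: "x \<otimes>\<^bsub>full_group H\<^esub> y = x \<otimes>\<^bsub>S.BH\<^esub> y" for x y by (simp add: S.full_group_H_eq)
  have coset: "DG #>\<^bsub>full_group H\<^esub> x = DG #>\<^bsub>S.BH\<^esub> x" for x by (simp add: r_coset_def mult)
  have upd: "(full_group H)\<lparr>carrier := Y\<rparr> = S.BH\<lparr>carrier := Y\<rparr>" for Y by (simp add: S.full_group_H_eq)
  have M: "M \<beta> = DG \<union> (DG #>\<^bsub>S.BH\<^esub> (S.\<iota> \<beta> \<otimes>\<^bsub>S.BH\<^esub> S.\<iota> S.\<Lambda>))" for \<beta>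
    unfolding M_eq coset mult l unfolding \<iota> ..
  show ?thesis
    unfolding FG mult coset upd l
  proof (intro conjI impI ballI)
    show "\<exists>\<beta>\<in>S.G.F. \<iota> \<beta> \<otimes>\<^bsub>S.BH\<^esub> S.\<iota> S.\<Lambda> \<in> DH" unfolding \<iota> DH by (rule S.exists_correction_H)
    assume inj: "inj_on (abelianization_map (full_group G) (full_group H) \<iota>) (carrier (abelianization (full_group G)))"
    fix \<beta> assume \<beta>: "\<beta> \<in> S.G.F" "\<iota> \<beta> \<otimes>\<^bsub>S.BH\<^esub> S.\<iota> S.\<Lambda> \<in> DH"
    note m = S.normalizer_maximal[OF af_or_pi(2) inj[unfolded \<iota>], folded DG DH]
    note m\<beta> = m[OF \<beta>[unfolded \<iota>]]
    show "DG \<inter> (DG #>\<^bsub>S.BH\<^esub> (\<iota> \<beta> \<otimes>\<^bsub>S.BH\<^esub> S.\<iota> S.\<Lambda>)) = {}"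
      "M \<beta> = normalizer (S.BH\<lparr>carrier := DH\<rparr>) DG"
      "maximal_subgroup (M \<beta>) (S.BH\<lparr>carrier := DH\<rparr>)"
      "DG \<lhd> S.BH\<lparr>carrier := M \<beta>\<rparr>"
      "card (rcosets\<^bsub>S.BH\<lparr>carrier := M \<beta>\<rparr>\<^esub> DG) = 2"
      unfolding \<iota> M by (insert m\<beta>, elim conjE, assumption)+
    fix \<beta>' assume \<beta>': "\<beta>' \<in> S.G.F" "\<iota> \<beta>' \<otimes>\<^bsub>S.BH\<^esub> S.\<iota> S.\<Lambda> \<in> DH"
    \<comment> \<open>Both sets are the normalizer, in whose description neither choice
      occurs.\<close>
    show "M \<beta>' = M \<beta>" using m\<beta> m[OF \<beta>'[unfolded \<iota>]] unfolding M by simp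
  qed
qed

end
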